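(* Let $X\in C^3(B,\mathbb R^3)$ be an immersion of the closed unit disc $B$, with unit normal $N$. Let $\mathbf G$ be a weight matrix with constant $g_0\in[0,+\infty)$, and let $X$ be $\mu$-stable (with respect to the weighted metric $ds_g^2$ induced by $\mathbf G$) with a real number $\mu>0$ and a function $q\in C^1(B,\mathbb R)$. Assume that $$\mu>\frac{1+g_0}{2}\quad\text{and}\quad q\ge 0\ \text{in}\ B.$$ Let $X$ represent a geodesic disc $\mathfrak B_r(X_0)$ of radius $r>0$ and center $X_0\in\mathbb R^3$. Then the area $\mathcal A[X]$ of the immersion satisfies $$\mathcal A[X]\le\frac{2\pi\mu}{2\mu-(1+g_0)}\,r^2 .$$
   Context: $B=\{(u,v)\in\mathbb R^2: u^2+v^2\le 1\}$. Vectors in $\mathbb R^3$ are rows, and the superscript $t$ denotes transposition. An immersion $X=X(u,v)\in C^3(B,\mathbb R^3)$ has $\mathrm{rank}\,\partial X=2$ in $B$. Its unit normal is $N=\frac{X_u\times X_v}{|X_u\times X_v|}$, its area element is $W=|X_u\times X_v|$, its area is $\mathcal A[X]=\iint_B W\,du\,dv$, and $K$ is its Gaussian curvature (with respect to the metric $ds^2$ induced from $\mathbb R^3$). Weight matrix: a symmetric positive definite $\mathbf G=\mathbf G(X,Z)\in C^2(\mathbb R^3\times(\mathbb R^3\setminus\{0\}),\mathbb R^{3\times 3})$ such that for all $(X,Z)\in\mathbb R^3\times(\mathbb R^3\setminus\{0\})$: (i) $\mathbf G(X,Z)=\mathbf G(X,\lambda Z)$ for all real $\lambda>0$; (ii)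 $\mathbf G(X,Z)Z^t=Z^t$; (iii) $(1+g_0)^{-1}|\xi|^2\le\xi\,\mathbf G(X,Z)\,\xi^t\le(1+g_0)|\xi|^2$ for all $\xi\in\mathbb R^3$, with a real constant $g_0\in[0,+\infty)$; (iv) $\det\mathbf G(X,Z)=1$. Weighted metric: with $u^1=u$, $u^2=v$, set $h_{ij}=X_{u^i}\,\mathbf G(X,N)\,X_{u^j}^t$ and $ds_g^2=h_{ij}\,du^i\,du^j$ (summation convention). Let $(h^{ij})$ be the inverse matrix of $(h_{ij})$ and set $\nabla_{ds_g^2}(\varphi,\psi)=h^{ij}\varphi_{u^i}\psi_{u^j}$. $\mu$-stability: $X$ is $\mu$-stable with real $\mu>0$ and $q\in C^1(B,\mathbb R)$ if $q-K\ge 0$ in $B$ and $$\iint_B\nabla_{ds_g^2}(\varphi,\varphi)\,W\,du\,dv\ge\mu\iint_B(q-K)W\varphi^2\,du\,dv\quad\text{for all }\varphi\in C_0^\infty(B,\mathbb R).$$ Geodesic disc: $X$ represents a geodesic disc $\mathfrak B_r(X_0)$ of radius $r$ and center $X_0$ if the whole surface, with its induced (non-weighted) metric, is described by geodesic polar coordinates $(\varrho,\varphi)\in[0,r]\times[0,2\pi]$ around $X_0$. In these coordinates the metric is $d\varrho^2+P(\varrho,\varphi)\,d\varphi^2$ with $P>0$ on $(0,r]\times[0,2\pi)$, $\lim_{\varrho\to0_+}P(\varrho,\varphi)=0$ and $\lim_{\varrho\to0_+}\frac{\partial}{\partial\varrho}\sqrt{P(\varrho,\varphi)}=1$. The boundary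 of the surface is the curve $\varrho=r$. *)

theory Defs
  imports "HOL-Analysis.Analysis"
begin

text \<open>
  Functions of class \<open>C\<^sup>k\<close> on a set \<open>S\<close>, via continuous partial derivatives. Derivatives are taken
  within \<open>S\<close>, so that for the closed disc (convex with nonempty interior) this is the usual
  \<open>C\<^sup>k(B)\<close>: all partial derivatives up to order \<open>k\<close> exist in the interior and extend continuously
  to the boundary.
\<close>

primrec Ck_on :: "nat \<Rightarrow> 'a::euclidean_space set \<Rightarrow> ('a \<Rightarrow> 'b::real_normed_vector) \<Rightarrow> bool" where
  "Ck_on 0 S f \<longleftrightarrow> continuous_on S f"
| "Ck_on (Suc k) S f \<longleftrightarrow>
     (\<exists>D. (\<forall>x\<in>S. (f has_derivative (\<lambda>h. \<Sum>b\<in>Basis. (h \<bullet> b) *\<^sub>R D b x)) (at x within S)) \<and>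
          (\<forall>b\<in>Basis. Ck_on k S (D b)))"

abbreviation disc :: "(real^2) set" where
  "disc \<equiv> cball 0 1"

definition pd :: "2 \<Rightarrow> (real^2 \<Rightarrow> 'b::real_normed_vector) \<Rightarrow> real^2 \<Rightarrow> 'b" where
  "pd i f w = frechet_derivative f (at w within disc) (axis i 1)"

definition immersion :: "(real^2 \<Rightarrow> real^3) \<Rightarrow> bool" where
  "immersion X \<longleftrightarrow>
     Ck_on 3 disc X \<and>
     (\<forall>w\<in>disc. rank (matrix (frechet_derivative X (at w within disc))) = 2)"

definition area_element :: "(real^2 \<Rightarrow> real^3) \<Rightarrow> real^2 \<Rightarrow> real" where
  "area_element X w = norm (cross3 (pd 1 X w) (pd 2 X w))"

definition unit_normal :: "(real^2 \<Rightarrow> real^3) \<Rightarrow> real^2 \<Rightarrow> real^3" where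
  "unit_normal X w = cross3 (pd 1 X w) (pd 2 X w) /\<^sub>R norm (cross3 (pd 1 X w) (pd 2 X w))"

definition area :: "(real^2 \<Rightarrow> real^3) \<Rightarrow> real" where
  "area X = integral disc (area_element X)"

definition first_form :: "(real^2 \<Rightarrow> real^3) \<Rightarrow> real^2 \<Rightarrow> real^2^2" where
  "first_form X w = (\<chi> i j. pd i X w \<bullet> pd j X w)"

definition second_form :: "(real^2 \<Rightarrow> real^3) \<Rightarrow> real^2 \<Rightarrow> real^2^2" where
  "second_form X w = (\<chi> i j. pd j (pd i X) w \<bullet> unit_normal X w)"

definition gauss_curvature :: "(real^2 \<Rightarrow> real^3) \<Rightarrow> real^2 \<Rightarrow> real" where
  "gauss_curvature X w = det (second_form X w) / det (first_form X w)"

definition weight_matrix :: "(real^3 \<Rightarrow> real^3 \<Rightarrow> real^3^3) \<Rightarrow> real \<Rightarrow> bool" where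
  "weight_matrix G g0 \<longleftrightarrow>
     0 \<le> g0 \<and>
     Ck_on 2 (UNIV \<times> (UNIV - {0})) (\<lambda>(x, z). G x z) \<and>
     (\<forall>x z. z \<noteq> 0 \<longrightarrow>
        transpose (G x z) = G x z \<and>
        (\<forall>\<xi>. \<xi> \<noteq> 0 \<longrightarrow> \<xi> \<bullet> (G x z *v \<xi>) > 0) \<and>
        (\<forall>c>0. G x z = G x (c *\<^sub>R z)) \<and>
        G x z *v z = z \<and>
        (\<forall>\<xi>. inverse (1 + g0) * (norm \<xi>)\<^sup>2 \<le> \<xi> \<bullet> (G x z *v \<xi>) \<and>
             \<xi> \<bullet> (G x z *v \<xi>) \<le> (1 + g0) * (norm \<xi>)\<^sup>2) \<and>
        det (G x z) = 1)"

definition weighted_metric ::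
    "(real^3 \<Rightarrow> real^3 \<Rightarrow> real^3^3) \<Rightarrow> (real^2 \<Rightarrow> real^3) \<Rightarrow> real^2 \<Rightarrow> real^2^2" where
  "weighted_metric G X w = (\<chi> i j. pd i X w \<bullet> (G (X w) (unit_normal X w) *v pd j X w))"

definition weighted_grad ::
    "(real^3 \<Rightarrow> real^3 \<Rightarrow> real^3^3) \<Rightarrow> (real^2 \<Rightarrow> real^3) \<Rightarrow>
     (real^2 \<Rightarrow> real) \<Rightarrow> (real^2 \<Rightarrow> real) \<Rightarrow> real^2 \<Rightarrow> real" where
  "weighted_grad G X \<phi> \<psi> w =
     (\<Sum>i\<in>UNIV. \<Sum>j\<in>UNIV. matrix_inv (weighted_metric G X w) $ i $ j * pd i \<phi> w * pd j \<psi> w)"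

text \<open>\<open>C\<^sub>0\<^sup>\<infinity>(B)\<close>: smooth functions with compact support in the open disc, extended by zero.\<close>

definition test_function :: "(real^2 \<Rightarrow> real) \<Rightarrow> bool" where
  "test_function \<phi> \<longleftrightarrow> (\<forall>k. Ck_on k UNIV \<phi>) \<and> closure {w. \<phi> w \<noteq> 0} \<subseteq> ball 0 1"

definition mu_stable ::
    "(real^3 \<Rightarrow> real^3 \<Rightarrow> real^3^3) \<Rightarrow> (real^2 \<Rightarrow> real^3) \<Rightarrow> real \<Rightarrow> (real^2 \<Rightarrow> real) \<Rightarrow> bool" where
  "mu_stable G X \<mu> q \<longleftrightarrow>
     \<mu> > 0 \<and> Ck_on 1 disc q \<and>
     (\<forall>w\<in>disc. q w - gauss_curvature X w \<ge> 0) \<and>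
     (\<forall>\<phi>. test_function \<phi> \<longrightarrow>
        integral disc (\<lambda>w. weighted_grad G X \<phi> \<phi> w * area_element X w)
        \<ge> \<mu> * integral disc (\<lambda>w. (q w - gauss_curvature X w) * area_element X w * (\<phi> w)\<^sup>2))"

text \<open>
  Geodesic polar coordinates are a map \<open>\<Phi>(\<rho>, \<theta>)\<close> from the closed rectangle onto the parameter
  disc. It collapses \<open>\<rho> = 0\<close> to the parameter \<open>w0\<close> of the centre, is closed up at
  \<open>\<theta> = 0, 2\<pi>\<close>, and is otherwise one-to-one. A surface of class \<open>C\<^sup>3\<close> has a metric of
  class \<open>C\<^sup>2\<close>, hence a geodesic flow of class \<open>C\<^sup>1\<close>; this is exactly the regularity of
  \<open>\<Phi>\<close> and \<open>\<partial>\<Phi>/\<partial>\<rho>\<close> below, and in general no more is available. That the rays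
  \<open>\<theta> = const\<close> are geodesics follows from the form \<open>d\<rho>\<^sup>2 + P d\<theta>\<^sup>2\<close> of the metric.
\<close>

definition polar_rect :: "real \<Rightarrow> (real \<times> real) set" where
  "polar_rect r = {0..r} \<times> {0..2*pi}"

definition d_rho :: "real \<Rightarrow> (real \<times> real \<Rightarrow> 'b::real_normed_vector) \<Rightarrow> real \<times> real \<Rightarrow> 'b" where
  "d_rho r F p = frechet_derivative F (at p within polar_rect r) (1, 0)"

definition d_theta :: "real \<Rightarrow> (real \<times> real \<Rightarrow> 'b::real_normed_vector) \<Rightarrow> real \<times> real \<Rightarrow> 'b" where
  "d_theta r F p = frechet_derivative F (at p within polar_rect r) (0, 1)"

definition geodesic_disc :: "(real^2 \<Rightarrow> real^3) \<Rightarrow> real \<Rightarrow> real^3 \<Rightarrow> bool" where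
  "geodesic_disc X r X0 \<longleftrightarrow>
     (\<exists>(\<Phi> :: real \<times> real \<Rightarrow> real^2) (P :: real \<Rightarrow> real \<Rightarrow> real) w0.
        w0 \<in> disc \<and> X w0 = X0 \<and>
        Ck_on 1 (polar_rect r) \<Phi> \<and> Ck_on 1 (polar_rect r) (d_rho r \<Phi>) \<and>
        (\<forall>\<theta>\<in>{0..2*pi}. \<Phi> (0, \<theta>) = w0) \<and>
        (\<forall>\<rho>\<in>{0..r}. \<Phi> (\<rho>, 2*pi) = \<Phi> (\<rho>, 0)) \<and>
        bij_betw \<Phi> ({0<..r} \<times> {0..<2*pi}) (disc - {w0}) \<and>
        \<Phi> ` ({r} \<times> {0..2*pi}) = sphere 0 1 \<and>
        (\<forall>\<rho>\<in>{0<..r}. \<forall>\<theta>\<in>{0..2*pi}.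
           d_rho r (X \<circ> \<Phi>) (\<rho>, \<theta>) \<bullet> d_rho r (X \<circ> \<Phi>) (\<rho>, \<theta>) = 1 \<and>
           d_rho r (X \<circ> \<Phi>) (\<rho>, \<theta>) \<bullet> d_theta r (X \<circ> \<Phi>) (\<rho>, \<theta>) = 0 \<and>
           d_theta r (X \<circ> \<Phi>) (\<rho>, \<theta>) \<bullet> d_theta r (X \<circ> \<Phi>) (\<rho>, \<theta>) = P \<rho> \<theta>) \<and>
        (\<forall>\<rho>\<in>{0<..r}. \<forall>\<theta>\<in>{0..<2*pi}. P \<rho> \<theta> > 0) \<and>
        (\<forall>\<theta>\<in>{0..<2*pi}.
           ((\<lambda>\<rho>. P \<rho> \<theta>) \<longlongrightarrow> 0) (at_right 0) \<and>
           ((\<lambda>\<rho>. deriv (\<lambda>s. sqrt (P s \<theta>)) \<rho>) \<longlongrightarrow> 1) (at_right 0)))"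

end

theory Submission
  imports Defs
begin

text \<open>
  Let \<open>\<rho>\<close> be the geodesic distance from the centre and \<open>a(s)\<close> the area of the geodesic disc of radius
  \<open>s < r\<close>. The stability inequality is tested with the cone \<open>\<phi> = (1 - \<rho>/s)\<^sub>+\<close>.

  Since \<open>|\<nabla>\<phi>| = 1/s\<close> in the induced metric, and the weighted gradient exceeds the induced one at most
  by the factor \<open>1 + g0\<close> (\<open>weighted_grad_le\<close>), the left side is at most \<open>(1 + g0) a(s) / s\<^sup>2\<close>. On the
  right, \<open>q \<ge> 0\<close> is dropped, and in polar coordinates, with area density \<open>f = \<surd>P\<close>, there remains
  \<open>- \<mu> \<integral>\<integral> K f \<phi>\<^sup>2\<close>. By Jacobi's equation \<open>f\<^sub>\<rho>\<^sub>\<rho> = - K f\<close> (\<open>Jacobi_1\<close>, \<open>Jacobi_2\<close>) and two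
  integrations by parts along each ray (\<open>radial_identity\<close>) this equals \<open>\<mu> (2 a(s) / s\<^sup>2 - 2\<pi>)\<close>. The
  boundary term \<open>2\<pi>\<close> comes from \<open>f\<^sub>\<rho> = 1\<close> at the centre. So
  \<open>(2\<mu> - (1 + g0)) a(s) \<le> 2\<pi>\<mu> s\<^sup>2\<close> (\<open>area_growth\<close>), and \<open>s \<rightarrow> r\<close> gives the theorem.

  Two points need care. Jacobi's equation links the curvature, given by the second fundamental form, to
  a polar map \<open>\<Phi>\<close> of class \<open>C\<^sup>1\<close> with \<open>\<Phi>\<^sub>\<rho>\<close> of class \<open>C\<^sup>1\<close>, so \<open>f\<close> has no second derivative at first sight.
  It is obtained from the moving frame \<open>e = (X \<circ> \<Phi>)\<^sub>\<rho>\<close>, \<open>n \<times> e\<close>, \<open>n\<close>: the rays are geodesics, which makes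
  \<open>e\<^sub>\<rho>\<close> differentiable in \<open>\<theta>\<close>, and mixed derivatives may be swapped (\<open>partial_swap\<close>).

  Secondly, the cone is not smooth, and regularity of \<open>\<rho>\<close> across the cut \<open>\<theta> = 0\<close> is awkward to
  establish. The cone is therefore mollified, with the convolution written as an integral over the polar
  rectangle. Its derivative is found by integration by parts in \<open>(\<rho>, \<theta>)\<close>, where the contributions of
  the two sides of the cut cancel (\<open>weak_divergence\<close>, \<open>pd_cone_test\<close>). The mollified cones and their
  gradients are bounded and converge off a null set (\<open>average_bound\<close>, \<open>average_tendsto\<close>), so the
  stability inequality passes to the limit.
\<close>

section \<open>Functions of class \<open>C\<^sup>k\<close>\<close>

text \<open>
  A derivative within a convex set with interior points is determined, also at boundary points:
  it is determined on every segment into the set, and the directions of these segments span the space.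
  So the partial derivatives taken within the closed disc or the closed polar rectangle can be
  computed from any derivative that is at hand.
\<close>
lemma has_derivative_unique_convex:
  fixes f :: "'a::euclidean_space \<Rightarrow> 'b::real_normed_vector"
  assumes S: "convex S" "interior S \<noteq> {}" and x: "x \<in> S"
    and f1: "(f has_derivative f1) (at x within S)" and f2: "(f has_derivative f2) (at x within S)"
  shows "f1 = f2"
proof -
  define L where "L = (\<lambda>h. f1 h - f2 h)"
  have L: "((\<lambda>y. 0::'b) has_derivative L) (at x within S)"
    using has_derivative_diff[OF f1 f2] by (simp add: L_def)
  interpret L: bounded_linear L using L by (rule has_derivative_bounded_linear)
  have L0: "L (y - x) = 0" if y: "y \<in> S" for y
  proof -
    let ?c = "\<lambda>t::real. x + t *\<^sub>R (y - x)"
    have cS: "?c ` {0..1} \<subseteq> S"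
    proof safe
      fix t :: real assume "t \<in> {0..1}"
      then have "(1 - t) *\<^sub>R x + t *\<^sub>R y \<in> S" using S(1) x y by (auto simp: convex_alt)
      then show "?c t \<in> S" by (simp add: algebra_simps)
    qed
    have c: "(?c has_derivative (\<lambda>t. t *\<^sub>R (y - x))) (at 0 within {0..1})"
      by (auto intro!: derivative_eq_intros)
    have "((\<lambda>y. 0::'b) has_derivative L) (at (?c 0) within ?c ` {0..1})"
      using has_derivative_subset[OF L cS] by simp
    from has_derivative_in_compose[OF c this]
    have "((\<lambda>t. 0::'b) has_vector_derivative L (y - x)) (at 0 within {0..1::real})"
      by (simp add: has_vector_derivative_def L.scaleR o_def)
    then show ?thesis
      using vector_derivative_unique_within_closed_interval[of 0 1 0 "\<lambda>t. 0::'b" "L (y - x)" 0]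
      by auto
  qed
  obtain z e where e: "e > 0" and ze: "ball z e \<subseteq> S"
    using S(2) by (metis all_not_in_conv mem_interior)
  have "L h = 0" for h
  proof -
    define t where "t = e / (2 * (norm h + 1))"
    have t: "t > 0" using e by (auto simp: t_def intro!: divide_pos_pos add_nonneg_pos)
    have "t * norm h < t * (2 * (norm h + 1))"
      using t by (intro mult_strict_left_mono) (auto simp: add_nonneg_pos)
    also have "\<dots> = e"
      using add_nonneg_pos[of "norm h" 1] by (simp add: t_def)
    finally have "t * norm h < e" .
    then have "z + t *\<^sub>R h \<in> S" "z \<in> S"
      using ze e t by (auto simp: dist_norm subset_eq)
    then have "L (z + t *\<^sub>R h - x) - L (z - x) = 0" using L0 by simp
    then show ?thesis using t by (simp add: L.add L.diff L.scaleR)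
  qed
  then show ?thesis by (auto simp: L_def)
qed

lemma Ck_on_SucI:
  assumes "\<And>x. x \<in> S \<Longrightarrow> (f has_derivative (\<lambda>h. \<Sum>b\<in>Basis. (h \<bullet> b) *\<^sub>R D b x)) (at x within S)"
    and "\<And>b. b \<in> Basis \<Longrightarrow> Ck_on k S (D b)"
  shows "Ck_on (Suc k) S f"
  using assms by auto

lemma Ck_on_Suc_imp: "Ck_on (Suc k) S f \<Longrightarrow> Ck_on k S f"
proof (induction k arbitrary: f)
  case 0
  then show ?case
    by (auto simp: continuous_on_eq_continuous_within intro: has_derivative_continuous)
next
  case (Suc k)
  obtain D where D: "\<And>x. x \<in> S \<Longrightarrow> (f has_derivative (\<lambda>h. \<Sum>b\<in>Basis. (h \<bullet> b) *\<^sub>R D b x)) (at x within S)"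
    "\<And>b. b \<in> Basis \<Longrightarrow> Ck_on (Suc k) S (D b)" using Suc.prems unfolding Ck_on.simps(2) by blast
  show ?case by (rule Ck_on_SucI[of S f D]) (use D Suc.IH in auto)
qed

lemma Ck_on_imp_continuous_on: "Ck_on k S f \<Longrightarrow> continuous_on S f"
  by (induction k) (auto dest: Ck_on_Suc_imp simp del: Ck_on.simps(2))

lemma Ck_on_cong:
  assumes "\<And>x. x \<in> S \<Longrightarrow> f x = g x" and "Ck_on k S f"
  shows "Ck_on k S g"
proof (cases k)
  case 0
  then show ?thesis using assms by (auto cong: continuous_on_cong)
next
  case (Suc m)
  obtain D where D: "\<And>x. x \<in> S \<Longrightarrow> (f has_derivative (\<lambda>h. \<Sum>b\<in>Basis. (h \<bullet> b) *\<^sub>R D b x)) (at x within S)"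
    "\<And>b. b \<in> Basis \<Longrightarrow> Ck_on m S (D b)" using assms(2) unfolding Suc Ck_on.simps(2) by blast
  show ?thesis unfolding Suc
    by (rule Ck_on_SucI[of S g D]) (use D assms(1) in \<open>auto intro: has_derivative_transform[where f=f]\<close>)
qed

lemma Ck_on_const: "Ck_on k S (\<lambda>x. c)"
proof (induction k arbitrary: c)
  case (Suc k)
  show ?case by (rule Ck_on_SucI[where D="\<lambda>b x. 0"]) (use Suc in auto)
qed auto

lemma Ck_on_add: "Ck_on k S f \<Longrightarrow> Ck_on k S g \<Longrightarrow> Ck_on k S (\<lambda>x. f x + g x)"
proof (induction k arbitrary: f g)
  case (Suc k)
  obtain D where D: "\<And>x. x \<in> S \<Longrightarrow> (f has_derivative (\<lambda>h. \<Sum>b\<in>Basis. (h \<bullet> b) *\<^sub>R D b x)) (at x within S)"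
    "\<And>b. b \<in> Basis \<Longrightarrow> Ck_on k S (D b)" using Suc.prems(1) unfolding Ck_on.simps(2) by blast
  obtain E where E: "\<And>x. x \<in> S \<Longrightarrow> (g has_derivative (\<lambda>h. \<Sum>b\<in>Basis. (h \<bullet> b) *\<^sub>R E b x)) (at x within S)"
    "\<And>b. b \<in> Basis \<Longrightarrow> Ck_on k S (E b)" using Suc.prems(2) unfolding Ck_on.simps(2) by blast
  show ?case
    by (rule Ck_on_SucI[where D="\<lambda>b x. D b x + E b x"])
      (use D E Suc.IH in \<open>auto intro!: derivative_eq_intros simp: scaleR_add_right sum.distrib\<close>)
qed (auto intro!: continuous_intros)

lemma Ck_on_bilinear:
  fixes f :: "'d::euclidean_space \<Rightarrow> _"
  assumes "bounded_bilinear p"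
  shows "Ck_on k S f \<Longrightarrow> Ck_on k S g \<Longrightarrow> Ck_on k S (\<lambda>x. p (f x) (g x))"
proof (induction k arbitrary: f g)
  case 0
  then show ?case using bounded_bilinear.continuous_on[OF assms] by auto
next
  case (Suc k)
  interpret bounded_bilinear p by fact
  obtain D where D: "\<And>x. x \<in> S \<Longrightarrow> (f has_derivative (\<lambda>h. \<Sum>b\<in>Basis. (h \<bullet> b) *\<^sub>R D b x)) (at x within S)"
    "\<And>b. b \<in> Basis \<Longrightarrow> Ck_on k S (D b)" using Suc.prems(1) unfolding Ck_on.simps(2) by blast
  obtain E where E: "\<And>x. x \<in> S \<Longrightarrow> (g has_derivative (\<lambda>h. \<Sum>b\<in>Basis. (h \<bullet> b) *\<^sub>R E b x)) (at x within S)"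
    "\<And>b. b \<in> Basis \<Longrightarrow> Ck_on k S (E b)" using Suc.prems(2) unfolding Ck_on.simps(2) by blast
  show ?case
  proof (rule Ck_on_SucI[where D="\<lambda>b x. p (f x) (E b x) + p (D b x) (g x)"])
    fix x assume "x \<in> S"
    then show "((\<lambda>x. p (f x) (g x)) has_derivative
        (\<lambda>h. \<Sum>b\<in>Basis. (h \<bullet> b) *\<^sub>R (p (f x) (E b x) + p (D b x) (g x)))) (at x within S)"
      using FDERIV[OF D(1) E(1)]
      by (simp add: sum.distrib scaleR_add_right sum_left sum_right scaleR_left scaleR_right)
  next
    fix b assume "b \<in> (Basis :: 'd set)"
    then show "Ck_on k S (\<lambda>x. p (f x) (E b x) + p (D b x) (g x))"
      using D E Suc by (intro Ck_on_add Suc.IH Ck_on_Suc_imp[of k S f] Ck_on_Suc_imp[of k S g]) auto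
  qed
qed

text \<open>
  The derivative of \<open>v = f\<^sup>-\<^sup>1\<^sup>/\<^sup>2\<close> is \<open>- v\<^sup>3 f' / 2\<close>, a polynomial in \<open>v\<close> and \<open>f'\<close>, so the order of
  differentiability goes up by induction. This makes the unit normal of class \<open>C\<^sup>2\<close>.
\<close>
lemma Ck_on_inverse_sqrt:
  assumes pos: "\<And>x. x \<in> S \<Longrightarrow> f x > 0"
  shows "Ck_on k S f \<Longrightarrow> Ck_on k S (\<lambda>x. inverse (sqrt (f x)))"
proof (induction k)
  case 0
  then show ?case using pos by (auto intro!: continuous_intros simp: order_less_imp_not_eq2)
next
  case (Suc k)
  obtain D where D: "\<And>x. x \<in> S \<Longrightarrow> (f has_derivative (\<lambda>h. \<Sum>b\<in>Basis. (h \<bullet> b) *\<^sub>R D b x)) (at x within S)"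
    "\<And>b. b \<in> Basis \<Longrightarrow> Ck_on k S (D b)" using Suc.prems(1) unfolding Ck_on.simps(2) by blast
  let ?v = "\<lambda>x. inverse (sqrt (f x))"
  have v: "Ck_on k S ?v" using Suc Ck_on_Suc_imp by blast
  note mult = Ck_on_bilinear[OF bounded_bilinear_mult]
  show ?case
  proof (rule Ck_on_SucI[where D="\<lambda>b x. (- 1 / 2) * (?v x * (?v x * (?v x * D b x)))"])
    fix x assume x: "x \<in> S"
    have "((\<lambda>y. inverse (sqrt y)) has_derivative (\<lambda>h. h * (- 1 / 2 * (?v x * (?v x * ?v x))))) (at (f x) within f ` S)"
      by (rule has_derivative_at_withinI)
        (use pos[OF x] in \<open>auto intro!: derivative_eq_intros simp: divide_simps power2_eq_square\<close>)
    from has_derivative_in_compose[OF D(1)[OF x] this]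
    show "(?v has_derivative (\<lambda>h. \<Sum>b\<in>Basis. (h \<bullet> b) *\<^sub>R ((- 1 / 2) * (?v x * (?v x * (?v x * D b x)))))) (at x within S)"
      by (simp add: sum_distrib_left sum_distrib_right sum_negf sum_divide_distrib mult_ac)
  qed (use D v in \<open>intro mult Ck_on_const; auto\<close>)
qed

lemma interior_disc: "convex disc" "interior disc \<noteq> {}" by auto

lemma Basis_R2: "(Basis :: (real^2) set) = {axis 1 1, axis 2 1}"
  by (auto simp: Basis_vec_def UNIV_2)

lemma axis_R2_neq: "axis 1 (1::real) \<noteq> (axis 2 1 :: real^2)"
  by (simp add: axis_eq_axis)

lemma sum_Basis_R2: "(\<Sum>b\<in>Basis. g b) = g (axis 1 1) + g (axis 2 1 :: real^2)"
  by (simp add: Basis_R2 axis_R2_neq)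

lemma Ck_on_disc_pd:
  assumes "Ck_on (Suc k) disc f"
  shows Ck_on_pd: "Ck_on k disc (pd i f)"
    and has_derivative_pd: "\<And>w. w \<in> disc \<Longrightarrow> (f has_derivative (\<lambda>h. (h $ 1) *\<^sub>R pd 1 f w + (h $ 2) *\<^sub>R pd 2 f w)) (at w within disc)"
proof -
  obtain D where D: "\<And>x. x \<in> disc \<Longrightarrow> (f has_derivative (\<lambda>h. \<Sum>b\<in>Basis. (h \<bullet> b) *\<^sub>R D b x)) (at x within disc)"
    "\<And>b. b \<in> Basis \<Longrightarrow> Ck_on k disc (D b)"
    using assms unfolding Ck_on.simps(2) by blast
  have fd: "frechet_derivative f (at w within disc) = (\<lambda>h. \<Sum>b\<in>Basis. (h \<bullet> b) *\<^sub>R D b w)" if "w \<in> disc" for w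
    using has_derivative_unique_convex[OF interior_disc that _ D(1)[OF that]] D(1)[OF that]
      frechet_derivative_works differentiable_def by blast
  have pd: "pd i f w = D (axis i 1) w" if "w \<in> disc" for w i
    using exhaust_2[of i] by (auto simp: pd_def fd[OF that] sum_Basis_R2 inner_axis_axis axis_R2_neq)
  show "Ck_on k disc (pd i f)"
    by (rule Ck_on_cong[OF _ D(2)[of "axis i 1"]]) (auto simp: pd)
  show "(f has_derivative (\<lambda>h. (h $ 1) *\<^sub>R pd 1 f w + (h $ 2) *\<^sub>R pd 2 f w)) (at w within disc)"
    if "w \<in> disc" for w
    using D(1)[OF that] by (simp add: sum_Basis_R2 pd[OF that] inner_axis)
qed

section \<open>Mollifiers\<close>

text \<open>
  The smooth functions that vanish to infinite order at \<open>0\<close>. The powers of \<open>1/x\<close> are included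
  because the span of this family is closed under differentiation.
\<close>
definition flat_exp :: "nat \<Rightarrow> real \<Rightarrow> real" where
  "flat_exp m x = (if x > 0 then inverse x ^ m * exp (- inverse x) else 0)"

lemma flat_exp_tendsto_0: "(flat_exp m \<longlongrightarrow> 0) (at 0)"
proof -
  \<comment> \<open>Substitute \<open>y = 1/x\<close>.\<close>
  have "((\<lambda>x. inverse x ^ m / exp (inverse x)) \<longlongrightarrow> (0::real)) (at_right 0)"
    by (rule filterlim_compose[OF tendsto_power_div_exp_0 filterlim_inverse_at_top_right])
  then have "(flat_exp m \<longlongrightarrow> 0) (at_right 0)"
    by (rule Lim_transform_eventually)
      (auto simp: eventually_at_filter flat_exp_def exp_minus field_simps)
  moreover have "(flat_exp m \<longlongrightarrow> 0) (at_left 0)"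
    by (rule tendsto_eventually) (auto simp: eventually_at_filter flat_exp_def)
  ultimately show ?thesis by (simp add: filterlim_split_at)
qed

lemma flat_exp_derivative:
  "(flat_exp m has_real_derivative (- real m * flat_exp (Suc m) x + flat_exp (m + 2) x)) (at x)"
proof -
  consider "x > 0" | "x < 0" | "x = 0" by linarith
  then show ?thesis
  proof cases
    case 1
    have "((\<lambda>x. inverse x ^ m * exp (- inverse x)) has_real_derivative (- real m * flat_exp (Suc m) x + flat_exp (m + 2) x)) (at x)"
    proof -
      have "inverse x ^ n = inverse x * inverse x ^ (n - Suc 0) \<or> n = 0" for n
        by (cases n) auto
      then show ?thesis
        using 1 by (cases m) (auto intro!: derivative_eq_intros simp: flat_exp_def algebra_simps, metis)
    qed
    then show ?thesis
      by (rule has_field_derivative_transform_within_open[where S="{0<..}"]) (use 1 in \<open>auto simp: flat_exp_def\<close>)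
  next
    case 2
    have "((\<lambda>x. 0) has_real_derivative (- real m * flat_exp (Suc m) x + flat_exp (m + 2) x)) (at x)"
      using 2 by (auto simp: flat_exp_def)
    then show ?thesis
      by (rule has_field_derivative_transform_within_open[where S="{..<0}"]) (use 2 in \<open>auto simp: flat_exp_def\<close>)
  next
    case 3
    have "((\<lambda>y. (flat_exp m y - flat_exp m 0) / (y - 0)) \<longlongrightarrow> 0) (at 0)"
      by (rule Lim_transform_eventually[OF flat_exp_tendsto_0[of "Suc m"]])
        (auto simp: eventually_at_filter flat_exp_def field_simps)
    then show ?thesis using 3 by (simp add: has_field_derivative_iff flat_exp_def)
  qed
qed

lemma Ck_on_flat_exp:
  assumes g: "\<And>k. Ck_on k S g"
  shows "Ck_on k S (\<lambda>w. flat_exp m (g w))"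
proof (induction k arbitrary: m)
  case 0
  have "continuous_on UNIV (flat_exp m)"
    using flat_exp_derivative by (auto simp: continuous_on_eq_continuous_at intro!: DERIV_isCont)
  then show ?case using Ck_on_imp_continuous_on[OF g[of 0]]
    by (auto intro: continuous_on_compose2)
next
  case (Suc k)
  obtain D where D: "\<And>x. x \<in> S \<Longrightarrow> (g has_derivative (\<lambda>h. \<Sum>b\<in>Basis. (h \<bullet> b) *\<^sub>R D b x)) (at x within S)"
    "\<And>b. b \<in> Basis \<Longrightarrow> Ck_on k S (D b)" using g[of "Suc k"] unfolding Ck_on.simps(2) by blast
  note mult = Ck_on_bilinear[OF bounded_bilinear_mult]
  show ?case
  proof (rule Ck_on_SucI[where D="\<lambda>b x. D b x * (- real m * flat_exp (Suc m) (g x) + flat_exp (m + 2) (g x))"])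
    fix x assume x: "x \<in> S"
    from has_derivative_in_compose[OF D(1)[OF x] has_derivative_at_withinI[OF flat_exp_derivative[of m, unfolded has_field_derivative_def]]]
    show "((\<lambda>w. flat_exp m (g w)) has_derivative (\<lambda>h. \<Sum>b\<in>Basis. (h \<bullet> b) *\<^sub>R (D b x * (- real m * flat_exp (Suc m) (g x) + flat_exp (m + 2) (g x))))) (at x within S)"
      by (simp add: sum_distrib_left sum_distrib_right mult_ac)
  next
    fix b :: 'a assume "b \<in> Basis"
    then show "Ck_on k S (\<lambda>x. D b x * (- real m * flat_exp (Suc m) (g x) + flat_exp (m + 2) (g x)))"
      by (intro mult Ck_on_add Ck_on_const Suc D)
  qed
qed

lemma Ck_on_id: "Ck_on k S (\<lambda>x. x)"
proof (cases k)
  case (Suc m)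
  show ?thesis unfolding Suc
    by (rule Ck_on_SucI[where D="\<lambda>b x. b"]) (auto simp: euclidean_representation Ck_on_const)
qed auto

definition bump :: "real \<Rightarrow> 'a::euclidean_space \<Rightarrow> real" where
  "bump \<epsilon> w = flat_exp 0 (\<epsilon>\<^sup>2 - w \<bullet> w)"

definition mollifier :: "real \<Rightarrow> 'a::euclidean_space \<Rightarrow> real" where
  "mollifier \<epsilon> w = bump \<epsilon> w / integral UNIV (bump \<epsilon> :: 'a \<Rightarrow> real)"

lemma Ck_on_bump: "Ck_on k S (bump \<epsilon>)"
proof -
  have "Ck_on k S (\<lambda>w. \<epsilon>\<^sup>2 + (-1) * (w \<bullet> w))" for k
    by (intro Ck_on_add Ck_on_const Ck_on_bilinear[OF bounded_bilinear_mult] Ck_on_bilinear[OF bounded_bilinear_inner] Ck_on_id)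
  from Ck_on_flat_exp[OF this, of k 0] show ?thesis
    by (simp add: bump_def[abs_def])
qed

lemma Ck_on_mollifier: "Ck_on k S (mollifier \<epsilon>)"
proof -
  have "Ck_on k S (\<lambda>w. bump \<epsilon> w * inverse (integral UNIV (bump \<epsilon> :: 'a \<Rightarrow> real)))"
    by (intro Ck_on_const Ck_on_bilinear[OF bounded_bilinear_mult] Ck_on_bump)
  then show ?thesis by (simp add: mollifier_def[abs_def] divide_inverse)
qed

lemma bump_nonneg: "bump \<epsilon> w \<ge> 0"
  by (simp add: bump_def flat_exp_def)

lemma bump_eq_0: "\<epsilon> > 0 \<Longrightarrow> norm w \<ge> \<epsilon> \<Longrightarrow> bump \<epsilon> w = 0"
  using power_mono[of \<epsilon> "norm w" 2] by (simp add: bump_def flat_exp_def dot_square_norm not_less)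

lemma has_integral_reflect_translate:
  fixes f :: "'a::euclidean_space \<Rightarrow> real"
  assumes "(f has_integral i) (cbox a b)" and "\<And>x. x \<notin> cbox a b \<Longrightarrow> f x = 0"
  shows "((\<lambda>x. f (w - x)) has_integral i) UNIV"
proof (rule has_integral_on_superset)
  show "((\<lambda>x. f (w - x)) has_integral i) ((\<lambda>x. w - x) ` cbox a b)"
    using has_integral_affinity[OF assms(1), of "-1" w] by (simp add: algebra_simps)
next
  fix x assume "x \<notin> (\<lambda>x. w - x) ` cbox a b"
  then have "w - x \<notin> cbox a b" by force
  then show "f (w - x) = 0" by (rule assms(2))
qed auto

lemma
  fixes \<epsilon> :: real and w :: "'a::euclidean_space"
  assumes e: "\<epsilon> > 0"
  shows mollifier_nonneg: "mollifier \<epsilon> w \<ge> 0"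
    and mollifier_eq_0: "norm w \<ge> \<epsilon> \<Longrightarrow> mollifier \<epsilon> w = 0"
    and has_integral_mollifier: "((\<lambda>x. mollifier \<epsilon> (w - x)) has_integral 1) (UNIV :: 'a set)"
proof -
  let ?b = "bump \<epsilon> :: 'a \<Rightarrow> real"
  obtain a b :: 'a where ab: "ball 0 \<epsilon> \<subseteq> cbox a b" using bounded_ball bounded_subset_cbox_symmetric by metis
  have out: "?b x = 0" if "x \<notin> cbox a b" for x
    using that ab by (intro bump_eq_0 e) (auto simp: subset_eq not_less)
  have cont: "continuous_on (cbox a b) ?b" by (rule Ck_on_imp_continuous_on[OF Ck_on_bump[of 0]])
  obtain I where I: "(?b has_integral I) (cbox a b)"
    using integrable_continuous[OF cont] by (auto simp: integrable_on_def)
  have IU: "(?b has_integral I) UNIV"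
    by (rule has_integral_on_superset[OF I]) (auto simp: out)
  have "I \<ge> 0" using has_integral_nonneg[OF I] bump_nonneg by auto
  moreover have "I \<noteq> 0"
  proof
    assume "I = 0"
    have "(0::'a) \<in> box a b"
      using interior_mono[OF ab] e by (auto simp: interior_cbox)
    moreover from this have "0 \<in> cbox a b" using box_subset_cbox by blast
    ultimately have "?b 0 = 0"
      using has_integral_0_cbox_imp_0[OF cont _ I[unfolded \<open>I = 0\<close>]] bump_nonneg by blast
    then show False using e by (simp add: bump_def flat_exp_def)
  qed
  ultimately have "I > 0" by simp
  have m: "mollifier \<epsilon> = (\<lambda>w::'a. ?b w / I)" using IU by (auto simp: mollifier_def integral_unique)
  show "mollifier \<epsilon> w \<ge> 0" using \<open>I > 0\<close> by (simp add: m bump_nonneg)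
  show "mollifier \<epsilon> w = 0" if "norm w \<ge> \<epsilon>" using that e by (simp add: m bump_eq_0)
  have "((\<lambda>x. ?b (w - x) / I) has_integral (I / I)) UNIV"
    using has_integral_reflect_translate[OF I out, of w] by (rule has_integral_divide)
  then show "((\<lambda>x. mollifier \<epsilon> (w - x)) has_integral 1) (UNIV :: 'a set)"
    using \<open>I > 0\<close> by (simp add: m)
qed

text \<open>
  Derivatives fall on the kernel, so the convolution is as smooth as the kernel although the weight \<open>c\<close>
  is only continuous. The integration variable runs over a parameter rectangle and is carried into the
  space by a continuous map \<open>\<Phi>\<close>; thus polar coordinates need not be inverted.
\<close>
lemma Ck_on_convolution:
  fixes c :: "'b::euclidean_space \<Rightarrow> real" and \<Phi> :: "'b \<Rightarrow> 'a::euclidean_space"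
  assumes c: "continuous_on (cbox a b) c" and \<Phi>: "continuous_on (cbox a b) \<Phi>"
  shows "Ck_on k UNIV \<kappa> \<Longrightarrow> Ck_on k UNIV (\<lambda>w. integral (cbox a b) (\<lambda>p. c p * \<kappa> (w - \<Phi> p)))"
    and "(\<And>w. (\<kappa> has_derivative (\<lambda>h. \<Sum>b\<in>Basis. (h \<bullet> b) *\<^sub>R D b w)) (at w)) \<Longrightarrow>
      (\<And>b. b \<in> Basis \<Longrightarrow> continuous_on UNIV (D b)) \<Longrightarrow>
      ((\<lambda>w. integral (cbox a b) (\<lambda>p. c p * \<kappa> (w - \<Phi> p))) has_derivative
        (\<lambda>h. \<Sum>i\<in>Basis. (h \<bullet> i) *\<^sub>R integral (cbox a b) (\<lambda>p. c p * D i (w - \<Phi> p)))) (at w)"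
proof -
  have cont: "continuous_on (V \<times> cbox a b) (\<lambda>(w,p). c p * \<kappa> (w - \<Phi> p))" if "continuous_on UNIV \<kappa>" for \<kappa> :: "'a \<Rightarrow> real" and V
    using that unfolding case_prod_unfold
    by (intro continuous_intros continuous_on_compose2[OF c] continuous_on_compose2[OF \<Phi>] continuous_on_compose2[OF that]) auto
  have cont1: "continuous_on (cbox a b) (\<lambda>p. c p * \<kappa> (w - \<Phi> p))" if "continuous_on UNIV \<kappa>" for \<kappa> :: "'a \<Rightarrow> real" and w
    by (intro continuous_intros c \<Phi> continuous_on_compose2[OF that]) auto
  show deriv: "((\<lambda>w. integral (cbox a b) (\<lambda>p. c p * \<kappa> (w - \<Phi> p))) has_derivative
        (\<lambda>h. \<Sum>i\<in>Basis. (h \<bullet> i) *\<^sub>R integral (cbox a b) (\<lambda>p. c p * D i (w - \<Phi> p)))) (at w)"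
    if D: "\<And>w. (\<kappa> has_derivative (\<lambda>h. \<Sum>b\<in>Basis. (h \<bullet> b) *\<^sub>R D b w)) (at w)"
      and Dc: "\<And>b. b \<in> Basis \<Longrightarrow> continuous_on UNIV (D b)" for \<kappa> D w
  proof -
    define fx where "fx = (\<lambda>w p. \<Sum>i\<in>Basis. (c p * D i (w - \<Phi> p)) *\<^sub>R (blinfun_inner_left i :: 'a \<Rightarrow>\<^sub>L real))"
    have fx: "blinfun_apply (fx w p) h = c p * (\<Sum>b\<in>Basis. (h \<bullet> b) *\<^sub>R D b (w - \<Phi> p))" for w p h
      by (simp add: fx_def blinfun.sum_left blinfun.scaleR_left sum_distrib_left mult_ac)
    have \<kappa>c: "continuous_on UNIV \<kappa>"
      using D by (auto simp: continuous_on_eq_continuous_at intro: has_derivative_continuous)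
    have fxc: "continuous_on (UNIV \<times> cbox a b) (\<lambda>(w,p). fx w p)"
      unfolding fx_def case_prod_unfold
      by (intro continuous_intros cont[OF Dc, unfolded case_prod_unfold]) auto
    have fxc1: "continuous_on (cbox a b) (fx w)" for w
      unfolding fx_def by (intro continuous_intros cont1 Dc) auto
    have "((\<lambda>w. integral (cbox a b) (\<lambda>p. c p * \<kappa> (w - \<Phi> p))) has_derivative
        integral (cbox a b) (fx w)) (at w)"
    proof (rule leibniz_rule)
      fix x p
      show "((\<lambda>w. c p * \<kappa> (w - \<Phi> p)) has_derivative blinfun_apply (fx x p)) (at x)"
        unfolding fx by (auto intro!: derivative_eq_intros D has_derivative_compose[OF _ D])
    qed (auto intro!: integrable_continuous cont1 \<kappa>c fxc)
    then show ?thesis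
    proof (rule has_derivative_eq_rhs, intro ext)
      fix h
      have "blinfun_apply (integral (cbox a b) (fx w)) h = integral (cbox a b) (\<lambda>p. blinfun_apply (fx w p) h)"
        by (rule blinfun_apply_integral[OF integrable_continuous[OF fxc1]])
      also have "\<dots> = integral (cbox a b) (\<lambda>p. \<Sum>i\<in>Basis. (h \<bullet> i) * (c p * D i (w - \<Phi> p)))"
        by (simp add: fx sum_distrib_left mult_ac)
      also have "\<dots> = (\<Sum>i\<in>Basis. integral (cbox a b) (\<lambda>p. (h \<bullet> i) * (c p * D i (w - \<Phi> p))))"
        by (intro integral_sum integrable_continuous continuous_intros cont1 Dc) auto
      finally show "blinfun_apply (integral (cbox a b) (fx w)) h =
          (\<Sum>i\<in>Basis. (h \<bullet> i) *\<^sub>R integral (cbox a b) (\<lambda>p. c p * D i (w - \<Phi> p)))" by simp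
    qed
  qed
  show "Ck_on k UNIV (\<lambda>w. integral (cbox a b) (\<lambda>p. c p * \<kappa> (w - \<Phi> p)))" if "Ck_on k UNIV \<kappa>"
    using that
  proof (induction k arbitrary: \<kappa>)
    case 0
    then show ?case using integral_continuous_on_param[OF cont] by simp
  next
    case (Suc k)
    obtain D where D: "\<And>x. (\<kappa> has_derivative (\<lambda>h. \<Sum>b\<in>Basis. (h \<bullet> b) *\<^sub>R D b x)) (at x)"
      "\<And>b. b \<in> Basis \<Longrightarrow> Ck_on k UNIV (D b)" using Suc.prems unfolding Ck_on.simps(2) by auto
    show ?case
      by (rule Ck_on_SucI[where D="\<lambda>i w. integral (cbox a b) (\<lambda>p. c p * D i (w - \<Phi> p))"])
        (use deriv[OF D(1) Ck_on_imp_continuous_on[OF D(2)]] Suc.IH D(2) in auto)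
  qed
qed

section \<open>Immersed discs\<close>

lemma bounded_bilinear_cross3: "bounded_bilinear cross3"
  using bilinear_cross bilinear_conv_bounded_bilinear by blast

lemma columns_eq_R2: "columns A = {column 1 A, column 2 (A :: real^2^'n)}"
  by (auto simp: columns_def) (metis exhaust_2)

lemma rank_2_imp_cross3_nonzero:
  fixes A :: "real^2^3"
  assumes "rank A = 2"
  shows "cross3 (column 1 A) (column 2 A) \<noteq> 0"
proof
  assume "cross3 (column 1 A) (column 2 A) = 0"
  then have "collinear {0, column 1 A, column 2 A}" by (simp add: cross_eq_0)
  then consider "column 1 A = 0" | "column 2 A = 0" | c where "column 2 A = c *\<^sub>R column 1 A"
    by (auto simp: collinear_lemma)
  then have "columns A \<subseteq> span {column 1 A} \<or> columns A \<subseteq> span {column 2 A}"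
    by cases (auto simp: columns_eq_R2 span_base span_0 span_scale)
  then obtain x where "columns A \<subseteq> span {x}" by blast
  then have "dim (columns A) \<le> card {x}" by (intro dim_le_card) auto
  then show False using assms by (simp add: column_rank_def)
qed

text \<open>
  This is \<open>g\<^sup>i\<^sup>j p\<^sub>i p\<^sub>j\<close> for the induced metric \<open>g\<close>: in two dimensions the inverse of \<open>g\<close> is its cofactor
  matrix divided by \<open>W\<^sup>2\<close>.
\<close>
definition grad_sq :: "(real^2 \<Rightarrow> real^3) \<Rightarrow> real^2 \<Rightarrow> real \<Rightarrow> real \<Rightarrow> real" where
  "grad_sq X w p1 p2 = (norm (p1 *\<^sub>R pd 2 X w - p2 *\<^sub>R pd 1 X w) / area_element X w)\<^sup>2"

locale immersed_disc =
  fixes X :: "real^2 \<Rightarrow> real^3"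
  assumes immersion: "immersion X"
begin

abbreviation "W \<equiv> area_element X"
abbreviation "N \<equiv> unit_normal X"
abbreviation "K \<equiv> gauss_curvature X"

lemma Ck_X: "Ck_on 3 disc X" "Ck_on (Suc 2) disc X"
  using immersion by (simp_all add: immersion_def eval_nat_numeral)

lemma Ck_Xi: "Ck_on 2 disc (pd i X)"
  by (rule Ck_on_pd[OF Ck_X(2)])

lemmas has_derivative_X = has_derivative_pd[OF Ck_X(2)]

lemma has_derivative_Xi:
  "w \<in> disc \<Longrightarrow> (pd i X has_derivative (\<lambda>h. (h $ 1) *\<^sub>R pd 1 (pd i X) w + (h $ 2) *\<^sub>R pd 2 (pd i X) w)) (at w within disc)"
  by (rule has_derivative_pd[of 1]) (use Ck_Xi[of i] in \<open>simp_all add: eval_nat_numeral\<close>)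

lemma continuous_on_X: "continuous_on disc X" "continuous_on disc (pd i X)" "continuous_on disc (pd j (pd i X))"
  using Ck_on_imp_continuous_on[OF Ck_X(1)] Ck_on_imp_continuous_on[OF Ck_Xi]
    Ck_on_imp_continuous_on[OF Ck_on_pd, of 1 "pd i X" j] Ck_Xi[of i] by (simp_all add: eval_nat_numeral)

lemma area_element_pos: "w \<in> disc \<Longrightarrow> W w > 0"
proof -
  assume w: "w \<in> disc"
  have fd: "frechet_derivative X (at w within disc) = (\<lambda>h. (h $ 1) *\<^sub>R pd 1 X w + (h $ 2) *\<^sub>R pd 2 X w)"
    using has_derivative_unique_convex[OF interior_disc w _ has_derivative_X[OF w]] has_derivative_X[OF w]
      frechet_derivative_works differentiable_def by blast
  have "column i (matrix (frechet_derivative X (at w within disc))) = pd i X w" for i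
    by (simp add: column_def matrix_def pd_def vec_eq_iff)
  then show ?thesis
    using rank_2_imp_cross3_nonzero[of "matrix (frechet_derivative X (at w within disc))"] immersion w
    by (auto simp: immersion_def area_element_def)
qed

lemma cross3_eq_W_N: "w \<in> disc \<Longrightarrow> cross3 (pd 1 X w) (pd 2 X w) = W w *\<^sub>R N w"
  using area_element_pos[of w] by (simp add: area_element_def unit_normal_def)

lemma Ck_N: "Ck_on 2 disc N"
proof -
  let ?M = "\<lambda>w. cross3 (pd 1 X w) (pd 2 X w)"
  have "Ck_on 2 disc (\<lambda>w. inverse (sqrt (?M w \<bullet> ?M w)) *\<^sub>R ?M w)"
    using area_element_pos
    by (intro Ck_on_bilinear[OF bounded_bilinear_scaleR] Ck_on_inverse_sqrt
        Ck_on_bilinear[OF bounded_bilinear_inner] Ck_on_bilinear[OF bounded_bilinear_cross3] Ck_Xi)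
      (auto simp: area_element_def)
  then show ?thesis by (simp add: unit_normal_def[abs_def] norm_eq_sqrt_inner)
qed

lemma Ck_Ni: "Ck_on 1 disc (pd i N)"
  by (rule Ck_on_pd) (use Ck_N in \<open>simp add: eval_nat_numeral\<close>)

lemma has_derivative_N:
  "w \<in> disc \<Longrightarrow> (N has_derivative (\<lambda>h. (h $ 1) *\<^sub>R pd 1 N w + (h $ 2) *\<^sub>R pd 2 N w)) (at w within disc)"
  by (rule has_derivative_pd[of 1]) (use Ck_N in \<open>simp_all add: eval_nat_numeral\<close>)

lemma has_derivative_Ni:
  "w \<in> disc \<Longrightarrow> (pd i N has_derivative (\<lambda>h. (h $ 1) *\<^sub>R pd 1 (pd i N) w + (h $ 2) *\<^sub>R pd 2 (pd i N) w)) (at w within disc)"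
  by (rule has_derivative_pd[of 0]) (use Ck_Ni[of i] in \<open>simp_all\<close>)

lemma continuous_on_N: "continuous_on disc N" "continuous_on disc (pd i N)" "continuous_on disc (pd j (pd i N))"
  using Ck_on_imp_continuous_on[OF Ck_N] Ck_on_imp_continuous_on[OF Ck_Ni]
    Ck_on_imp_continuous_on[OF Ck_on_pd, of 0 "pd i N" j] Ck_Ni[of i] by simp_all

lemma continuous_on_W: "continuous_on disc W"
  unfolding area_element_def[abs_def]
  by (intro continuous_intros continuous_on_cross continuous_on_X)

lemma N_N: "w \<in> disc \<Longrightarrow> N w \<bullet> N w = 1"
  using area_element_pos[of w] by (simp add: unit_normal_def area_element_def dot_square_norm divide_simps power2_eq_square)

lemma N_X: "N w \<bullet> pd 1 X w = 0" "N w \<bullet> pd 2 X w = 0"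
  by (simp_all add: unit_normal_def dot_cross_self)

lemma det_first_form: "det (first_form X w) = (W w)\<^sup>2"
  using norm_cross_dot[of "pd 1 X w" "pd 2 X w"]
  by (simp add: first_form_def det_2 area_element_def dot_square_norm power_mult_distrib inner_commute algebra_simps flip: power2_eq_square)

text \<open>
  The common source of \<open>N\<^sub>j \<bullet> N = 0\<close> (with \<open>F = N\<close>) and of the Weingarten equations (with \<open>F = X\<^sub>i\<close>).
\<close>
lemma inner_normal_const_derivative:
  assumes F: "\<And>w. w \<in> disc \<Longrightarrow> (F has_derivative (\<lambda>h. (h $ 1) *\<^sub>R F1 w + (h $ 2) *\<^sub>R F2 w)) (at w within disc)"
    and const: "\<And>w. w \<in> disc \<Longrightarrow> N w \<bullet> F w = c" and w: "w \<in> disc"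
  shows "pd 1 N w \<bullet> F w = - (N w \<bullet> F1 w)" "pd 2 N w \<bullet> F w = - (N w \<bullet> F2 w)"
proof -
  let ?D = "\<lambda>h :: real^2. N w \<bullet> ((h $ 1) *\<^sub>R F1 w + (h $ 2) *\<^sub>R F2 w) + ((h $ 1) *\<^sub>R pd 1 N w + (h $ 2) *\<^sub>R pd 2 N w) \<bullet> F w"
  have "((\<lambda>w. N w \<bullet> F w) has_derivative ?D) (at w within disc)"
    using has_derivative_inner[OF has_derivative_N[OF w] F[OF w]] .
  moreover have "((\<lambda>w. N w \<bullet> F w) has_derivative (\<lambda>h. 0)) (at w within disc)"
    by (rule has_derivative_transform[OF w const]) auto
  ultimately have "?D = (\<lambda>h. 0)"
    by (rule has_derivative_unique_convex[OF interior_disc w])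
  from fun_cong[OF this, of "axis 1 1"] fun_cong[OF this, of "axis 2 1"]
  show "pd 1 N w \<bullet> F w = - (N w \<bullet> F1 w)" "pd 2 N w \<bullet> F w = - (N w \<bullet> F2 w)"
    by (simp_all add: axis_def)
qed

lemma Ni_N: "w \<in> disc \<Longrightarrow> pd 1 N w \<bullet> N w = 0" "w \<in> disc \<Longrightarrow> pd 2 N w \<bullet> N w = 0"
  using inner_normal_const_derivative[OF has_derivative_N N_N, of w] by (simp_all add: inner_commute)

lemma Weingarten:
  assumes w: "w \<in> disc"
  shows "pd j N w \<bullet> pd i X w = - second_form X w $ i $ j"
proof -
  have *: "N w \<bullet> pd i X w = 0" for w using exhaust_2[of i] N_X by auto
  show ?thesis
    using inner_normal_const_derivative[OF has_derivative_Xi, OF _ _ w, of i 0] * exhaust_2[of j]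
    by (auto simp: second_form_def inner_commute)
qed

text \<open>
  The Gauss map multiplies oriented areas by \<open>K\<close>: by the identity of Lagrange,
  \<open>(N\<^sub>1 \<times> N\<^sub>2) \<bullet> (X\<^sub>1 \<times> X\<^sub>2)\<close> is the determinant of the second fundamental form.
\<close>
lemma cross3_Ni:
  assumes w: "w \<in> disc"
  shows "cross3 (pd 1 N w) (pd 2 N w) \<bullet> N w = K w * W w"
proof -
  have "(cross3 (pd 1 N w) (pd 2 N w) \<bullet> N w) * W w = det (second_form X w)"
    using dot_cross[of "pd 1 N w" "pd 2 N w" "pd 1 X w" "pd 2 X w"] Weingarten[OF w]
    by (simp add: cross3_eq_W_N[OF w] det_2 mult_ac)
  then show ?thesis
    using area_element_pos[OF w] by (simp add: gauss_curvature_def det_first_form field_simps power2_eq_square)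
qed

lemma continuous_on_K: "continuous_on disc K"
proof -
  have "continuous_on disc (\<lambda>w. (cross3 (pd 1 N w) (pd 2 N w) \<bullet> N w) / W w)"
    using area_element_pos
    by (intro continuous_intros continuous_on_cross continuous_on_N continuous_on_W) force
  then show ?thesis
    by (rule continuous_on_eq) (use area_element_pos in \<open>force simp: cross3_Ni\<close>)
qed

text \<open>
  A tangent vector \<open>e\<close> is the gradient of any function whose partial derivatives are \<open>e \<bullet> X\<^sub>1\<close>, \<open>e \<bullet> X\<^sub>2\<close>.
\<close>
lemma grad_sq_tangent:
  assumes w: "w \<in> disc" and "N w \<bullet> e = 0"
  shows "grad_sq X w (e \<bullet> pd 1 X w) (e \<bullet> pd 2 X w) = e \<bullet> e"
proof -
  have "(e \<bullet> pd 1 X w) *\<^sub>R pd 2 X w - (e \<bullet> pd 2 X w) *\<^sub>R pd 1 X w = - cross3 e (cross3 (pd 1 X w) (pd 2 X w))"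
    by (simp add: cross3_simps) (simp add: forall_3 algebra_simps)
  then have "(norm ((e \<bullet> pd 1 X w) *\<^sub>R pd 2 X w - (e \<bullet> pd 2 X w) *\<^sub>R pd 1 X w))\<^sup>2 = (norm e)\<^sup>2 * (W w)\<^sup>2"
    using norm_cross_dot[of e "cross3 (pd 1 X w) (pd 2 X w)"] assms
    by (simp add: cross3_eq_W_N[OF w] inner_commute N_N power_mult_distrib norm_eq_sqrt_inner[of "N w"])
  then show ?thesis using area_element_pos[OF w]
    by (simp add: grad_sq_def power_divide dot_square_norm)
qed

text \<open>
  Let \<open>s = p \<bullet> v\<close> with \<open>H v = p\<close> be the weighted square of the covector \<open>p\<close>, and let \<open>\<xi>\<close> be the
  tangent vector with components \<open>v\<close>. The inequality of Cauchy and Schwarz for the induced metric gives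
  \<open>s\<^sup>2 \<le> |p|\<^sup>2 |\<xi>|\<^sup>2\<close>, and the lower bound on the weight matrix gives \<open>|\<xi>|\<^sup>2 \<le> (1 + g0) s\<close>.
\<close>
lemma weighted_grad_le:
  assumes G: "weight_matrix G g0" and w: "w \<in> disc"
  shows "weighted_grad G X \<phi> \<phi> w \<le> (1 + g0) * grad_sq X w (pd 1 \<phi> w) (pd 2 \<phi> w)"
proof -
  define H where "H = weighted_metric G X w"
  define A where "A = G (X w) (N w)"
  define \<xi> where "\<xi> v = (v $ 1) *\<^sub>R pd 1 X w + (v $ 2) *\<^sub>R pd 2 X w" for v :: "real^2"
  have N0: "N w \<noteq> 0" using N_N[OF w] by auto
  have g0: "0 \<le> g0" and A: "inverse (1 + g0) * (norm x)\<^sup>2 \<le> x \<bullet> (A *v x)" for x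
    using G N0 unfolding weight_matrix_def A_def by blast+
  have H: "v \<bullet> (H *v v) = \<xi> v \<bullet> (A *v \<xi> v)" for v
    by (simp add: H_def \<xi>_def weighted_metric_def A_def[symmetric] matrix_vector_mult_def[of _ v] inner_vec_def[of v] sum_2
        matrix_vector_right_distrib matrix_vector_mult_scaleR inner_add_left inner_add_right algebra_simps)
  have "v = 0" if "H *v v = 0" for v
  proof -
    have "inverse (1 + g0) * (norm (\<xi> v))\<^sup>2 \<le> 0" using H[of v] A[of "\<xi> v"] that by simp
    then have "\<xi> v = 0" using g0 by (auto simp: mult_le_0_iff)
    then have "cross3 (pd 1 X w) (\<xi> v) = 0" "cross3 (\<xi> v) (pd 2 X w) = 0" by simp_all
    then have "(v $ 2 * W w) *\<^sub>R N w = 0" "(v $ 1 * W w) *\<^sub>R N w = 0"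
      unfolding \<xi>_def
      by (simp_all add: cross_add_left cross_add_right cross_mult_left cross_mult_right cross3_eq_W_N[OF w])
    then show ?thesis using N0 area_element_pos[OF w] by (auto simp: vec_eq_iff forall_2)
  qed
  then have inv: "H ** matrix_inv H = mat 1"
    using matrix_left_invertible_ker[of H] invertible_left_inverse[of H]
      someI_ex[of "\<lambda>B. H ** B = mat 1 \<and> B ** H = mat 1"]
    unfolding matrix_inv_def invertible_def by blast
  define p :: "real^2" where "p = (\<chi> i. pd i \<phi> w)"
  define v where "v = matrix_inv H *v p"
  define c where "c = p $ 1 *\<^sub>R pd 2 X w - p $ 2 *\<^sub>R pd 1 X w"
  define s where "s = p \<bullet> v"
  have Hv: "H *v v = p" by (simp add: v_def matrix_vector_mul_assoc inv)
  have s: "weighted_grad G X \<phi> \<phi> w = s"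
    by (simp add: weighted_grad_def H_def[symmetric] s_def v_def p_def inner_vec_def sum_2 matrix_vector_mult_def algebra_simps)
  have sA: "s = \<xi> v \<bullet> (A *v \<xi> v)" using H[of v] by (simp add: Hv s_def inner_commute)
  have "cross3 (\<xi> v) c = (s * W w) *\<^sub>R N w"
  proof -
    have "cross3 (\<xi> v) c = s *\<^sub>R cross3 (pd 1 X w) (pd 2 X w)"
      by (simp add: c_def \<xi>_def s_def inner_vec_def sum_2 cross3_simps)
    then show ?thesis by (simp add: cross3_eq_W_N[OF w])
  qed
  then have "(s * W w)\<^sup>2 + (\<xi> v \<bullet> c)\<^sup>2 = (norm (\<xi> v))\<^sup>2 * (norm c)\<^sup>2"
    using norm_cross_dot[of "\<xi> v" c] N_N[OF w]
    by (simp add: power_mult_distrib norm_eq_sqrt_inner[of "N w"])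
  then have "(s * W w)\<^sup>2 \<le> (norm (\<xi> v))\<^sup>2 * (norm c)\<^sup>2"
    using zero_le_power2[of "\<xi> v \<bullet> c"] by linarith
  also have "\<dots> \<le> ((1 + g0) * s) * (norm c)\<^sup>2"
    using A[of "\<xi> v"] g0 by (intro mult_right_mono) (auto simp: sA field_simps)
  finally have *: "s * (s * (W w)\<^sup>2) \<le> s * ((1 + g0) * (norm c)\<^sup>2)" by (simp add: power2_eq_square algebra_simps)
  have W0: "W w > 0" by (rule area_element_pos[OF w])
  have "s \<le> (1 + g0) * (norm c)\<^sup>2 / (W w)\<^sup>2"
  proof (cases "s > 0")
    case True
    then show ?thesis using * W0 by (simp add: pos_le_divide_eq)
  next
    case False
    then show ?thesis using g0 by (smt (verit) divide_nonneg_nonneg mult_nonneg_nonneg zero_le_power2)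
  qed
  then show ?thesis by (simp add: s grad_sq_def c_def p_def power_divide)
qed

end

section \<open>Partial derivatives on the polar rectangle\<close>

definition partial_rho :: "real \<Rightarrow> (real \<times> real \<Rightarrow> 'a::real_normed_vector) \<Rightarrow> (real \<times> real \<Rightarrow> 'a) \<Rightarrow> bool" where
  "partial_rho r g g' \<longleftrightarrow> (\<forall>\<rho>\<in>{0..r}. \<forall>\<theta>\<in>{0..2*pi}.
     ((\<lambda>\<rho>. g (\<rho>, \<theta>)) has_vector_derivative g' (\<rho>, \<theta>)) (at \<rho> within {0..r}))"

definition partial_theta :: "real \<Rightarrow> (real \<times> real \<Rightarrow> 'a::real_normed_vector) \<Rightarrow> (real \<times> real \<Rightarrow> 'a) \<Rightarrow> bool" where
  "partial_theta r g g' \<longleftrightarrow> (\<forall>\<rho>\<in>{0..r}. \<forall>\<theta>\<in>{0..2*pi}.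
     ((\<lambda>\<theta>. g (\<rho>, \<theta>)) has_vector_derivative g' (\<rho>, \<theta>)) (at \<theta> within {0..2*pi}))"

lemma partial_rhoD: "partial_rho r g g' \<Longrightarrow> \<rho> \<in> {0..r} \<Longrightarrow> \<theta> \<in> {0..2*pi} \<Longrightarrow>
    ((\<lambda>\<rho>. g (\<rho>, \<theta>)) has_vector_derivative g' (\<rho>, \<theta>)) (at \<rho> within {0..r})"
  by (simp add: partial_rho_def)

lemma partial_thetaD: "partial_theta r g g' \<Longrightarrow> \<rho> \<in> {0..r} \<Longrightarrow> \<theta> \<in> {0..2*pi} \<Longrightarrow>
    ((\<lambda>\<theta>. g (\<rho>, \<theta>)) has_vector_derivative g' (\<rho>, \<theta>)) (at \<theta> within {0..2*pi})"
  by (simp add: partial_theta_def)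

lemma polar_rect_cbox: "polar_rect r = cbox (0, 0) (r, 2*pi)"
  by (simp add: polar_rect_def cbox_Pair_eq)

lemma mem_polar_rect: "(\<rho>, \<theta>) \<in> polar_rect r \<longleftrightarrow> \<rho> \<in> {0..r} \<and> \<theta> \<in> {0..2*pi}"
  by (auto simp: polar_rect_def)

lemma polar_rect_convex: "r > 0 \<Longrightarrow> convex (polar_rect r)" "r > 0 \<Longrightarrow> interior (polar_rect r) \<noteq> {}"
  by (simp_all add: polar_rect_def convex_Times interior_Times not_le)

lemma
  assumes r: "r > 0" and F: "(F has_derivative F') (at p within polar_rect r)" and p: "p \<in> polar_rect r"
  shows d_rho_eq: "d_rho r F p = F' (1, 0)" and d_theta_eq: "d_theta r F p = F' (0, 1)"
proof -
  have "frechet_derivative F (at p within polar_rect r) = F'"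
    using has_derivative_unique_convex[OF polar_rect_convex[OF r] p _ F] F
      frechet_derivative_works differentiable_def by blast
  then show "d_rho r F p = F' (1, 0)" "d_theta r F p = F' (0, 1)"
    by (simp_all add: d_rho_def d_theta_def)
qed

lemma partialI:
  assumes F: "\<And>p. p \<in> polar_rect r \<Longrightarrow> (F has_derivative (\<lambda>h. fst h *\<^sub>R F1 p + snd h *\<^sub>R F2 p)) (at p within polar_rect r)"
  shows "partial_rho r F F1" "partial_theta r F F2"
proof -
  show "partial_rho r F F1"
    unfolding partial_rho_def
  proof safe
    fix \<rho> \<theta> assume *: "\<rho> \<in> {0..r}" "\<theta> \<in> {0..2*pi}"
    have "((\<lambda>\<rho>. (\<rho>, \<theta>)) has_derivative (\<lambda>h. (h, 0))) (at \<rho> within {0..r})"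
      by (auto intro!: derivative_eq_intros)
    moreover have "(F has_derivative (\<lambda>h. fst h *\<^sub>R F1 (\<rho>, \<theta>) + snd h *\<^sub>R F2 (\<rho>, \<theta>))) (at (\<rho>, \<theta>) within (\<lambda>\<rho>. (\<rho>, \<theta>)) ` {0..r})"
      by (rule has_derivative_subset[OF F]) (use * in \<open>auto simp: mem_polar_rect\<close>)
    ultimately have "((\<lambda>\<rho>. F (\<rho>, \<theta>)) has_derivative (\<lambda>h. fst (h, 0::real) *\<^sub>R F1 (\<rho>, \<theta>) + snd (h, 0) *\<^sub>R F2 (\<rho>, \<theta>))) (at \<rho> within {0..r})"
      by (rule has_derivative_in_compose)
    then show "((\<lambda>\<rho>. F (\<rho>, \<theta>)) has_vector_derivative F1 (\<rho>, \<theta>)) (at \<rho> within {0..r})"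
      by (simp add: has_vector_derivative_def)
  qed
  show "partial_theta r F F2"
    unfolding partial_theta_def
  proof safe
    fix \<rho> \<theta> assume *: "\<rho> \<in> {0..r}" "\<theta> \<in> {0..2*pi}"
    have "((\<lambda>\<theta>. (\<rho>, \<theta>)) has_derivative (\<lambda>h. (0, h))) (at \<theta> within {0..2*pi})"
      by (auto intro!: derivative_eq_intros)
    moreover have "(F has_derivative (\<lambda>h. fst h *\<^sub>R F1 (\<rho>, \<theta>) + snd h *\<^sub>R F2 (\<rho>, \<theta>))) (at (\<rho>, \<theta>) within (\<lambda>\<theta>. (\<rho>, \<theta>)) ` {0..2*pi})"
      by (rule has_derivative_subset[OF F]) (use * in \<open>auto simp: mem_polar_rect\<close>)
    ultimately have "((\<lambda>\<theta>. F (\<rho>, \<theta>)) has_derivative (\<lambda>h. fst (0::real, h) *\<^sub>R F1 (\<rho>, \<theta>) + snd (0::real, h) *\<^sub>R F2 (\<rho>, \<theta>))) (at \<theta> within {0..2*pi})"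
      by (rule has_derivative_in_compose)
    then show "((\<lambda>\<theta>. F (\<rho>, \<theta>)) has_vector_derivative F2 (\<rho>, \<theta>)) (at \<theta> within {0..2*pi})"
      by (simp add: has_vector_derivative_def)
  qed
qed

lemma Ck_on_1_polar_rect:
  assumes r: "r > 0" and F: "Ck_on 1 (polar_rect r) F"
  shows "\<And>p. p \<in> polar_rect r \<Longrightarrow> (F has_derivative (\<lambda>h. fst h *\<^sub>R d_rho r F p + snd h *\<^sub>R d_theta r F p)) (at p within polar_rect r)"
    and "continuous_on (polar_rect r) (d_rho r F)" and "continuous_on (polar_rect r) (d_theta r F)"
proof -
  obtain D where D: "\<And>x. x \<in> polar_rect r \<Longrightarrow> (F has_derivative (\<lambda>h. \<Sum>b\<in>Basis. (h \<bullet> b) *\<^sub>R D b x)) (at x within polar_rect r)"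
    "\<And>b. b \<in> Basis \<Longrightarrow> continuous_on (polar_rect r) (D b)"
    using F unfolding One_nat_def Ck_on.simps by blast
  have B: "Basis = {(1, 0), (0, 1) :: real \<times> real}" by (auto simp: Basis_prod_def)
  have D': "(F has_derivative (\<lambda>h. fst h *\<^sub>R D (1, 0) p + snd h *\<^sub>R D (0, 1) p)) (at p within polar_rect r)" if "p \<in> polar_rect r" for p
    using D(1)[OF that] by (simp add: B inner_Pair_0 inner_prod_def)
  have d: "d_rho r F p = D (1, 0) p" "d_theta r F p = D (0, 1) p" if "p \<in> polar_rect r" for p
    using d_rho_eq[OF r D' that] d_theta_eq[OF r D' that] that by auto
  show "(F has_derivative (\<lambda>h. fst h *\<^sub>R d_rho r F p + snd h *\<^sub>R d_theta r F p)) (at p within polar_rect r)" if "p \<in> polar_rect r" for p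
    using D'[OF that] by (simp add: d[OF that])
  show "continuous_on (polar_rect r) (d_rho r F)" "continuous_on (polar_rect r) (d_theta r F)"
    using D(2)[of "(1, 0)"] D(2)[of "(0, 1)"] d by (auto simp: B cong: continuous_on_cong)
qed

lemma vector_derivative_unique_interval:
  fixes f :: "real \<Rightarrow> 'a::real_normed_vector"
  assumes "a < b" "x \<in> {a..b}" "(f has_vector_derivative f') (at x within {a..b})"
    "(f has_vector_derivative f'') (at x within {a..b})"
  shows "f' = f''"
  using vector_derivative_unique_within_closed_interval[of a b x f f' f''] assms by (simp add: cbox_interval)

lemma partial_rho_unique:
  "r > 0 \<Longrightarrow> \<rho> \<in> {0..r} \<Longrightarrow> \<theta> \<in> {0..2*pi} \<Longrightarrow> partial_rho r g g1 \<Longrightarrow> partial_rho r g g2 \<Longrightarrow> g1 (\<rho>, \<theta>) = g2 (\<rho>, \<theta>)"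
  by (rule vector_derivative_unique_interval[OF _ _ partial_rhoD partial_rhoD])

lemma partial_theta_unique:
  "\<rho> \<in> {0..r} \<Longrightarrow> \<theta> \<in> {0..2*pi} \<Longrightarrow> partial_theta r g g1 \<Longrightarrow> partial_theta r g g2 \<Longrightarrow> g1 (\<rho>, \<theta>) = g2 (\<rho>, \<theta>)"
  by (rule vector_derivative_unique_interval[OF _ _ partial_thetaD partial_thetaD]) auto

lemma partial_rho_cong:
  assumes "partial_rho r f f'" and "\<And>p. p \<in> polar_rect r \<Longrightarrow> f p = g p" "\<And>p. p \<in> polar_rect r \<Longrightarrow> f' p = g' p"
  shows "partial_rho r g g'"
  unfolding partial_rho_def
proof safe
  fix \<rho> \<theta> assume p: "\<rho> \<in> {0..r}" "\<theta> \<in> {0..2*pi}"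
  have "((\<lambda>\<rho>. g (\<rho>, \<theta>)) has_vector_derivative f' (\<rho>, \<theta>)) (at \<rho> within {0..r})"
    by (rule has_vector_derivative_transform[OF p(1) _ partial_rhoD[OF assms(1) p]])
      (use assms(2) p in \<open>auto simp: mem_polar_rect\<close>)
  then show "((\<lambda>\<rho>. g (\<rho>, \<theta>)) has_vector_derivative g' (\<rho>, \<theta>)) (at \<rho> within {0..r})"
    using assms(3) p by (simp add: mem_polar_rect)
qed

lemma partial_theta_cong:
  assumes "partial_theta r f f'" and "\<And>p. p \<in> polar_rect r \<Longrightarrow> f p = g p" "\<And>p. p \<in> polar_rect r \<Longrightarrow> f' p = g' p"
  shows "partial_theta r g g'"
  unfolding partial_theta_def
proof safe
  fix \<rho> \<theta> assume p: "\<rho> \<in> {0..r}" "\<theta> \<in> {0..2*pi}"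
  have "((\<lambda>\<theta>. g (\<rho>, \<theta>)) has_vector_derivative f' (\<rho>, \<theta>)) (at \<theta> within {0..2*pi})"
    by (rule has_vector_derivative_transform[OF p(2) _ partial_thetaD[OF assms(1) p]])
      (use assms(2) p in \<open>auto simp: mem_polar_rect\<close>)
  then show "((\<lambda>\<theta>. g (\<rho>, \<theta>)) has_vector_derivative g' (\<rho>, \<theta>)) (at \<theta> within {0..2*pi})"
    using assms(3) p by (simp add: mem_polar_rect)
qed

lemma partial_add:
  shows partial_rho_add: "partial_rho r f f' \<Longrightarrow> partial_rho r g g' \<Longrightarrow> partial_rho r (\<lambda>p. f p + g p) (\<lambda>p. f' p + g' p)"
    and partial_theta_add: "partial_theta r f f' \<Longrightarrow> partial_theta r g g' \<Longrightarrow> partial_theta r (\<lambda>p. f p + g p) (\<lambda>p. f' p + g' p)"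
  by (auto simp: partial_rho_def partial_theta_def intro: has_vector_derivative_add)

lemma partial_bilinear:
  assumes "bounded_bilinear pr"
  shows partial_rho_bilinear: "partial_rho r f f' \<Longrightarrow> partial_rho r g g' \<Longrightarrow> partial_rho r (\<lambda>p. pr (f p) (g p)) (\<lambda>p. pr (f p) (g' p) + pr (f' p) (g p))"
    and partial_theta_bilinear: "partial_theta r f f' \<Longrightarrow> partial_theta r g g' \<Longrightarrow> partial_theta r (\<lambda>p. pr (f p) (g p)) (\<lambda>p. pr (f p) (g' p) + pr (f' p) (g p))"
  by (auto simp: partial_rho_def partial_theta_def intro: bounded_bilinear.has_vector_derivative[OF assms])

lemma partial_linear:
  assumes "bounded_linear L"
  shows partial_rho_linear: "partial_rho r f f' \<Longrightarrow> partial_rho r (\<lambda>p. L (f p)) (\<lambda>p. L (f' p))"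
    and partial_theta_linear: "partial_theta r f f' \<Longrightarrow> partial_theta r (\<lambda>p. L (f p)) (\<lambda>p. L (f' p))"
  by (auto simp: partial_rho_def partial_theta_def intro: bounded_linear.has_vector_derivative[OF assms])

lemma partial_const:
  shows partial_rho_const: "partial_rho r (\<lambda>p. c) (\<lambda>p. 0)" and partial_theta_const: "partial_theta r (\<lambda>p. c) (\<lambda>p. 0)"
  by (auto simp: partial_rho_def partial_theta_def)

lemma partial_compose:
  fixes \<Phi> :: "real \<times> real \<Rightarrow> real^2" and F :: "real^2 \<Rightarrow> 'a::real_normed_vector"
  assumes F: "\<And>w. w \<in> S \<Longrightarrow> (F has_derivative (\<lambda>h. (h $ 1) *\<^sub>R F1 w + (h $ 2) *\<^sub>R F2 w)) (at w within S)"
    and \<Phi>: "\<And>p. p \<in> polar_rect r \<Longrightarrow> \<Phi> p \<in> S"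
  shows partial_rho_compose: "partial_rho r \<Phi> A \<Longrightarrow>
      partial_rho r (\<lambda>p. F (\<Phi> p)) (\<lambda>p. (A p $ 1) *\<^sub>R F1 (\<Phi> p) + (A p $ 2) *\<^sub>R F2 (\<Phi> p))"
    and partial_theta_compose: "partial_theta r \<Phi> A \<Longrightarrow>
      partial_theta r (\<lambda>p. F (\<Phi> p)) (\<lambda>p. (A p $ 1) *\<^sub>R F1 (\<Phi> p) + (A p $ 2) *\<^sub>R F2 (\<Phi> p))"
proof -
  assume A: "partial_rho r \<Phi> A"
  show "partial_rho r (\<lambda>p. F (\<Phi> p)) (\<lambda>p. (A p $ 1) *\<^sub>R F1 (\<Phi> p) + (A p $ 2) *\<^sub>R F2 (\<Phi> p))"
    unfolding partial_rho_def
  proof safe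
    fix \<rho> \<theta> assume *: "\<rho> \<in> {0..r}" "\<theta> \<in> {0..2*pi}"
    have "(F has_derivative (\<lambda>h. (h $ 1) *\<^sub>R F1 (\<Phi> (\<rho>,\<theta>)) + (h $ 2) *\<^sub>R F2 (\<Phi> (\<rho>,\<theta>)))) (at (\<Phi> (\<rho>,\<theta>)) within (\<lambda>\<rho>. \<Phi> (\<rho>,\<theta>)) ` {0..r})"
      by (rule has_derivative_subset[OF F]) (use * in \<open>auto intro!: \<Phi> simp: mem_polar_rect\<close>)
    from has_derivative_in_compose[OF partial_rhoD[OF A *, unfolded has_vector_derivative_def] this]
    show "((\<lambda>\<rho>. F (\<Phi> (\<rho>, \<theta>))) has_vector_derivative (A (\<rho>, \<theta>) $ 1) *\<^sub>R F1 (\<Phi> (\<rho>, \<theta>)) + (A (\<rho>, \<theta>) $ 2) *\<^sub>R F2 (\<Phi> (\<rho>, \<theta>))) (at \<rho> within {0..r})"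
      by (simp add: has_vector_derivative_def scaleR_add_right)
  qed
next
  assume A: "partial_theta r \<Phi> A"
  show "partial_theta r (\<lambda>p. F (\<Phi> p)) (\<lambda>p. (A p $ 1) *\<^sub>R F1 (\<Phi> p) + (A p $ 2) *\<^sub>R F2 (\<Phi> p))"
    unfolding partial_theta_def
  proof safe
    fix \<rho> \<theta> assume *: "\<rho> \<in> {0..r}" "\<theta> \<in> {0..2*pi}"
    have "(F has_derivative (\<lambda>h. (h $ 1) *\<^sub>R F1 (\<Phi> (\<rho>,\<theta>)) + (h $ 2) *\<^sub>R F2 (\<Phi> (\<rho>,\<theta>)))) (at (\<Phi> (\<rho>,\<theta>)) within (\<lambda>\<theta>. \<Phi> (\<rho>,\<theta>)) ` {0..2*pi})"
      by (rule has_derivative_subset[OF F]) (use * in \<open>auto intro!: \<Phi> simp: mem_polar_rect\<close>)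
    from has_derivative_in_compose[OF partial_thetaD[OF A *, unfolded has_vector_derivative_def] this]
    show "((\<lambda>\<theta>. F (\<Phi> (\<rho>, \<theta>))) has_vector_derivative (A (\<rho>, \<theta>) $ 1) *\<^sub>R F1 (\<Phi> (\<rho>, \<theta>)) + (A (\<rho>, \<theta>) $ 2) *\<^sub>R F2 (\<Phi> (\<rho>, \<theta>))) (at \<theta> within {0..2*pi})"
      by (simp add: has_vector_derivative_def scaleR_add_right)
  qed
qed

lemma continuous_on_polar_rect_section:
  assumes "continuous_on (polar_rect r) g"
  shows "\<theta> \<in> {0..2*pi} \<Longrightarrow> continuous_on {0..r} (\<lambda>\<rho>. g (\<rho>, \<theta>))"
    and "\<rho> \<in> {0..r} \<Longrightarrow> continuous_on {0..2*pi} (\<lambda>\<theta>. g (\<rho>, \<theta>))"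
  by (auto intro!: continuous_on_compose2[OF assms] continuous_intros simp: mem_polar_rect)

text \<open>
  A weak form of Schwarz's theorem: if \<open>g\<^sub>\<rho>\<close> has a continuous \<open>\<theta>\<close>-derivative, then \<open>g\<^sub>\<theta>\<close> is differentiable
  in \<open>\<rho>\<close> with the same value. One integrates \<open>g\<^sub>\<rho>\<close> along rays and differentiates under the integral.
  The polar map \<open>\<Phi>\<close> is of class \<open>C\<^sup>1\<close> together with \<open>\<Phi>\<^sub>\<rho>\<close> only, and this is how mixed derivatives of
  higher order become available.
\<close>
lemma partial_swap:
  fixes g :: "real \<times> real \<Rightarrow> 'a::banach"
  assumes r: "r > 0"
    and g1: "partial_rho r g g1" "continuous_on (polar_rect r) g1" and g2: "partial_theta r g g2"
    and g12: "partial_theta r g1 g12" "continuous_on (polar_rect r) g12"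
  shows "partial_rho r g2 g12"
  unfolding partial_rho_def
proof safe
  fix \<rho> \<theta> assume p: "\<rho> \<in> {0..r}" "\<theta> \<in> {0..2*pi}"
  have eq: "g2 (x, \<theta>) = g2 (0, \<theta>) + integral {0..x} (\<lambda>s. g12 (s, \<theta>))" if x: "x \<in> {0..r}" for x
  proof -
    have g: "g (x, t) = g (0, t) + integral {0..x} (\<lambda>s. g1 (s, t))" if t: "t \<in> {0..2*pi}" for t
    proof -
      have "((\<lambda>s. g1 (s, t)) has_integral g (x, t) - g (0, t)) {0..x}"
        by (rule fundamental_theorem_of_calculus)
          (use x t in \<open>auto intro!: has_vector_derivative_within_subset[OF partial_rhoD[OF g1(1)]]\<close>)
      then show ?thesis by (simp add: integral_unique)
    qed
    have sub: "{0..2*pi} \<times> {0..x} \<subseteq> prod.swap -` polar_rect r" using x by (auto simp: mem_polar_rect)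
    have "((\<lambda>t. integral (cbox 0 x) (\<lambda>s. g1 (s, t))) has_vector_derivative integral (cbox 0 x) (\<lambda>s. g12 (s, \<theta>)))
        (at \<theta> within {0..2*pi})"
    proof (rule leibniz_rule_vector_derivative)
      show "continuous_on ({0..2 * pi} \<times> cbox 0 x) (\<lambda>(t, s). g12 (s, t))"
        using sub by (auto intro!: continuous_on_compose2[OF g12(2)] continuous_intros simp: case_prod_unfold)
      show "(\<lambda>s. g1 (s, t)) integrable_on cbox 0 x" if "t \<in> {0..2*pi}" for t
        using that x by (auto intro!: integrable_continuous_real continuous_on_subset[OF continuous_on_polar_rect_section(1)[OF g1(2)]])
    qed (use x p partial_thetaD[OF g12(1)] in auto)
    then have "((\<lambda>t. g (0, t) + integral {0..x} (\<lambda>s. g1 (s, t))) has_vector_derivative g2 (0, \<theta>) + integral {0..x} (\<lambda>s. g12 (s, \<theta>)))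
        (at \<theta> within {0..2*pi})"
      using p x by (intro has_vector_derivative_add partial_thetaD[OF g2]) (auto simp: cbox_interval)
    then have "((\<lambda>t. g (x, t)) has_vector_derivative g2 (0, \<theta>) + integral {0..x} (\<lambda>s. g12 (s, \<theta>))) (at \<theta> within {0..2*pi})"
      by (rule has_vector_derivative_transform[rotated 2]) (use g p in auto)
    from vector_derivative_unique_interval[OF _ p(2) partial_thetaD[OF g2 x p(2)] this]
    show ?thesis by simp
  qed
  have "((\<lambda>x. g2 (0, \<theta>) + integral {0..x} (\<lambda>s. g12 (s, \<theta>))) has_vector_derivative 0 + g12 (\<rho>, \<theta>)) (at \<rho> within {0..r})"
    using p by (intro has_vector_derivative_add has_vector_derivative_const integral_has_vector_derivative
        continuous_on_polar_rect_section(1)[OF g12(2)])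
  then show "((\<lambda>\<rho>. g2 (\<rho>, \<theta>)) has_vector_derivative g12 (\<rho>, \<theta>)) (at \<rho> within {0..r})"
    using has_vector_derivative_transform[OF p(1) eq] by simp
qed

text \<open>
  Identities of continuous functions extend from the part of the rectangle where the metric is
  positive to the centre \<open>\<rho> = 0\<close> and to the cut \<open>\<theta> = 2\<pi>\<close>.
\<close>
lemma polar_rect_eqI:
  fixes f g :: "real \<times> real \<Rightarrow> 'a::real_normed_vector"
  assumes r: "r > 0" and f: "continuous_on (polar_rect r) f" and g: "continuous_on (polar_rect r) g"
    and eq: "\<And>\<rho> \<theta>. 0 < \<rho> \<Longrightarrow> \<rho> \<le> r \<Longrightarrow> 0 \<le> \<theta> \<Longrightarrow> \<theta> < 2*pi \<Longrightarrow> f (\<rho>, \<theta>) = g (\<rho>, \<theta>)"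
    and p: "p \<in> polar_rect r"
  shows "f p = g p"
proof -
  have cl: "closure ({0<..r} \<times> {0..<2*pi}) = polar_rect r"
    using r by (simp add: closure_Times polar_rect_def)
  have "f p - g p = 0"
    by (rule continuous_constant_on_closure[of "{0<..r} \<times> {0..<2*pi}" "\<lambda>p. f p - g p"])
      (use eq p f g in \<open>auto simp: cl intro!: continuous_intros\<close>)
  then show ?thesis by simp
qed

section \<open>Geodesic polar coordinates and Jacobi's equation\<close>

lemma eq_normal_component:
  fixes x e b n :: "real^3"
  assumes "x \<bullet> e = 0" "x \<bullet> b = 0" "n \<bullet> e = 0" "n \<bullet> b = 0" "n \<bullet> n = 1" "cross3 e b = c *\<^sub>R n" "c \<noteq> 0"
  shows "x = (x \<bullet> n) *\<^sub>R n"
proof -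
  define y where "y = x - (x \<bullet> n) *\<^sub>R n"
  have y: "y \<bullet> e = 0" "y \<bullet> b = 0" "y \<bullet> n = 0" using assms by (simp_all add: y_def inner_diff_left)
  have "cross3 y (cross3 e b) = (y \<bullet> b) *\<^sub>R e - (y \<bullet> e) *\<^sub>R b"
    by (rule Lagrange)
  then have "cross3 y n = 0" using y assms by (simp add: cross_mult_right)
  then have "y = 0 \<or> n = 0" using y norm_and_cross_eq_0 by blast
  then show ?thesis using assms by (auto simp: y_def)
qed

text \<open>
  With \<open>n1\<close>, \<open>n2\<close> the derivatives of the normal, the left side is the \<open>\<rho>\<close>-derivative of the connection
  form \<open>n \<bullet> (e \<times> e\<^sub>\<theta>)\<close> of the frame \<open>e\<close>, \<open>t = n \<times> e\<close> (see \<open>Jacobi_2\<close>). The right side is minus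
  the area distortion of the Gauss map, through which the curvature enters.
\<close>
lemma frame_identity:
  fixes e n e2 n1 n2 :: "real^3"
  assumes n: "n \<bullet> n = 1" and e: "e \<bullet> e = 1" and en: "e \<bullet> n = 0"
    and e2: "e2 \<bullet> e = 0" "e2 \<bullet> n = - (e \<bullet> n2)" and n1: "n1 \<bullet> n = 0"
  shows "n1 \<bullet> cross3 e e2 - (e \<bullet> n1) * (n \<bullet> cross3 e n2) = - (cross3 n1 n2 \<bullet> n)"
proof -
  define t where "t = cross3 n e"
  have t: "t \<bullet> n = 0" "t \<bullet> e = 0" "cross3 e t = n" "cross3 n e = t" "cross3 e n = - t"
    "n \<bullet> t = 0" "e \<bullet> t = 0"
  proof -
    show t0: "t \<bullet> n = 0" "t \<bullet> e = 0" "n \<bullet> t = 0" "e \<bullet> t = 0" by (simp_all add: t_def dot_cross_self)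
    have "cross3 e (cross3 n e) = (e \<bullet> e) *\<^sub>R n - (e \<bullet> n) *\<^sub>R e" by (rule Lagrange)
    then show "cross3 e t = n" using e en by (simp add: t_def)
    show "cross3 n e = t" "cross3 e n = - t" using cross_skew[of e n] by (simp_all add: t_def)
  qed
  have "t \<bullet> t = 1"
    using dot_cross[of n e n e] n e en by (simp add: t_def inner_commute)
  let ?y = "e2 - (e2 \<bullet> n) *\<^sub>R n"
  have "?y \<bullet> n = 0" "?y \<bullet> e = 0"
    using n en e2 by (simp_all add: inner_diff_left inner_add_left inner_commute[of n e])
  from eq_normal_component[OF this t(1,2) \<open>t \<bullet> t = 1\<close>, of 1]
  have "?y = (?y \<bullet> t) *\<^sub>R t" using t by simp
  then have "e2 = (e2 \<bullet> t) *\<^sub>R t + (e2 \<bullet> n) *\<^sub>R n"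
  proof -
    have "?y \<bullet> t = e2 \<bullet> t" using t by (simp add: inner_diff_left)
    then have "e2 - (e2 \<bullet> n) *\<^sub>R n = (e2 \<bullet> t) *\<^sub>R t" using \<open>?y = (?y \<bullet> t) *\<^sub>R t\<close> by (simp only:)
    then show ?thesis by (simp only: diff_eq_eq)
  qed
  then have "cross3 e e2 = cross3 e ((e2 \<bullet> t) *\<^sub>R t + (e2 \<bullet> n) *\<^sub>R n)" by (rule arg_cong)
  then have "cross3 e e2 = (e2 \<bullet> t) *\<^sub>R n - (e2 \<bullet> n) *\<^sub>R t"
    by (simp only: cross_add_right cross_mult_right t) simp
  then have 1: "n1 \<bullet> cross3 e e2 = (e \<bullet> n2) * (n1 \<bullet> t)"
    using e2 n1 by (simp add: inner_diff_right inner_add_right)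
  have 2: "n \<bullet> cross3 e n2 = n2 \<bullet> t"
    by (simp add: t_def cross3_simps)
  have "cross3 n1 n2 \<bullet> cross3 e t = (n1 \<bullet> e) * (n2 \<bullet> t) - (n1 \<bullet> t) * (n2 \<bullet> e)"
    by (rule dot_cross)
  then show ?thesis by (simp add: 1 2 t inner_commute mult_ac)
qed

locale polar_disc = immersed_disc +
  fixes r :: real and \<Phi> :: "real \<times> real \<Rightarrow> real^2" and P :: "real \<Rightarrow> real \<Rightarrow> real" and w0 :: "real^2"
  assumes r: "r > 0" and w0: "w0 \<in> disc"
    and Ck_\<Phi>: "Ck_on 1 (polar_rect r) \<Phi>" and Ck_A: "Ck_on 1 (polar_rect r) (d_rho r \<Phi>)"
    and \<Phi>_0: "\<forall>\<theta>\<in>{0..2*pi}. \<Phi> (0, \<theta>) = w0"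
    and \<Phi>_per: "\<forall>\<rho>\<in>{0..r}. \<Phi> (\<rho>, 2*pi) = \<Phi> (\<rho>, 0)"
    and \<Phi>_bij: "bij_betw \<Phi> ({0<..r} \<times> {0..<2*pi}) (disc - {w0})"
    and \<Phi>_r: "\<Phi> ` ({r} \<times> {0..2*pi}) = sphere 0 1"
    and metric: "\<forall>\<rho>\<in>{0<..r}. \<forall>\<theta>\<in>{0..2*pi}.
           d_rho r (X \<circ> \<Phi>) (\<rho>, \<theta>) \<bullet> d_rho r (X \<circ> \<Phi>) (\<rho>, \<theta>) = 1 \<and>
           d_rho r (X \<circ> \<Phi>) (\<rho>, \<theta>) \<bullet> d_theta r (X \<circ> \<Phi>) (\<rho>, \<theta>) = 0 \<and>
           d_theta r (X \<circ> \<Phi>) (\<rho>, \<theta>) \<bullet> d_theta r (X \<circ> \<Phi>) (\<rho>, \<theta>) = P \<rho> \<theta>"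
    and P_pos: "\<forall>\<rho>\<in>{0<..r}. \<forall>\<theta>\<in>{0..<2*pi}. P \<rho> \<theta> > 0"
    and P_lim: "\<forall>\<theta>\<in>{0..<2*pi}. ((\<lambda>\<rho>. deriv (\<lambda>s. sqrt (P s \<theta>)) \<rho>) \<longlongrightarrow> 1) (at_right 0)"
begin

abbreviation "R \<equiv> polar_rect r"

text \<open>
  Subscripts \<open>1\<close> and \<open>2\<close> denote derivatives in \<open>\<rho>\<close> and \<open>\<theta>\<close>. The vectors \<open>e\<close> and \<open>b\<close> are the two
  coordinate fields on the surface in space, with \<open>|e| = 1\<close> and \<open>e \<bullet> b = 0\<close>, and \<open>D\<close> is the Jacobian
  of the polar map.
\<close>
definition "A = d_rho r \<Phi>"
definition "B = d_theta r \<Phi>"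
definition "A1 = d_rho r A"
definition "A2 = d_theta r A"

definition e :: "real \<times> real \<Rightarrow> real^3" where
  "e p = (A p $ 1) *\<^sub>R pd 1 X (\<Phi> p) + (A p $ 2) *\<^sub>R pd 2 X (\<Phi> p)"

definition b :: "real \<times> real \<Rightarrow> real^3" where
  "b p = (B p $ 1) *\<^sub>R pd 1 X (\<Phi> p) + (B p $ 2) *\<^sub>R pd 2 X (\<Phi> p)"

definition D :: "real \<times> real \<Rightarrow> real" where
  "D p = A p $ 1 * B p $ 2 - A p $ 2 * B p $ 1"

lemma R_iff: "(\<rho>, \<theta>) \<in> R \<longleftrightarrow> \<rho> \<in> {0..r} \<and> \<theta> \<in> {0..2*pi}" by (rule mem_polar_rect)

lemma \<Phi>_disc: "p \<in> R \<Longrightarrow> \<Phi> p \<in> disc"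
proof (cases p)
  case (Pair \<rho> \<theta>)
  assume p: "p \<in> R"
  have *: "\<Phi> (\<rho>, \<theta>) \<in> disc" if "\<rho> \<in> {0<..r}" "\<theta> \<in> {0..<2*pi}" for \<rho> \<theta>
    using bij_betwE[OF \<Phi>_bij] that by blast
  consider "\<rho> = 0" | "\<rho> > 0" "\<theta> < 2*pi" | "\<rho> > 0" "\<theta> = 2*pi"
    using p by (fastforce simp: Pair R_iff)
  then show ?thesis
  proof cases
    case 1 then show ?thesis using p \<Phi>_0 w0 by (simp add: Pair R_iff)
  next
    case 2 then show ?thesis using p * by (simp add: Pair R_iff)
  next
    case 3 then show ?thesis using p * \<Phi>_per by (simp add: Pair R_iff)
  qed
qed

lemma \<Phi>_partial: "partial_rho r \<Phi> A" "partial_theta r \<Phi> B" "partial_rho r A A1" "partial_theta r A A2"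
  using partialI[OF Ck_on_1_polar_rect(1)[OF r Ck_\<Phi>]] partialI[OF Ck_on_1_polar_rect(1)[OF r Ck_A]]
  by (auto simp: A_def B_def A1_def A2_def)

lemma \<Phi>_continuous: "continuous_on R \<Phi>" "continuous_on R A" "continuous_on R B" "continuous_on R A1" "continuous_on R A2"
  using Ck_on_imp_continuous_on[OF Ck_\<Phi>] Ck_on_1_polar_rect(2,3)[OF r Ck_\<Phi>] Ck_on_1_polar_rect(2,3)[OF r Ck_A]
  by (auto simp: A_def B_def A1_def A2_def)

lemma continuous_on_comp_\<Phi>: "continuous_on disc F \<Longrightarrow> continuous_on R (\<lambda>p. F (\<Phi> p))"
  by (rule continuous_on_compose2[OF _ \<Phi>_continuous(1)]) (use \<Phi>_disc in blast)+

lemmas continuous_on_surface [continuous_intros] =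
  continuous_on_X[THEN continuous_on_comp_\<Phi>] continuous_on_N[THEN continuous_on_comp_\<Phi>]
  continuous_on_W[THEN continuous_on_comp_\<Phi>] continuous_on_K[THEN continuous_on_comp_\<Phi>] \<Phi>_continuous

lemma partial_comp_\<Phi>:
  assumes "\<And>w. w \<in> disc \<Longrightarrow> (F has_derivative (\<lambda>h. (h $ 1) *\<^sub>R F1 w + (h $ 2) *\<^sub>R F2 w)) (at w within disc)"
  shows "partial_rho r (\<lambda>p. F (\<Phi> p)) (\<lambda>p. (A p $ 1) *\<^sub>R F1 (\<Phi> p) + (A p $ 2) *\<^sub>R F2 (\<Phi> p))"
    and "partial_theta r (\<lambda>p. F (\<Phi> p)) (\<lambda>p. (B p $ 1) *\<^sub>R F1 (\<Phi> p) + (B p $ 2) *\<^sub>R F2 (\<Phi> p))"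
  using partial_rho_compose[OF assms \<Phi>_disc \<Phi>_partial(1)] partial_theta_compose[OF assms \<Phi>_disc \<Phi>_partial(2)] by auto

lemma Y_partial: "partial_rho r (\<lambda>p. X (\<Phi> p)) e" "partial_theta r (\<lambda>p. X (\<Phi> p)) b"
  unfolding e_def[abs_def] b_def[abs_def] by (rule partial_comp_\<Phi>[OF has_derivative_X]; assumption)+

lemma coordinate_vectors_eq: assumes p: "p \<in> R" shows "d_rho r (X \<circ> \<Phi>) p = e p" "d_theta r (X \<circ> \<Phi>) p = b p"
proof -
  let ?F' = "\<lambda>h. (fst h *\<^sub>R A p + snd h *\<^sub>R B p) $ 1 *\<^sub>R pd 1 X (\<Phi> p) + (fst h *\<^sub>R A p + snd h *\<^sub>R B p) $ 2 *\<^sub>R pd 2 X (\<Phi> p)"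
  have "(X has_derivative (\<lambda>h. (h $ 1) *\<^sub>R pd 1 X (\<Phi> p) + (h $ 2) *\<^sub>R pd 2 X (\<Phi> p))) (at (\<Phi> p) within \<Phi> ` R)"
    by (rule has_derivative_subset[OF has_derivative_X]) (use p \<Phi>_disc in auto)
  from has_derivative_in_compose[OF Ck_on_1_polar_rect(1)[OF r Ck_\<Phi> p] this]
  have "((X \<circ> \<Phi>) has_derivative ?F') (at p within R)" by (simp add: o_def A_def B_def)
  from d_rho_eq[OF r this p] d_theta_eq[OF r this p]
  show "d_rho r (X \<circ> \<Phi>) p = e p" "d_theta r (X \<circ> \<Phi>) p = b p" by (simp_all add: e_def b_def)
qed

lemma continuous_on_frame [continuous_intros]: "continuous_on R e" "continuous_on R b" "continuous_on R D"
  unfolding e_def[abs_def] b_def[abs_def] D_def[abs_def] by (intro continuous_intros)+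

lemma B_0: assumes "\<theta> \<in> {0..2*pi}" shows "B (0, \<theta>) = 0"
proof -
  have "((\<lambda>t. \<Phi> (0, t)) has_vector_derivative 0) (at \<theta> within {0..2*pi})"
    by (rule has_vector_derivative_transform[OF assms _ has_vector_derivative_const]) (use \<Phi>_0 in auto)
  then show ?thesis
    using vector_derivative_unique_interval[OF _ assms partial_thetaD[OF \<Phi>_partial(2)]] assms r by auto
qed

lemma e_e: "p \<in> R \<Longrightarrow> e p \<bullet> e p = 1"
  by (rule polar_rect_eqI[OF r, where g="\<lambda>_. 1"])
    (use metric in \<open>auto intro!: continuous_intros simp: coordinate_vectors_eq R_iff\<close>)

lemma e_b: "p \<in> R \<Longrightarrow> e p \<bullet> b p = 0"
  by (rule polar_rect_eqI[OF r, where g="\<lambda>_. 0"])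
    (use metric in \<open>auto intro!: continuous_intros simp: coordinate_vectors_eq R_iff\<close>)

lemma b_b: "\<rho> \<in> {0<..r} \<Longrightarrow> \<theta> \<in> {0..2*pi} \<Longrightarrow> b (\<rho>, \<theta>) \<bullet> b (\<rho>, \<theta>) = P \<rho> \<theta>"
  using metric[rule_format, of \<rho> \<theta>] coordinate_vectors_eq[of "(\<rho>, \<theta>)"] by (simp add: R_iff)

abbreviation "n p \<equiv> N (\<Phi> p)"

definition n1 :: "real \<times> real \<Rightarrow> real^3" where
  "n1 p = (A p $ 1) *\<^sub>R pd 1 N (\<Phi> p) + (A p $ 2) *\<^sub>R pd 2 N (\<Phi> p)"

definition n2 :: "real \<times> real \<Rightarrow> real^3" where
  "n2 p = (B p $ 1) *\<^sub>R pd 1 N (\<Phi> p) + (B p $ 2) *\<^sub>R pd 2 N (\<Phi> p)"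

lemma n_partial: "partial_rho r (\<lambda>p. n p) n1" "partial_theta r (\<lambda>p. n p) n2"
  unfolding n1_def[abs_def] n2_def[abs_def] by (rule partial_comp_\<Phi>[OF has_derivative_N]; assumption)+

lemma continuous_on_n12 [continuous_intros]: "continuous_on R n1" "continuous_on R n2"
  unfolding n1_def[abs_def] n2_def[abs_def] by (intro continuous_intros)+

lemma n_orth:
  assumes "p \<in> R"
  shows "n p \<bullet> n p = 1" "n p \<bullet> e p = 0" "n p \<bullet> b p = 0" "n1 p \<bullet> n p = 0" "n2 p \<bullet> n p = 0"
  using N_N[OF \<Phi>_disc[OF assms]] N_X Ni_N[OF \<Phi>_disc[OF assms]]
  by (simp_all add: e_def b_def n1_def n2_def inner_add_left inner_add_right)

lemma e_cross_b: "p \<in> R \<Longrightarrow> cross3 (e p) (b p) = (D p * W (\<Phi> p)) *\<^sub>R n p"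
proof -
  assume p: "p \<in> R"
  have "cross3 (e p) (b p) = D p *\<^sub>R cross3 (pd 1 X (\<Phi> p)) (pd 2 X (\<Phi> p))"
    by (simp add: e_def b_def D_def cross3_simps)
  then show ?thesis by (simp add: cross3_eq_W_N[OF \<Phi>_disc[OF p]])
qed

lemma n1_cross_n2: "p \<in> R \<Longrightarrow> cross3 (n1 p) (n2 p) \<bullet> n p = K (\<Phi> p) * (D p * W (\<Phi> p))"
proof -
  assume p: "p \<in> R"
  have "cross3 (n1 p) (n2 p) = D p *\<^sub>R cross3 (pd 1 N (\<Phi> p)) (pd 2 N (\<Phi> p))"
    by (simp add: n1_def n2_def D_def cross3_simps)
  then show ?thesis by (simp add: cross3_Ni[OF \<Phi>_disc[OF p]])
qed

lemma area_density_squared: "\<rho> \<in> {0<..r} \<Longrightarrow> \<theta> \<in> {0..2*pi} \<Longrightarrow> (D (\<rho>, \<theta>) * W (\<Phi> (\<rho>, \<theta>)))\<^sup>2 = P \<rho> \<theta>"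
proof -
  assume *: "\<rho> \<in> {0<..r}" "\<theta> \<in> {0..2*pi}"
  then have p: "(\<rho>, \<theta>) \<in> R" by (auto simp: R_iff)
  show ?thesis
    using dot_cross[of "e (\<rho>, \<theta>)" "b (\<rho>, \<theta>)" "e (\<rho>, \<theta>)" "b (\<rho>, \<theta>)"]
    by (simp add: e_cross_b[OF p] n_orth[OF p] e_e[OF p] e_b[OF p] b_b[OF *] power2_eq_square)
qed

lemma D_nonzero: "\<rho> \<in> {0<..r} \<Longrightarrow> \<theta> \<in> {0..<2*pi} \<Longrightarrow> D (\<rho>, \<theta>) \<noteq> 0"
  using area_density_squared[of \<rho> \<theta>] P_pos by force

definition e1 :: "real \<times> real \<Rightarrow> real^3" where
  "e1 p = (A1 p $ 1) *\<^sub>R pd 1 X (\<Phi> p) + (A1 p $ 2) *\<^sub>R pd 2 X (\<Phi> p) +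
     (A p $ 1) *\<^sub>R (A p $ 1 *\<^sub>R pd 1 (pd 1 X) (\<Phi> p) + A p $ 2 *\<^sub>R pd 2 (pd 1 X) (\<Phi> p)) +
     (A p $ 2) *\<^sub>R (A p $ 1 *\<^sub>R pd 1 (pd 2 X) (\<Phi> p) + A p $ 2 *\<^sub>R pd 2 (pd 2 X) (\<Phi> p))"

definition e2 :: "real \<times> real \<Rightarrow> real^3" where
  "e2 p = (A2 p $ 1) *\<^sub>R pd 1 X (\<Phi> p) + (A2 p $ 2) *\<^sub>R pd 2 X (\<Phi> p) +
     (A p $ 1) *\<^sub>R (B p $ 1 *\<^sub>R pd 1 (pd 1 X) (\<Phi> p) + B p $ 2 *\<^sub>R pd 2 (pd 1 X) (\<Phi> p)) +
     (A p $ 2) *\<^sub>R (B p $ 1 *\<^sub>R pd 1 (pd 2 X) (\<Phi> p) + B p $ 2 *\<^sub>R pd 2 (pd 2 X) (\<Phi> p))"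

lemma e_partial: "partial_rho r e e1" "partial_theta r e e2"
proof -
  note 1 = partial_rho_linear[OF bounded_linear_vec_nth \<Phi>_partial(3)] partial_theta_linear[OF bounded_linear_vec_nth \<Phi>_partial(4)]
  note 2 = partial_comp_\<Phi>[OF has_derivative_Xi]
  show "partial_rho r e e1"
    by (rule partial_rho_cong[OF partial_rho_add[OF
          partial_rho_bilinear[OF bounded_bilinear_scaleR 1(1)[of 1] 2(1)[of 1]]
          partial_rho_bilinear[OF bounded_bilinear_scaleR 1(1)[of 2] 2(1)[of 2]]]])
      (simp_all add: e_def e1_def)
  show "partial_theta r e e2"
    by (rule partial_theta_cong[OF partial_theta_add[OF
          partial_theta_bilinear[OF bounded_bilinear_scaleR 1(2)[of 1] 2(2)[of 1]]
          partial_theta_bilinear[OF bounded_bilinear_scaleR 1(2)[of 2] 2(2)[of 2]]]])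
      (simp_all add: e_def e2_def)
qed

lemma continuous_on_e12 [continuous_intros]: "continuous_on R e1" "continuous_on R e2"
  unfolding e1_def[abs_def] e2_def[abs_def] by (intro continuous_intros)+

text \<open>
  Both \<open>b\<^sub>\<rho>\<close> and \<open>e\<^sub>\<theta>\<close> are the mixed second derivative of \<open>X \<circ> \<Phi>\<close>.
\<close>
lemma b_partial: "partial_rho r b e2"
  by (rule partial_swap[OF r Y_partial(1) _ Y_partial(2) e_partial(2)]) (intro continuous_intros)+

lemma inner_partial:
  "partial_rho r f f' \<Longrightarrow> partial_rho r g g' \<Longrightarrow> (\<And>p. p \<in> R \<Longrightarrow> f p \<bullet> g p = c) \<Longrightarrow> p \<in> R \<Longrightarrow> f p \<bullet> g' p + f' p \<bullet> g p = 0"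
  "partial_theta r f f' \<Longrightarrow> partial_theta r g g' \<Longrightarrow> (\<And>p. p \<in> R \<Longrightarrow> f p \<bullet> g p = c) \<Longrightarrow> p \<in> R \<Longrightarrow> f p \<bullet> g' p + f' p \<bullet> g p = 0"
proof -
  obtain \<rho> \<theta> where p': "p = (\<rho>, \<theta>)" by (cases p)
  assume c: "\<And>p. p \<in> R \<Longrightarrow> f p \<bullet> g p = c" and p: "p \<in> R"
  {
    assume *: "partial_rho r f f'" "partial_rho r g g'"
    show "f p \<bullet> g' p + f' p \<bullet> g p = 0"
      using partial_rho_unique[OF r _ _ partial_rho_bilinear[OF bounded_bilinear_inner *] partial_rho_cong[OF partial_rho_const[of r c]], of \<rho> \<theta> "\<lambda>p. 0"]
      using c p by (simp add: p' R_iff)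
  next
    assume *: "partial_theta r f f'" "partial_theta r g g'"
    show "f p \<bullet> g' p + f' p \<bullet> g p = 0"
      using partial_theta_unique[OF _ _ partial_theta_bilinear[OF bounded_bilinear_inner *] partial_theta_cong[OF partial_theta_const[of r c]], of \<rho> \<theta> "\<lambda>p. 0"]
      using c p by (simp add: p' R_iff)
  }
qed

text \<open>
  The normal curvature of the ray; \<open>e\<^sub>\<rho> = c n\<close> says that the ray is a geodesic.
\<close>
definition c :: "real \<times> real \<Rightarrow> real" where "c p = - (e p \<bullet> n1 p)"

lemma e2_orth: assumes p: "p \<in> R" shows "e2 p \<bullet> e p = 0" "e2 p \<bullet> n p = - (e p \<bullet> n2 p)"
  using inner_partial(2)[OF e_partial(2) e_partial(2) e_e p] inner_partial(2)[OF e_partial(2) n_partial(2) _ p, of 0] n_orth(2)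
  by (simp_all add: inner_commute)

text \<open>
  The rays are geodesics. Indeed \<open>e\<^sub>\<rho> \<bullet> e = 0\<close> because \<open>|e| = 1\<close>, and
  \<open>e\<^sub>\<rho> \<bullet> b = - e \<bullet> b\<^sub>\<rho> = - e \<bullet> e\<^sub>\<theta> = 0\<close>. The gain is regularity: the right side of the equation
  has a \<open>\<theta>\<close>-derivative, which is not clear for \<open>e\<^sub>\<rho>\<close> as it stands.
\<close>
lemma e1_eq: "p \<in> R \<Longrightarrow> e1 p = c p *\<^sub>R n p"
proof (rule polar_rect_eqI[OF r])
  fix \<rho> \<theta> assume *: "0 < \<rho>" "\<rho> \<le> r" "0 \<le> \<theta>" "\<theta> < 2*pi"
  let ?p = "(\<rho>, \<theta>)"
  have p: "?p \<in> R" using * by (auto simp: R_iff)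
  have 1: "e1 ?p \<bullet> e ?p = 0" using inner_partial(1)[OF e_partial(1) e_partial(1) e_e p] by (simp add: inner_commute)
  have 2: "e1 ?p \<bullet> b ?p = 0"
    using inner_partial(1)[OF e_partial(1) b_partial e_b p] e2_orth(1)[OF p] by (simp add: inner_commute)
  have 3: "e1 ?p \<bullet> n ?p = c ?p"
    using inner_partial(1)[OF e_partial(1) n_partial(1) _ p, of 0] n_orth(2) by (simp add: inner_commute c_def)
  have "D ?p * W (\<Phi> ?p) \<noteq> 0" using D_nonzero[of \<rho> \<theta>] * area_element_pos[OF \<Phi>_disc[OF p]] by auto
  from eq_normal_component[OF 1 2 _ _ _ e_cross_b[OF p] this] n_orth[OF p] 3
  show "e1 ?p = c ?p *\<^sub>R n ?p" by simp
qed (auto intro!: continuous_intros simp: c_def[abs_def])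

definition n12 :: "real \<times> real \<Rightarrow> real^3" where
  "n12 p = (A2 p $ 1) *\<^sub>R pd 1 N (\<Phi> p) + (A2 p $ 2) *\<^sub>R pd 2 N (\<Phi> p) +
     (A p $ 1) *\<^sub>R (B p $ 1 *\<^sub>R pd 1 (pd 1 N) (\<Phi> p) + B p $ 2 *\<^sub>R pd 2 (pd 1 N) (\<Phi> p)) +
     (A p $ 2) *\<^sub>R (B p $ 1 *\<^sub>R pd 1 (pd 2 N) (\<Phi> p) + B p $ 2 *\<^sub>R pd 2 (pd 2 N) (\<Phi> p))"

lemma n1_partial: "partial_theta r n1 n12"
proof -
  note 1 = partial_theta_linear[OF bounded_linear_vec_nth \<Phi>_partial(4)]
  note 2 = partial_comp_\<Phi>[OF has_derivative_Ni]
  show ?thesis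
    by (rule partial_theta_cong[OF partial_theta_add[OF
          partial_theta_bilinear[OF bounded_bilinear_scaleR 1[of 1] 2(2)[of 1]]
          partial_theta_bilinear[OF bounded_bilinear_scaleR 1[of 2] 2(2)[of 2]]]])
      (simp_all add: n1_def n12_def)
qed

definition c2 :: "real \<times> real \<Rightarrow> real" where "c2 p = - (e p \<bullet> n12 p + e2 p \<bullet> n1 p)"

lemma c_partial: "partial_theta r c c2"
  by (rule partial_theta_cong[OF partial_theta_linear[OF bounded_linear_minus[OF bounded_linear_ident]
        partial_theta_bilinear[OF bounded_bilinear_inner e_partial(2) n1_partial]]])
    (simp_all add: c_def c2_def)

lemma e2_partial: "partial_rho r e2 (\<lambda>p. c p *\<^sub>R n2 p + c2 p *\<^sub>R n p)"
proof (rule partial_swap[OF r e_partial(1) _ e_partial(2)])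
  show "partial_theta r e1 (\<lambda>p. c p *\<^sub>R n2 p + c2 p *\<^sub>R n p)"
    by (rule partial_theta_cong[OF partial_theta_bilinear[OF bounded_bilinear_scaleR c_partial n_partial(2)]])
      (simp_all add: e1_eq)
  show "continuous_on R (\<lambda>p. c p *\<^sub>R n2 p + c2 p *\<^sub>R n p)"
    unfolding c_def c2_def n12_def by (intro continuous_intros)
qed (intro continuous_intros)

text \<open>
  The \<open>\<theta>\<close>-component of the connection form of the frame \<open>e\<close>, \<open>n \<times> e\<close>; its \<open>\<rho>\<close>-component vanishes
  by \<open>e1_eq\<close>.
\<close>
definition a :: "real \<times> real \<Rightarrow> real" where "a p = n p \<bullet> cross3 (e p) (e2 p)"

lemma DW_eq: "p \<in> R \<Longrightarrow> D p * W (\<Phi> p) = n p \<bullet> cross3 (e p) (b p)"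
  by (simp add: e_cross_b n_orth)

text \<open>
  The equation \<open>F\<^sub>\<rho>\<^sub>\<rho> = - K F\<close> for the oriented area density \<open>F = D W\<close>, as a first-order system for
  \<open>F\<close> and \<open>a\<close>. It is Gauss's theorema egregium in geodesic coordinates: \<open>K\<close> enters through the second
  fundamental form, \<open>F\<close> belongs to the induced metric.
\<close>
lemma Jacobi_1: "partial_rho r (\<lambda>p. D p * W (\<Phi> p)) a"
proof (rule partial_rho_cong[OF partial_rho_bilinear[OF bounded_bilinear_inner n_partial(1)
        partial_rho_bilinear[OF bounded_bilinear_cross3 e_partial(1) b_partial]]])
  fix p assume p: "p \<in> R"
  show "n p \<bullet> (cross3 (e p) (e2 p) + cross3 (e1 p) (b p)) + n1 p \<bullet> cross3 (e p) (b p) = a p"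
    by (simp add: a_def e_cross_b[OF p] n_orth[OF p] e1_eq[OF p] inner_add_right cross_mult_left dot_cross_self)
qed (simp add: DW_eq)

lemma Jacobi_2: "partial_rho r a (\<lambda>p. - K (\<Phi> p) * (D p * W (\<Phi> p)))"
proof (rule partial_rho_cong[OF partial_rho_bilinear[OF bounded_bilinear_inner n_partial(1)
        partial_rho_bilinear[OF bounded_bilinear_cross3 e_partial(1) e2_partial]]])
  fix p assume p: "p \<in> R"
  have "n1 p \<bullet> cross3 (e p) (e2 p) - (e p \<bullet> n1 p) * (n p \<bullet> cross3 (e p) (n2 p)) = - (cross3 (n1 p) (n2 p) \<bullet> n p)"
    by (rule frame_identity) (use n_orth[OF p] e_e[OF p] e2_orth[OF p] in \<open>simp_all add: inner_commute\<close>)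
  moreover have "e p \<bullet> n1 p = - c p" by (simp add: c_def)
  ultimately show "n p \<bullet> (cross3 (e p) (c p *\<^sub>R n2 p + c2 p *\<^sub>R n p) + cross3 (e1 p) (e2 p)) + n1 p \<bullet> cross3 (e p) (e2 p)
      = - K (\<Phi> p) * (D p * W (\<Phi> p))"
    by (simp add: n1_cross_n2[OF p] e1_eq[OF p] inner_add_right cross_mult_left cross_mult_right cross_add_right dot_cross_self)
qed (simp add: a_def)

end

section \<open>Integration in geodesic polar coordinates\<close>

lemma has_integral_cart2_prod:
  fixes F :: "real \<times> real \<Rightarrow> 'a::real_normed_vector"
  assumes "(F has_integral i) (cbox (a, c) (b, d))"
  shows "((\<lambda>v. F (v $ 1, v $ 2)) has_integral i) (cbox (vector [a, c]) (vector [b, d] :: real^2))"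
proof -
  let ?g = "\<lambda>v::real^2. (v $ 1, v $ 2)" and ?h = "\<lambda>p::real\<times>real. vector [fst p, snd p] :: real^2"
  have hg: "?h (?g x) = x" and gh: "?g (?h p) = p" for x p
    by (simp_all add: vec_eq_iff forall_2)
  have g: "?g ` cbox u v = cbox (?g u) (?g v)" for u v
  proof -
    have iff: "?g x \<in> cbox (?g u) (?g v) \<longleftrightarrow> x \<in> cbox u v" for x
      by (simp add: cbox_Pair_eq mem_box_cart forall_2)
    have "p \<in> ?g ` cbox u v" if "p \<in> cbox (?g u) (?g v)" for p
    proof (rule image_eqI[where x="?h p"])
      show "p = ?g (?h p)" by (rule gh[symmetric])
      show "?h p \<in> cbox u v" using that iff[of "?h p"] by (simp only: gh)
    qed
    then show ?thesis using iff by blast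
  qed
  have h: "?h ` cbox p q = cbox (?h p) (?h q)" for p q
  proof -
    have "?h ` cbox p q = ?h ` ?g ` cbox (?h p) (?h q)" by (simp only: g gh)
    also have "\<dots> = cbox (?h p) (?h q)" by (simp only: image_image hg image_ident)
    finally show ?thesis .
  qed
  have content: "measure lborel (?g ` cbox u v) = 1 * measure lborel (cbox u v)" for u v
  proof (cases "cbox u v = {}")
    case False
    then have "u $ 1 \<le> v $ 1" "u $ 2 \<le> v $ 2" by (auto simp: interval_ne_empty_cart forall_2)
    then show ?thesis using False by (simp add: g content_Pair content_cbox_cart UNIV_2)
  qed simp
  have "((\<lambda>x. F (?g x)) has_integral (1 / 1) *\<^sub>R i) (?h ` cbox (a, c) (b, d))"
  proof (rule has_integral_twiddle[OF zero_less_one hg gh _ _ _ content assms])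
    show "continuous (at x) ?g" for x by (intro continuous_intros)
    show "\<exists>w z. ?g ` cbox u v = cbox w z" for u v using g by blast
    show "\<exists>w z. ?h ` cbox p q = cbox w z" for p q using h by blast
  qed
  then show ?thesis by (simp add: h)
qed

context polar_disc
begin

text \<open>
  The polar map may reverse the orientation. Its Jacobian \<open>D\<close> has no zero on the connected set
  \<open>0 < \<rho>\<close>, \<open>\<theta> < 2\<pi>\<close>, hence constant sign \<open>\<sigma>\<close>. Then \<open>J = |D|\<close>, and \<open>f = J W\<close>
  is the area density \<open>\<surd>P\<close> in polar coordinates.
\<close>
definition \<sigma> :: real where "\<sigma> = sgn (D (r, 0))"

definition J :: "real \<times> real \<Rightarrow> real" where "J p = \<sigma> * D p"
definition f :: "real \<times> real \<Rightarrow> real" where "f p = J p * W (\<Phi> p)"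
definition f1 :: "real \<times> real \<Rightarrow> real" where "f1 p = \<sigma> * a p"

lemma J_pos: assumes "\<rho> \<in> {0<..r}" "\<theta> \<in> {0..<2*pi}" shows "J (\<rho>, \<theta>) > 0"
proof -
  let ?S = "{0<..r} \<times> {0..<2*pi}"
  have S: "?S \<subseteq> R" by (auto simp: R_iff)
  have "connected (D ` ?S)"
    by (intro connected_continuous_image continuous_on_subset[OF continuous_on_frame(3) S]
        convex_connected convex_Times convex_real_interval)
  moreover have "(0::real) \<notin> D ` ?S" using D_nonzero by fastforce
  moreover have in_S: "D (r, 0) \<in> D ` ?S" "D (\<rho>, \<theta>) \<in> D ` ?S" using r assms by auto
  ultimately have "\<not> (D (r, 0) \<le> 0 \<and> 0 \<le> D (\<rho>, \<theta>))" "\<not> (D (\<rho>, \<theta>) \<le> 0 \<and> 0 \<le> D (r, 0))"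
    using connectedD_interval by metis+
  then show ?thesis unfolding J_def \<sigma>_def
    by (auto simp: zero_less_mult_iff sgn_if not_le)
qed

lemma \<sigma>_sq: "\<sigma> * \<sigma> = 1"
  using J_pos[of r 0] r by (auto simp: \<sigma>_def J_def sgn_if)

lemma continuous_on_J [continuous_intros]: "continuous_on R J"
  unfolding J_def[abs_def] by (intro continuous_intros)

lemma J_eq_abs: assumes "p \<in> R" shows "J p = \<bar>D p\<bar>"
proof (rule polar_rect_eqI[OF r _ _ _ assms])
  fix \<rho> \<theta> assume *: "0 < \<rho>" "\<rho> \<le> r" "0 \<le> \<theta>" "\<theta> < 2*pi"
  then have "J (\<rho>, \<theta>) = \<bar>J (\<rho>, \<theta>)\<bar>" using J_pos[of \<rho> \<theta>] by simp
  also have "\<dots> = \<bar>D (\<rho>, \<theta>)\<bar>" using \<sigma>_sq by (auto simp: J_def abs_mult square_eq_1_iff)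
  finally show "J (\<rho>, \<theta>) = \<bar>D (\<rho>, \<theta>)\<bar>" .
qed (intro continuous_intros)+

lemma J_nonneg: "p \<in> R \<Longrightarrow> J p \<ge> 0" by (simp add: J_eq_abs)

lemma W_pos: "p \<in> R \<Longrightarrow> W (\<Phi> p) > 0"
  using area_element_pos \<Phi>_disc by blast

lemma f_nonneg: "p \<in> R \<Longrightarrow> f p \<ge> 0"
  using J_nonneg[of p] W_pos[of p] by (simp add: f_def)

lemma J_0: "\<theta> \<in> {0..2*pi} \<Longrightarrow> J (0, \<theta>) = 0"
  by (simp add: J_def D_def B_0)

lemma continuous_on_f [continuous_intros]: "continuous_on R f" "continuous_on R f1"
  unfolding f_def[abs_def] f1_def[abs_def] a_def by (intro continuous_intros continuous_on_cross)+

lemma f_partial: "partial_rho r f f1" "partial_rho r f1 (\<lambda>p. - (K (\<Phi> p) * f p))"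
proof -
  show "partial_rho r f f1"
    by (rule partial_rho_cong[OF partial_rho_linear[OF bounded_linear_mult_right[of \<sigma>] Jacobi_1]])
      (simp_all add: f_def f1_def J_def)
  show "partial_rho r f1 (\<lambda>p. - (K (\<Phi> p) * f p))"
    by (rule partial_rho_cong[OF partial_rho_linear[OF bounded_linear_mult_right[of \<sigma>] Jacobi_2]])
      (simp_all add: f_def f1_def J_def)
qed

lemma f_eq_sqrt_P: assumes "\<rho> \<in> {0<..r}" "\<theta> \<in> {0..<2*pi}" shows "f (\<rho>, \<theta>) = sqrt (P \<rho> \<theta>)"
proof -
  have "(f (\<rho>, \<theta>))\<^sup>2 = P \<rho> \<theta>"
    using area_density_squared[of \<rho> \<theta>] assms \<sigma>_sq by (simp add: f_def J_def power_mult_distrib power2_eq_square[of \<sigma>])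
  then show ?thesis using f_nonneg[of "(\<rho>, \<theta>)"] assms by (auto simp: R_iff intro!: real_sqrt_unique[symmetric])
qed

text \<open>
  The normalisation \<open>\<partial>\<^sub>\<rho>\<surd>P \<rightarrow> 1\<close> at the centre becomes an initial value, since \<open>f1\<close> is continuous up
  to \<open>\<rho> = 0\<close>. Integrated over \<open>\<theta>\<close> it is the origin of the term \<open>2\<pi>\<close> of the estimate.
\<close>
lemma f1_0: assumes "\<theta> \<in> {0..2*pi}" shows "f1 (0, \<theta>) = 1"
proof -
  have *: "f1 (0, \<theta>) = 1" if \<theta>: "\<theta> \<in> {0..<2*pi}" for \<theta>
  proof -
    have "eventually (\<lambda>\<rho>. deriv (\<lambda>s. sqrt (P s \<theta>)) \<rho> = f1 (\<rho>, \<theta>)) (at_right 0)"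
      unfolding eventually_at_right_field
    proof (intro exI[of _ r] conjI allI impI r)
      fix \<rho> assume \<rho>: "0 < \<rho>" "\<rho> < r"
      have "((\<lambda>s. f (s, \<theta>)) has_vector_derivative f1 (\<rho>, \<theta>)) (at \<rho> within {0<..<r})"
        by (rule has_vector_derivative_within_subset[OF partial_rhoD[OF f_partial(1)]]) (use \<rho> \<theta> in auto)
      then have "((\<lambda>s. f (s, \<theta>)) has_real_derivative f1 (\<rho>, \<theta>)) (at \<rho>)"
        using at_within_open[of \<rho> "{0<..<r}"] \<rho> by (simp add: has_real_derivative_iff_has_vector_derivative)
      then have "((\<lambda>s. sqrt (P s \<theta>)) has_real_derivative f1 (\<rho>, \<theta>)) (at \<rho>)"
        by (rule has_field_derivative_transform_within_open[where S="{0<..<r}"]) (use \<rho> \<theta> f_eq_sqrt_P in auto)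
      then show "deriv (\<lambda>s. sqrt (P s \<theta>)) \<rho> = f1 (\<rho>, \<theta>)" by (rule DERIV_imp_deriv)
    qed
    then have "((\<lambda>\<rho>. f1 (\<rho>, \<theta>)) \<longlongrightarrow> 1) (at_right 0)"
      using P_lim \<theta> tendsto_cong by fast
    moreover have "((\<lambda>\<rho>. f1 (\<rho>, \<theta>)) \<longlongrightarrow> f1 (0, \<theta>)) (at 0 within {0..r})"
      using continuous_on_polar_rect_section(1)[OF continuous_on_f(2), of \<theta>] \<theta> r by (auto simp: continuous_on_def)
    then have "((\<lambda>\<rho>. f1 (\<rho>, \<theta>)) \<longlongrightarrow> f1 (0, \<theta>)) (at_right 0)"
      using at_within_Icc_at_right[OF r] by simp
    ultimately show ?thesis using tendsto_unique trivial_limit_at_right_real by blast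
  qed
  have "f1 (0, \<theta>) - 1 = 0"
    by (rule continuous_constant_on_closure[of "{0..<2*pi}" "\<lambda>\<theta>. f1 (0, \<theta>) - 1"])
      (use * assms r continuous_on_polar_rect_section(2)[OF continuous_on_f(2), of 0] in \<open>auto intro!: continuous_intros\<close>)
  then show ?thesis by simp
qed

text \<open>
  With \<open>h = 1 - \<rho>/s\<close>, the function \<open>f\<^sub>\<rho> h\<^sup>2 + (2/s) f h\<close> is a primitive of \<open>- K f h\<^sup>2 - (2/s\<^sup>2) f\<close>: this
  is integration by parts, twice, of Jacobi's equation against \<open>h\<^sup>2\<close>.
\<close>
lemma radial_identity:
  assumes s: "0 < s" "s \<le> r" and \<theta>: "\<theta> \<in> {0..2*pi}"
  shows "integral {0..s} (\<lambda>\<rho>. K (\<Phi> (\<rho>, \<theta>)) * f (\<rho>, \<theta>) * (1 - \<rho>/s)\<^sup>2) = 1 - 2/s\<^sup>2 * integral {0..s} (\<lambda>\<rho>. f (\<rho>, \<theta>))"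
proof -
  let ?k = "\<lambda>\<rho>. K (\<Phi> (\<rho>, \<theta>)) * f (\<rho>, \<theta>)" and ?h = "\<lambda>\<rho>. 1 - \<rho>/s"
  let ?G = "\<lambda>\<rho>. f1 (\<rho>, \<theta>) * (?h \<rho>)\<^sup>2 + 2/s * (f (\<rho>, \<theta>) * ?h \<rho>)"
  have d: "((\<lambda>\<rho>. f (\<rho>, \<theta>)) has_real_derivative f1 (\<rho>, \<theta>)) (at \<rho> within {0..s})"
    "((\<lambda>\<rho>. f1 (\<rho>, \<theta>)) has_real_derivative - ?k \<rho>) (at \<rho> within {0..s})" if "\<rho> \<in> {0..s}" for \<rho>
    using partial_rhoD[OF f_partial(1), of \<rho> \<theta>] partial_rhoD[OF f_partial(2), of \<rho> \<theta>] that s \<theta>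
    by (auto simp: has_real_derivative_iff_has_vector_derivative intro: has_vector_derivative_within_subset)
  have "((\<lambda>\<rho>. - (?k \<rho> * (?h \<rho>)\<^sup>2 + 2/s\<^sup>2 * f (\<rho>, \<theta>))) has_integral ?G s - ?G 0) {0..s}"
  proof (rule fundamental_theorem_of_calculus)
    fix \<rho> assume \<rho>: "\<rho> \<in> {0..s}"
    have alg: "- k * H\<^sup>2 + of_nat 2 * ((- (1/s)) * H ^ (2 - Suc 0)) * F1 + 2/s * (F1 * H + (- (1/s)) * F) = - (k * H\<^sup>2 + 2/s\<^sup>2 * F)"
      for k H F F1 :: real
      using s by (simp add: field_simps power2_eq_square)
    have h: "(?h has_real_derivative - (1/s)) (at \<rho> within {0..s})"
      using s by (auto intro!: derivative_eq_intros)
    have "(?G has_real_derivative - (?k \<rho> * (?h \<rho>)\<^sup>2 + 2/s\<^sup>2 * f (\<rho>, \<theta>))) (at \<rho> within {0..s})"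
      by (rule DERIV_cong[OF DERIV_add[OF DERIV_mult[OF d(2)[OF \<rho>] DERIV_power[OF h]] DERIV_cmult[OF DERIV_mult[OF d(1)[OF \<rho>] h]]]])
        (rule alg[of "?k \<rho>" "?h \<rho>" "f1 (\<rho>, \<theta>)" "f (\<rho>, \<theta>)"])
    then show "(?G has_vector_derivative - (?k \<rho> * (?h \<rho>)\<^sup>2 + 2/s\<^sup>2 * f (\<rho>, \<theta>))) (at \<rho> within {0..s})"
      by (simp add: has_real_derivative_iff_has_vector_derivative)
  qed (use s in simp)
  moreover have "?G s - ?G 0 = - 1" using s \<theta> by (simp add: f1_0 f_def J_0)
  ultimately have "((\<lambda>\<rho>. - (?k \<rho> * (?h \<rho>)\<^sup>2 + 2/s\<^sup>2 * f (\<rho>, \<theta>))) has_integral - 1) {0..s}"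
    by (simp only:)
  then have 1: "((\<lambda>\<rho>. ?k \<rho> * (?h \<rho>)\<^sup>2 + 2/s\<^sup>2 * f (\<rho>, \<theta>)) has_integral 1) {0..s}"
    unfolding has_integral_neg_iff by (simp only: minus_minus)
  have "continuous_on {0..s} (\<lambda>\<rho>. f (\<rho>, \<theta>))"
    by (rule continuous_on_subset[OF continuous_on_polar_rect_section(1)[OF continuous_on_f(1) \<theta>]]) (use s in auto)
  then have "((\<lambda>\<rho>. 2/s\<^sup>2 * f (\<rho>, \<theta>)) has_integral 2/s\<^sup>2 * integral {0..s} (\<lambda>\<rho>. f (\<rho>, \<theta>))) {0..s}"
    by (intro has_integral_mult_right integrable_integral integrable_continuous_real)
  from has_integral_diff[OF 1 this] show ?thesis by (simp add: integral_unique)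
qed

lemma negligible_complement:
  "negligible (disc - \<Phi> ` ({0<..<r} \<times> {0<..<2*pi}))"
proof (rule negligible_subset)
  have "(\<lambda>\<rho>. \<Phi> (\<rho>, 0)) differentiable_on {0..r}"
    using partial_rhoD[OF \<Phi>_partial(1), of _ 0]
    unfolding differentiable_on_def has_vector_derivative_def differentiable_def by fastforce
  then have "negligible ((\<lambda>\<rho>. \<Phi> (\<rho>, 0)) ` {0..r})"
    by (intro negligible_differentiable_image_lowdim) auto
  then show "negligible ({w0} \<union> sphere 0 1 \<union> (\<lambda>\<rho>. \<Phi> (\<rho>, 0)) ` {0..r})"
    using negligible_sphere by (intro negligible_Un) auto
  show "disc - \<Phi> ` ({0<..<r} \<times> {0<..<2*pi}) \<subseteq> {w0} \<union> sphere 0 1 \<union> (\<lambda>\<rho>. \<Phi> (\<rho>, 0)) ` {0..r}"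
  proof
    fix w assume w: "w \<in> disc - \<Phi> ` ({0<..<r} \<times> {0<..<2*pi})"
    show "w \<in> {w0} \<union> sphere 0 1 \<union> (\<lambda>\<rho>. \<Phi> (\<rho>, 0)) ` {0..r}"
    proof (cases "w = w0")
      case False
      then have "w \<in> \<Phi> ` ({0<..r} \<times> {0..<2*pi})" using w \<Phi>_bij by (auto simp: bij_betw_def)
      then obtain \<rho> \<theta> where p: "w = \<Phi> (\<rho>, \<theta>)" "0 < \<rho>" "\<rho> \<le> r" "0 \<le> \<theta>" "\<theta> < 2*pi" by auto
      then have "\<rho> = r \<or> \<theta> = 0" using w by force
      then show ?thesis using p \<Phi>_r by force
    qed simp
  qed
qed

text \<open>
  The substitution rule is applied on the open rectangle, where \<open>\<Phi>\<close> is injective; the sphere, the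
  centre and the ray \<open>\<theta> = 0\<close>, which its image misses, have measure zero. The rectangle is first moved
  from pairs to \<open>real^2\<close>, the setting of that rule.
\<close>
lemma integral_disc_polar:
  fixes g :: "real^2 \<Rightarrow> real"
  assumes g: "continuous_on disc g"
  shows "integral disc g = integral R (\<lambda>p. g (\<Phi> p) * J p)"
proof -
  define L where "L v = (v $ 1, v $ 2)" for v :: "real^2"
  let ?lo = "vector [0, 0] :: real^2" and ?hi = "vector [r, 2*pi] :: real^2"
  define S where "S = box ?lo ?hi"
  define \<Psi> where "\<Psi> v = \<Phi> (L v)" for v
  define \<Psi>' where "\<Psi>' v = (\<lambda>h::real^2. (h $ 1) *\<^sub>R A (L v) + (h $ 2) *\<^sub>R B (L v))" for v
  have LS: "L v \<in> R" if "v \<in> cbox ?lo ?hi" for v using that by (simp add: L_def R_iff mem_box_cart forall_2)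
  have SI: "v \<in> S \<longleftrightarrow> L v \<in> {0<..<r} \<times> {0<..<2*pi}" for v by (simp add: S_def L_def mem_box_cart forall_2)
  have LimS: "L ` S = {0<..<r} \<times> {0<..<2*pi}"
  proof -
    have "p \<in> L ` S" if "p \<in> {0<..<r} \<times> {0<..<2*pi}" for p
    proof -
      have "L (vector [fst p, snd p]) = p" by (simp add: L_def)
      then show ?thesis using SI that by (metis imageI)
    qed
    then show ?thesis using SI by blast
  qed
  have deriv: "(\<Psi> has_derivative \<Psi>' v) (at v within S)" if v: "v \<in> S" for v
  proof -
    have "(L has_derivative (\<lambda>h. (h $ 1, h $ 2))) (at v within S)"
      unfolding L_def[abs_def]
      by (intro has_derivative_Pair bounded_linear_imp_has_derivative bounded_linear_vec_nth)
    moreover have "(\<Phi> has_derivative (\<lambda>h. fst h *\<^sub>R A (L v) + snd h *\<^sub>R B (L v))) (at (L v) within L ` S)"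
    proof (rule has_derivative_subset)
      show "(\<Phi> has_derivative (\<lambda>h. fst h *\<^sub>R A (L v) + snd h *\<^sub>R B (L v))) (at (L v) within R)"
        using Ck_on_1_polar_rect(1)[OF r Ck_\<Phi>] LS box_subset_cbox v unfolding A_def B_def S_def by blast
      show "L ` S \<subseteq> R" using LS box_subset_cbox[of ?lo ?hi] unfolding S_def by blast
    qed
    ultimately show ?thesis
      using has_derivative_in_compose[of L "\<lambda>h. (h $ 1, h $ 2)" v S \<Phi> "\<lambda>h. fst h *\<^sub>R A (L v) + snd h *\<^sub>R B (L v)"] unfolding \<Psi>_def[abs_def] \<Psi>'_def by simp
  qed
  have det: "det (matrix (\<Psi>' v)) = D (L v)" for v
    by (simp add: det_2 matrix_def \<Psi>'_def D_def axis_def)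
  have inj: "inj_on \<Psi> S"
  proof (rule inj_onI)
    fix u v assume uv: "u \<in> S" "v \<in> S" "\<Psi> u = \<Psi> v"
    have "inj_on \<Phi> ({0<..r} \<times> {0..<2*pi})" using \<Phi>_bij by (auto simp: bij_betw_def)
    moreover have "{0<..<r} \<times> {0<..<2*pi} \<subseteq> {0<..r} \<times> {0..<2*pi}" by auto
    ultimately have "L u = L v" using uv SI unfolding \<Psi>_def by (meson inj_onD subsetD)
    then show "u = v" by (simp add: L_def vec_eq_iff forall_2)
  qed
  \<comment> \<open>Real-valued functions enter the substitution rule as vectors with one component.\<close>
  define G where "G w = (vec (g w) :: real^1)" for w
  have cont: "continuous_on (cbox ?lo ?hi) (\<lambda>v. \<bar>D (L v)\<bar> *\<^sub>R G (\<Psi> v))"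
  proof -
    have "continuous_on R (\<lambda>p. \<bar>D p\<bar> *\<^sub>R G (\<Phi> p))"
      unfolding G_def vec_def by (intro continuous_intros continuous_on_comp_\<Phi> g)
    then show ?thesis unfolding \<Psi>_def
      by (rule continuous_on_compose2[where g="\<lambda>p. \<bar>D p\<bar> *\<^sub>R G (\<Phi> p)"]) (use LS in \<open>auto simp: L_def intro!: continuous_intros\<close>)
  qed
  have abs: "(\<lambda>v. \<bar>D (L v)\<bar> *\<^sub>R G (\<Psi> v)) absolutely_integrable_on S"
    unfolding S_def
    by (rule set_integrable_subset[OF absolutely_integrable_continuous[OF cont]]) (auto simp: box_subset_cbox)
  have "G absolutely_integrable_on \<Psi> ` S \<and> integral (\<Psi> ` S) G = integral S (\<lambda>v. \<bar>D (L v)\<bar> *\<^sub>R G (\<Psi> v))"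
    using has_absolute_integral_change_of_variables[OF _ deriv inj, of G "integral S (\<lambda>v. \<bar>D (L v)\<bar> *\<^sub>R G (\<Psi> v))"] abs
    by (simp add: det S_def)
  then have Gi: "G integrable_on \<Psi> ` S" and GI: "integral (\<Psi> ` S) G = integral S (\<lambda>v. \<bar>D (L v)\<bar> *\<^sub>R G (\<Psi> v))"
    using set_lebesgue_integral_eq_integral(1) by auto
  have Si: "(\<lambda>v. \<bar>D (L v)\<bar> *\<^sub>R G (\<Psi> v)) integrable_on S"
    using abs set_lebesgue_integral_eq_integral(1) by blast
  have im: "\<Psi> ` S = \<Phi> ` ({0<..<r} \<times> {0<..<2*pi})"
    by (simp only: LimS[symmetric] image_image \<Psi>_def[abs_def])
  have sub: "\<Psi> ` S \<subseteq> disc" 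
  proof -
    have "{0<..<r} \<times> {0<..<2*pi} \<subseteq> R" by (auto simp: R_iff)
    then show ?thesis unfolding im using \<Phi>_disc by blast
  qed
  have "integral disc g = integral (\<Psi> ` S) g"
  proof (rule integral_spike_set)
    show "negligible {x \<in> disc - \<Psi> ` S. g x \<noteq> 0}"
      by (rule negligible_subset[OF negligible_complement]) (use im in blast)
    have "{x \<in> \<Psi> ` S - disc. g x \<noteq> 0} = {}" using sub by blast
    then show "negligible {x \<in> \<Psi> ` S - disc. g x \<noteq> 0}" by (simp only: negligible_empty)
  qed
  also have "\<dots> = integral (\<Psi> ` S) G $ 1"
    using integral_component_eq_cart[OF Gi, of 1] by (simp add: G_def)
  also have "\<dots> = integral S (\<lambda>v. \<bar>D (L v)\<bar> * g (\<Psi> v))"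
    using integral_component_eq_cart[OF Si, of 1] by (simp add: GI G_def)
  also have "\<dots> = integral (cbox ?lo ?hi) (\<lambda>v. \<bar>D (L v)\<bar> * g (\<Psi> v))"
    unfolding S_def by (rule integral_open_interval)
  also have "\<dots> = integral R (\<lambda>p. \<bar>D p\<bar> * g (\<Phi> p))"
  proof -
    have "continuous_on R (\<lambda>p. \<bar>D p\<bar> * g (\<Phi> p))"
      by (intro continuous_intros continuous_on_comp_\<Phi> g)
    then have "(\<lambda>p. \<bar>D p\<bar> * g (\<Phi> p)) integrable_on R"
      unfolding polar_rect_cbox by (rule integrable_continuous)
    then have "((\<lambda>p. \<bar>D p\<bar> * g (\<Phi> p)) has_integral integral R (\<lambda>p. \<bar>D p\<bar> * g (\<Phi> p))) (cbox (0, 0) (r, 2*pi))"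
      using integrable_integral polar_rect_cbox by metis
    from integral_unique[OF has_integral_cart2_prod[OF this]]
    show ?thesis by (simp only: L_def \<Psi>_def)
  qed
  also have "\<dots> = integral R (\<lambda>p. g (\<Phi> p) * J p)"
    by (rule integral_cong) (simp add: J_eq_abs)
  finally show ?thesis .
qed

lemma area_eq: "area X = integral R f"
  unfolding area_def f_def[abs_def] using integral_disc_polar[OF continuous_on_W] by (simp add: mult.commute)

end

section \<open>Mollified cones\<close>

lemma integral_polar_rect:
  fixes F :: "real \<times> real \<Rightarrow> real"
  assumes "continuous_on (polar_rect s) F"
  shows "integral (polar_rect s) F = integral {0..s} (\<lambda>\<rho>. integral {0..2*pi} (\<lambda>\<theta>. F (\<rho>, \<theta>)))"
    and "integral (polar_rect s) F = integral {0..2*pi} (\<lambda>\<theta>. integral {0..s} (\<lambda>\<rho>. F (\<rho>, \<theta>)))"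
proof -
  have 1: "continuous_on (cbox (0, 0) (s, 2*pi)) F" using assms by (simp add: polar_rect_cbox)
  then have 2: "continuous_on (cbox (0, 0) (s, 2*pi)) (\<lambda>(x, y). F (x, y))" by simp
  show "integral (polar_rect s) F = integral {0..s} (\<lambda>\<rho>. integral {0..2*pi} (\<lambda>\<theta>. F (\<rho>, \<theta>)))"
    using integral_prod_continuous[OF 1] by (simp add: polar_rect_cbox cbox_interval)
  then show "integral (polar_rect s) F = integral {0..2*pi} (\<lambda>\<theta>. integral {0..s} (\<lambda>\<rho>. F (\<rho>, \<theta>)))"
    using integral_swap_continuous[OF 2] by (simp add: cbox_interval)
qed

lemma polar_rect_mono: "s \<le> r \<Longrightarrow> polar_rect s \<subseteq> polar_rect r"
  by (auto simp: polar_rect_def)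

context polar_disc
begin

lemma \<Phi>_eqD:
  assumes "(\<rho>, \<theta>) \<in> R" "(\<rho>', \<theta>') \<in> R" and eq: "\<Phi> (\<rho>, \<theta>) = \<Phi> (\<rho>', \<theta>')"
  shows "\<rho> = \<rho>'" and "0 < \<rho> \<Longrightarrow> 0 < \<theta> \<Longrightarrow> \<theta> < 2*pi \<Longrightarrow> \<theta> = \<theta>'"
proof -
  \<comment> \<open>The angles \<open>0\<close> and \<open>2\<pi>\<close> describe the same ray; \<open>\<Phi>\<close> is injective for reduced angles.\<close>
  define red where "red t = (if t = 2*pi then 0 else t)" for t :: real
  have red: "\<Phi> (x, red t) = \<Phi> (x, t)" "red t \<in> {0..<2*pi}" if "(x, t) \<in> R" for x t
    using that \<Phi>_per by (auto simp: red_def R_iff)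
  have inj: "inj_on \<Phi> ({0<..r} \<times> {0..<2*pi})" and im: "\<Phi> ` ({0<..r} \<times> {0..<2*pi}) = disc - {w0}"
    using \<Phi>_bij by (auto simp: bij_betw_def)
  have w0_iff: "\<Phi> (x, t) = w0 \<longleftrightarrow> x = 0" if "(x, t) \<in> R" for x t
  proof
    assume *: "\<Phi> (x, t) = w0"
    show "x = 0"
    proof (rule ccontr)
      assume "x \<noteq> 0"
      then have "(x, red t) \<in> {0<..r} \<times> {0..<2*pi}" using that red(2)[OF that] by (auto simp: R_iff)
      then have "\<Phi> (x, red t) \<in> disc - {w0}" using im by blast
      then show False using * red(1)[OF that] by simp
    qed
  qed (use that \<Phi>_0 in \<open>auto simp: R_iff\<close>)
  have 1: "(\<rho>, red \<theta>) = (\<rho>', red \<theta>')" if "\<rho> \<noteq> 0"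
  proof (rule inj_onD[OF inj])
    have "\<rho>' \<noteq> 0" using that w0_iff[OF assms(1)] w0_iff[OF assms(2)] eq by simp
    then show "(\<rho>, red \<theta>) \<in> {0<..r} \<times> {0..<2*pi}" "(\<rho>', red \<theta>') \<in> {0<..r} \<times> {0..<2*pi}"
      using assms that red(2)[OF assms(1)] red(2)[OF assms(2)] by (auto simp: R_iff)
    show "\<Phi> (\<rho>, red \<theta>) = \<Phi> (\<rho>', red \<theta>')" using red(1) assms by simp
  qed
  show "\<rho> = \<rho>'" using 1 w0_iff[OF assms(1)] w0_iff[OF assms(2)] eq by (cases "\<rho> = 0") auto
  show "\<theta> = \<theta>'" if "0 < \<rho>" "0 < \<theta>" "\<theta> < 2*pi"
    using 1 that by (auto simp: red_def split: if_splits)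
qed

lemma \<Phi>_interior:
  assumes "(\<rho>, \<theta>) \<in> R" "\<rho> < r" shows "norm (\<Phi> (\<rho>, \<theta>)) < 1"
proof (rule ccontr)
  assume "\<not> norm (\<Phi> (\<rho>, \<theta>)) < 1"
  then have "\<Phi> (\<rho>, \<theta>) \<in> sphere 0 1" using \<Phi>_disc[OF assms(1)] by auto
  then have "\<Phi> (\<rho>, \<theta>) \<in> \<Phi> ` ({r} \<times> {0..2*pi})" by (simp only: \<Phi>_r)
  then obtain t where "t \<in> {0..2*pi}" "\<Phi> (\<rho>, \<theta>) = \<Phi> (r, t)" by blast
  then show False using \<Phi>_eqD(1)[OF assms(1), of r t] r assms by (auto simp: R_iff)
qed

lemma compact_R: "compact R" by (simp add: polar_rect_cbox)

text \<open>
  Off the cut, nearby values have nearby polar coordinates. This is a compactness argument: \<open>\<Phi> p\<close> is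
  taken at \<open>p\<close> only, so it has positive distance from the image of the complement of a ball about \<open>p\<close>.
\<close>
lemma \<Phi>_inverse_continuous:
  assumes p: "p \<in> {0<..<r} \<times> {0<..<2*pi}" and \<delta>: "\<delta> > 0"
  obtains \<epsilon> where "\<epsilon> > 0" "\<And>p'. p' \<in> R \<Longrightarrow> dist (\<Phi> p) (\<Phi> p') < \<epsilon> \<Longrightarrow> dist p p' < \<delta>"
proof -
  let ?C = "\<Phi> ` (R - ball p \<delta>)"
  have "compact ?C"
    by (intro compact_continuous_image continuous_on_subset[OF \<Phi>_continuous(1)] compact_diff compact_R) auto
  moreover have "\<Phi> p \<notin> ?C"
  proof
    assume "\<Phi> p \<in> ?C"
    then obtain p' where p': "\<Phi> p = \<Phi> p'" "p' \<in> R" "p' \<notin> ball p \<delta>" by auto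
    have "(fst p, snd p) \<in> R" using p by (auto simp: R_iff)
    then have "p = p'" using \<Phi>_eqD[of "fst p" "snd p" "fst p'" "snd p'"] p p' by (auto simp: prod_eq_iff)
    then show False using p' \<delta> by simp
  qed
  ultimately obtain \<epsilon> where \<epsilon>: "\<epsilon> > 0" "\<And>x. x \<in> ?C \<Longrightarrow> \<epsilon> \<le> dist (\<Phi> p) x"
    using separate_point_closed[of ?C "\<Phi> p"] compact_imp_closed by blast
  have "dist p p' < \<delta>" if "p' \<in> R" "dist (\<Phi> p) (\<Phi> p') < \<epsilon>" for p'
  proof (rule ccontr)
    assume "\<not> dist p p' < \<delta>"
    then have "\<Phi> p' \<in> ?C" using that by simp
    then show False using \<epsilon>(2) that by fastforce
  qed
  then show thesis using that \<epsilon>(1) by blast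
qed

lemma A_per: "\<rho> \<in> {0..r} \<Longrightarrow> A (\<rho>, 2*pi) = A (\<rho>, 0)"
proof -
  assume \<rho>: "\<rho> \<in> {0..r}"
  have "((\<lambda>\<rho>. \<Phi> (\<rho>, 2*pi)) has_vector_derivative A (\<rho>, 0)) (at \<rho> within {0..r})"
    by (rule has_vector_derivative_transform[OF \<rho> _ partial_rhoD[OF \<Phi>_partial(1) \<rho>]]) (use \<Phi>_per in auto)
  then show ?thesis
    using vector_derivative_unique_interval[OF r \<rho> partial_rhoD[OF \<Phi>_partial(1) \<rho>]] by auto
qed

lemma B_partial: "partial_rho r B A2"
  by (rule partial_swap[OF r \<Phi>_partial(1) _ \<Phi>_partial(2,4)]) (intro continuous_intros)+

text \<open>
  If \<open>k\<close> is a function \<open>\<kappa>\<close> on the disc, read in polar coordinates, then \<open>B\<^sub>i k\<^sub>\<rho> - A\<^sub>i k\<^sub>\<theta>\<close> is up to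
  sign the Jacobian times a partial derivative of \<open>\<kappa>\<close>. So the identity is the weak differentiability
  of \<open>(1 - \<rho>/s)\<^sub>+\<close>, stated and proved without leaving the polar rectangle.
  On integrating by parts the mixed derivatives \<open>A\<^sub>\<theta> = B\<^sub>\<rho>\<close> cancel. The boundary terms vanish because
  \<open>k\<close> and \<open>A\<close> agree on the two sides of the cut, \<open>B = 0\<close> at \<open>\<rho> = 0\<close>, and \<open>1 - \<rho>/s = 0\<close> at \<open>\<rho> = s\<close>.
\<close>
lemma weak_divergence:
  fixes k k1 k2 :: "real \<times> real \<Rightarrow> real"
  assumes s: "0 < s" "s \<le> r"
    and k: "partial_rho r k k1" "partial_theta r k k2"
    and [continuous_intros]: "continuous_on R k" "continuous_on R k1" "continuous_on R k2"
    and per: "\<And>\<rho>. \<rho> \<in> {0..r} \<Longrightarrow> k (\<rho>, 2*pi) = k (\<rho>, 0)"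
  shows "integral (polar_rect s) (\<lambda>p. (1 - fst p / s) * (B p $ i * k1 p - A p $ i * k2 p))
    = 1/s * integral (polar_rect s) (\<lambda>p. B p $ i * k p)"
proof -
  have sub: "polar_rect s \<subseteq> R" by (rule polar_rect_mono[OF s(2)])
  define q1 where "q1 p = A2 p $ i * k p + B p $ i * k1 p" for p
  define u2 where "u2 p = A2 p $ i * k p + A p $ i * k2 p" for p
  have q: "partial_rho r (\<lambda>p. B p $ i * k p) q1"
    by (rule partial_rho_cong[OF partial_rho_bilinear[OF bounded_bilinear_mult partial_rho_linear[OF bounded_linear_vec_nth[of i] B_partial] k(1)]])
      (simp_all add: q1_def)
  have u: "partial_theta r (\<lambda>p. A p $ i * k p) u2"
    by (rule partial_theta_cong[OF partial_theta_bilinear[OF bounded_bilinear_mult partial_theta_linear[OF bounded_linear_vec_nth[of i] \<Phi>_partial(4)] k(2)]])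
      (simp_all add: u2_def)
  have c1: "continuous_on (polar_rect s) (\<lambda>p. (1 - fst p / s) * q1 p)"
    and c2: "continuous_on (polar_rect s) (\<lambda>p. (1 - fst p / s) * u2 p)"
    and c3: "continuous_on (polar_rect s) (\<lambda>p. B p $ i * k p)"
    using s unfolding q1_def u2_def by (intro continuous_on_subset[OF _ sub] continuous_intros; simp)+
  have I1: "integral (polar_rect s) (\<lambda>p. (1 - fst p / s) * q1 p) = 1/s * integral (polar_rect s) (\<lambda>p. B p $ i * k p)"
  proof -
    have "integral {0..s} (\<lambda>\<rho>. (1 - \<rho> / s) * q1 (\<rho>, \<theta>)) = 1/s * integral {0..s} (\<lambda>\<rho>. B (\<rho>, \<theta>) $ i * k (\<rho>, \<theta>))"
      if \<theta>: "\<theta> \<in> {0..2*pi}" for \<theta>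
    proof -
      let ?q = "\<lambda>\<rho>. B (\<rho>, \<theta>) $ i * k (\<rho>, \<theta>)"
      have "((\<lambda>\<rho>. (1 - \<rho> / s) * q1 (\<rho>, \<theta>) + (- (1/s)) * ?q \<rho>) has_integral (1 - s/s) * ?q s - (1 - 0/s) * ?q 0) {0..s}"
      proof (rule fundamental_theorem_of_calculus)
        fix \<rho> assume \<rho>: "\<rho> \<in> {0..s}"
        have "(?q has_vector_derivative q1 (\<rho>, \<theta>)) (at \<rho> within {0..s})"
          by (rule has_vector_derivative_within_subset[OF partial_rhoD[OF q]]) (use \<rho> s \<theta> in auto)
        moreover have "((\<lambda>\<rho>. 1 - \<rho>/s) has_vector_derivative - (1/s)) (at \<rho> within {0..s})"
          unfolding has_real_derivative_iff_has_vector_derivative[symmetric]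
          using s by (auto intro!: derivative_eq_intros)
        ultimately show "((\<lambda>\<rho>. (1 - \<rho>/s) * ?q \<rho>) has_vector_derivative (1 - \<rho> / s) * q1 (\<rho>, \<theta>) + (- (1/s)) * ?q \<rho>) (at \<rho> within {0..s})"
          by (intro has_vector_derivative_mult)
      qed (use s in simp)
      moreover have "(1 - s/s) * ?q s - (1 - 0/s) * ?q 0 = 0" using s B_0[OF \<theta>] by simp
      ultimately have 1: "((\<lambda>\<rho>. (1 - \<rho> / s) * q1 (\<rho>, \<theta>) + (- (1/s)) * ?q \<rho>) has_integral 0) {0..s}" by (simp only:)
      have "((\<lambda>\<rho>. 1/s * ?q \<rho>) has_integral 1/s * integral {0..s} ?q) {0..s}"
        using continuous_on_polar_rect_section(1)[OF c3 \<theta>]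
        by (intro has_integral_mult_right integrable_integral integrable_continuous_real)
      from has_integral_add[OF 1 this] show ?thesis by (simp add: integral_unique)
    qed
    then show ?thesis
      unfolding integral_polar_rect(2)[OF c1] integral_polar_rect(2)[OF c3] integral_mult_right[symmetric] fst_conv
      by (rule integral_cong)
  qed
  have I2: "integral (polar_rect s) (\<lambda>p. (1 - fst p / s) * u2 p) = 0"
  proof -
    have "integral {0..2*pi} (\<lambda>\<theta>. u2 (\<rho>, \<theta>)) = 0" if \<rho>: "\<rho> \<in> {0..s}" for \<rho>
    proof -
      have \<rho>r: "\<rho> \<in> {0..r}" using \<rho> s by auto
      have "((\<lambda>\<theta>. u2 (\<rho>, \<theta>)) has_integral A (\<rho>, 2*pi) $ i * k (\<rho>, 2*pi) - A (\<rho>, 0) $ i * k (\<rho>, 0)) {0..2*pi}"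
        by (rule fundamental_theorem_of_calculus) (use partial_thetaD[OF u \<rho>r] in auto)
      then show ?thesis by (simp add: A_per[OF \<rho>r] per[OF \<rho>r] integral_unique)
    qed
    then have "integral (polar_rect s) (\<lambda>p. (1 - fst p / s) * u2 p) = integral {0..s} (\<lambda>\<rho>. 0)"
      unfolding integral_polar_rect(1)[OF c2] by (intro integral_cong) simp
    then show ?thesis by simp
  qed
  have "integral (polar_rect s) (\<lambda>p. (1 - fst p / s) * (B p $ i * k1 p - A p $ i * k2 p))
      = integral (polar_rect s) (\<lambda>p. (1 - fst p / s) * q1 p - (1 - fst p / s) * u2 p)"
    by (simp add: q1_def u2_def algebra_simps)
  also have "\<dots> = integral (polar_rect s) (\<lambda>p. (1 - fst p / s) * q1 p) - integral (polar_rect s) (\<lambda>p. (1 - fst p / s) * u2 p)"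
    using c1 c2 unfolding polar_rect_cbox by (intro integral_diff integrable_continuous)
  finally show ?thesis by (simp add: I1 I2)
qed

text \<open>
  The unit field \<open>e\<close> is the gradient of \<open>\<rho>\<close>, and \<open>e \<bullet> X\<^sub>i\<close> are its covariant components. Multiplied by the
  Jacobian they are entries of the cofactor matrix of \<open>(A, B)\<close>, which is the form that integration by
  parts produces.
\<close>
lemma gradient_rho_Cramer:
  assumes p: "p \<in> R"
  shows "(e p \<bullet> pd 1 X (\<Phi> p)) * J p = \<sigma> * B p $ 2" "(e p \<bullet> pd 2 X (\<Phi> p)) * J p = - (\<sigma> * B p $ 1)"
proof -
  have "D p *\<^sub>R pd 1 X (\<Phi> p) = B p $ 2 *\<^sub>R e p - A p $ 2 *\<^sub>R b p"
    "D p *\<^sub>R pd 2 X (\<Phi> p) = A p $ 1 *\<^sub>R b p - B p $ 1 *\<^sub>R e p"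
    by (simp_all add: D_def e_def b_def algebra_simps)
  from this[THEN arg_cong[where f="\<lambda>v. e p \<bullet> v"]]
  have "D p * (e p \<bullet> pd 1 X (\<Phi> p)) = B p $ 2" "D p * (e p \<bullet> pd 2 X (\<Phi> p)) = - (B p $ 1)"
    by (simp_all add: inner_diff_right e_e[OF p] e_b[OF p])
  then show "(e p \<bullet> pd 1 X (\<Phi> p)) * J p = \<sigma> * B p $ 2" "(e p \<bullet> pd 2 X (\<Phi> p)) * J p = - (\<sigma> * B p $ 1)"
    by (simp_all add: J_def algebra_simps)
qed

text \<open>
  The mollification at \<open>w\<close> of the function that is \<open>m\<close> in polar coordinates on the geodesic disc of
  radius \<open>s\<close> and zero outside. In particular \<open>cone_test s \<epsilon>\<close> mollifies the cone \<open>(1 - \<rho>/s)\<^sub>+\<close>.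
\<close>
definition average :: "real \<Rightarrow> real \<Rightarrow> (real \<times> real \<Rightarrow> real) \<Rightarrow> real^2 \<Rightarrow> real" where
  "average s \<epsilon> m w = integral (polar_rect s) (\<lambda>p. m p * J p * mollifier \<epsilon> (w - \<Phi> p))"

definition cone_test :: "real \<Rightarrow> real \<Rightarrow> real^2 \<Rightarrow> real" where
  "cone_test s \<epsilon> = average s \<epsilon> (\<lambda>p. 1 - fst p / s)"

lemma continuous_on_mollifier_\<Phi>: "continuous_on R (\<lambda>p. mollifier \<epsilon> (w - \<Phi> p))"
  by (intro continuous_on_compose2[OF Ck_on_imp_continuous_on[OF Ck_on_mollifier[of 0 UNIV]]] continuous_intros) auto

lemma Ck_on_average:
  assumes s: "s \<le> r" and m: "continuous_on R m"
  shows "Ck_on k UNIV (average s \<epsilon> m)"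
proof -
  have "continuous_on R (\<lambda>p. m p * J p)" by (intro continuous_intros m)
  note c = continuous_on_subset[OF this polar_rect_mono[OF s]] continuous_on_subset[OF \<Phi>_continuous(1) polar_rect_mono[OF s]]
  show ?thesis
    unfolding average_def[abs_def] polar_rect_cbox
    by (rule Ck_on_convolution(1)[OF c[unfolded polar_rect_cbox] Ck_on_mollifier])
qed

text \<open>
  The derivative of the mollified cone is the mollified derivative of the cone, whose covariant
  components are \<open>- (e \<bullet> X\<^sub>i) / s\<close> inside the geodesic disc of radius \<open>s\<close>.
\<close>
lemma pd_cone_test:
  assumes s: "0 < s" "s \<le> r" and w: "w \<in> disc"
  shows "pd i (cone_test s \<epsilon>) w = average s \<epsilon> (\<lambda>p. - (1/s) * (e p \<bullet> pd i X (\<Phi> p))) w"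
proof -
  have sub: "polar_rect s \<subseteq> R" by (rule polar_rect_mono[OF s(2)])
  let ?\<kappa> = "mollifier \<epsilon> :: real^2 \<Rightarrow> real"
  obtain \<kappa>' where \<kappa>': "\<And>x. (?\<kappa> has_derivative (\<lambda>h. \<Sum>b\<in>Basis. (h \<bullet> b) *\<^sub>R \<kappa>' b x)) (at x)"
    "\<And>b. b \<in> Basis \<Longrightarrow> continuous_on UNIV (\<kappa>' b)"
    using Ck_on_mollifier[of 1 UNIV \<epsilon>] unfolding One_nat_def Ck_on.simps by auto
  let ?k1 = "\<kappa>' (axis 1 1)" and ?k2 = "\<kappa>' (axis 2 1)"
  have \<kappa>'_cont: "continuous_on UNIV ?k1" "continuous_on UNIV ?k2" using \<kappa>'(2) by (auto simp: Basis_R2)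
  have c: "continuous_on R (\<lambda>p. (1 - fst p / s) * J p)" using s by (intro continuous_intros) auto
  note c' = continuous_on_subset[OF c sub] continuous_on_subset[OF \<Phi>_continuous(1) sub]
  have "(cone_test s \<epsilon> has_derivative
      (\<lambda>h. \<Sum>i\<in>Basis. (h \<bullet> i) *\<^sub>R integral (polar_rect s) (\<lambda>p. (1 - fst p / s) * J p * \<kappa>' i (w - \<Phi> p)))) (at w)"
    unfolding cone_test_def average_def[abs_def] polar_rect_cbox
    by (rule Ck_on_convolution(2)[OF c'[unfolded polar_rect_cbox] \<kappa>'])
  then have deriv: "(cone_test s \<epsilon> has_derivative
      (\<lambda>h. \<Sum>i\<in>Basis. (h \<bullet> i) *\<^sub>R integral (polar_rect s) (\<lambda>p. (1 - fst p / s) * J p * \<kappa>' i (w - \<Phi> p)))) (at w within disc)"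
    by (rule has_derivative_at_withinI)
  have "frechet_derivative (cone_test s \<epsilon>) (at w within disc) =
      (\<lambda>h. \<Sum>i\<in>Basis. (h \<bullet> i) *\<^sub>R integral (polar_rect s) (\<lambda>p. (1 - fst p / s) * J p * \<kappa>' i (w - \<Phi> p)))"
    using has_derivative_unique_convex[OF interior_disc w _ deriv] deriv frechet_derivative_works differentiable_def by blast
  then have pd: "pd j (cone_test s \<epsilon>) w = integral (polar_rect s) (\<lambda>p. (1 - fst p / s) * J p * \<kappa>' (axis j 1) (w - \<Phi> p))" for j
    using exhaust_2[of j] by (auto simp: pd_def sum_Basis_R2 inner_axis_axis axis_R2_neq)
  define k where "k p = ?\<kappa> (w - \<Phi> p)" for p
  define k1 where "k1 p = - (A p $ 1 * ?k1 (w - \<Phi> p) + A p $ 2 * ?k2 (w - \<Phi> p))" for p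
  define k2 where "k2 p = - (B p $ 1 * ?k1 (w - \<Phi> p) + B p $ 2 * ?k2 (w - \<Phi> p))" for p
  have "((\<lambda>z. ?\<kappa> (w - z)) has_derivative (\<lambda>h. (h $ 1) *\<^sub>R (- ?k1 (w - z)) + (h $ 2) *\<^sub>R (- ?k2 (w - z)))) (at z within UNIV)" for z
  proof -
    have "((\<lambda>z. w - z) has_derivative (\<lambda>h. - h)) (at z)" by (auto intro!: derivative_eq_intros)
    from has_derivative_compose[OF this \<kappa>'(1)] show ?thesis by (simp add: sum_Basis_R2 inner_axis)
  qed
  note kk = partial_rho_compose[OF this, of r \<Phi>] partial_theta_compose[OF this, of r \<Phi>]
  have kp: "partial_rho r k k1" "partial_theta r k k2"
    by (rule partial_rho_cong[OF kk(1)[OF _ \<Phi>_partial(1)]], auto simp: k_def k1_def)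
      (rule partial_theta_cong[OF kk(2)[OF _ \<Phi>_partial(2)]], auto simp: k_def k2_def)
  have kc: "continuous_on R k" unfolding k_def by (rule continuous_on_mollifier_\<Phi>)
  have kic: "continuous_on R (\<lambda>p. ?k1 (w - \<Phi> p))" "continuous_on R (\<lambda>p. ?k2 (w - \<Phi> p))"
    by (intro continuous_on_compose2[OF \<kappa>'_cont(1)] continuous_on_compose2[OF \<kappa>'_cont(2)] continuous_intros; simp)+
  have k12c: "continuous_on R k1" "continuous_on R k2"
    unfolding k1_def k2_def by (intro continuous_intros kic)+
  have per: "k (\<rho>, 2*pi) = k (\<rho>, 0)" if "\<rho> \<in> {0..r}" for \<rho> using that \<Phi>_per by (simp add: k_def)
  have div: "integral (polar_rect s) (\<lambda>p. (1 - fst p / s) * (B p $ j * k1 p - A p $ j * k2 p))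
      = 1/s * integral (polar_rect s) (\<lambda>p. B p $ j * k p)" for j
    by (rule weak_divergence[OF s kp kc k12c]) (rule per)
  have "average s \<epsilon> (\<lambda>p. - (1/s) * (e p \<bullet> pd 1 X (\<Phi> p))) w = - \<sigma> * (1/s * integral (polar_rect s) (\<lambda>p. B p $ 2 * k p))"
  proof -
    have "average s \<epsilon> (\<lambda>p. - (1/s) * (e p \<bullet> pd 1 X (\<Phi> p))) w = integral (polar_rect s) (\<lambda>p. (- \<sigma> * (1/s)) * (B p $ 2 * k p))"
      unfolding average_def k_def
    proof (rule integral_cong)
      fix p assume "p \<in> polar_rect s"
      then have "p \<in> R" using sub by blast
      from arg_cong[OF gradient_rho_Cramer(1)[OF this], of "\<lambda>x. - (1/s) * x * ?\<kappa> (w - \<Phi> p)"]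
      show "- (1/s) * (e p \<bullet> pd 1 X (\<Phi> p)) * J p * ?\<kappa> (w - \<Phi> p) = (- \<sigma> * (1/s)) * (B p $ 2 * ?\<kappa> (w - \<Phi> p))"
        by (simp add: algebra_simps)
    qed
    then show ?thesis by simp
  qed
  moreover have "pd 1 (cone_test s \<epsilon>) w = - \<sigma> * integral (polar_rect s) (\<lambda>p. (1 - fst p / s) * (B p $ 2 * k1 p - A p $ 2 * k2 p))"
    unfolding pd integral_mult_right[symmetric]
    by (intro integral_cong) (simp add: J_def D_def k1_def k2_def algebra_simps)
  moreover have "average s \<epsilon> (\<lambda>p. - (1/s) * (e p \<bullet> pd 2 X (\<Phi> p))) w = \<sigma> * (1/s * integral (polar_rect s) (\<lambda>p. B p $ 1 * k p))"
  proof -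
    have "average s \<epsilon> (\<lambda>p. - (1/s) * (e p \<bullet> pd 2 X (\<Phi> p))) w = integral (polar_rect s) (\<lambda>p. (\<sigma> * (1/s)) * (B p $ 1 * k p))"
      unfolding average_def k_def
    proof (rule integral_cong)
      fix p assume "p \<in> polar_rect s"
      then have "p \<in> R" using sub by blast
      from arg_cong[OF gradient_rho_Cramer(2)[OF this], of "\<lambda>x. - (1/s) * x * ?\<kappa> (w - \<Phi> p)"]
      show "- (1/s) * (e p \<bullet> pd 2 X (\<Phi> p)) * J p * ?\<kappa> (w - \<Phi> p) = (\<sigma> * (1/s)) * (B p $ 1 * ?\<kappa> (w - \<Phi> p))"
        by (simp add: algebra_simps)
    qed
    then show ?thesis by simp
  qed
  moreover have "pd 2 (cone_test s \<epsilon>) w = \<sigma> * integral (polar_rect s) (\<lambda>p. (1 - fst p / s) * (B p $ 1 * k1 p - A p $ 1 * k2 p))"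
    unfolding pd integral_mult_right[symmetric]
    by (intro integral_cong) (simp add: J_def D_def k1_def k2_def algebra_simps)
  ultimately show ?thesis using exhaust_2[of i] by (auto simp: div)
qed

end

section \<open>Removing the mollification\<close>

lemma integrable_on_disc: "continuous_on disc (g :: real^2 \<Rightarrow> real) \<Longrightarrow> g integrable_on disc"
  using borel_integrable_compact[OF compact_cball, of 0 1 g] set_borel_integral_eq_integral(1)[of disc g]
  by (simp add: set_integrable_def)

lemma mollifier_mass:
  assumes e: "\<epsilon> > 0"
  shows "integral disc (\<lambda>z. mollifier \<epsilon> (w - z)) \<le> 1"
    and "norm w + \<epsilon> \<le> 1 \<Longrightarrow> integral disc (\<lambda>z. mollifier \<epsilon> (w - z)) = 1"
proof -
  have I: "((\<lambda>x. mollifier \<epsilon> (w - x)) has_integral 1) UNIV" by (rule has_integral_mollifier[OF e])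
  have "integral disc (\<lambda>z. mollifier \<epsilon> (w - z)) \<le> integral UNIV (\<lambda>z. mollifier \<epsilon> (w - z))"
  proof (rule integral_subset_le)
    have "continuous_on disc (\<lambda>z. mollifier \<epsilon> (w - z))"
      by (intro continuous_on_compose2[OF Ck_on_imp_continuous_on[OF Ck_on_mollifier[of 0 UNIV]]] continuous_intros) auto
    then show "(\<lambda>z. mollifier \<epsilon> (w - z)) integrable_on disc" by (rule integrable_on_disc)
  qed (use I mollifier_nonneg[OF e] in auto)
  then show "integral disc (\<lambda>z. mollifier \<epsilon> (w - z)) \<le> 1" using I by (simp add: integral_unique)
  assume w: "norm w + \<epsilon> \<le> 1"
  have "mollifier \<epsilon> (w - z) = 0" if "z \<notin> disc" for z
  proof (rule mollifier_eq_0[OF e])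
    show "\<epsilon> \<le> norm (w - z)" using that w norm_triangle_ineq2[of z w] by (simp add: norm_minus_commute)
  qed
  then have "(\<lambda>z. if z \<in> disc then mollifier \<epsilon> (w - z) else 0) = (\<lambda>z. mollifier \<epsilon> (w - z))" by (auto simp del: mem_cball)
  then have "((\<lambda>z. mollifier \<epsilon> (w - z)) has_integral 1) disc"
    using I has_integral_restrict_UNIV[of disc "\<lambda>z. mollifier \<epsilon> (w - z)" 1] by (simp del: mem_cball)
  then show "integral disc (\<lambda>z. mollifier \<epsilon> (w - z)) = 1" by (rule integral_unique)
qed

lemma integrable_on_polar_rect: "continuous_on (polar_rect s) (F :: _ \<Rightarrow> real) \<Longrightarrow> F integrable_on polar_rect s"
  unfolding polar_rect_cbox by (rule integrable_continuous)

context polar_disc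
begin

lemma polar_mass:
  "integral R (\<lambda>p. J p * mollifier \<epsilon> (w - \<Phi> p)) = integral disc (\<lambda>z. mollifier \<epsilon> (w - z))"
proof -
  have "continuous_on disc (\<lambda>z. mollifier \<epsilon> (w - z))"
    by (intro continuous_on_compose2[OF Ck_on_imp_continuous_on[OF Ck_on_mollifier[of 0 UNIV]]] continuous_intros) auto
  from integral_disc_polar[OF this] show ?thesis by (simp add: mult.commute)
qed

lemma continuous_on_J_mollifier: "continuous_on R (\<lambda>p. J p * mollifier \<epsilon> (w - \<Phi> p))"
  by (intro continuous_intros continuous_on_mollifier_\<Phi>)

lemma average_bound:
  assumes s: "s \<le> r" and m: "continuous_on R m" and M: "\<And>p. p \<in> R \<Longrightarrow> \<bar>m p\<bar> \<le> M" and e: "\<epsilon> > 0"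
  shows "\<bar>average s \<epsilon> m w\<bar> \<le> M"
proof -
  have sub: "polar_rect s \<subseteq> R" by (rule polar_rect_mono[OF s])
  let ?k = "\<lambda>p. J p * mollifier \<epsilon> (w - \<Phi> p)"
  have k0: "?k p \<ge> 0" if "p \<in> R" for p by (intro mult_nonneg_nonneg J_nonneg[OF that] mollifier_nonneg[OF e])
  have M0: "M \<ge> 0" using M[of "(0, 0)"] r by (auto simp: R_iff)
  have kc: "continuous_on (polar_rect s) ?k" by (rule continuous_on_subset[OF continuous_on_J_mollifier sub])
  have kM: "(\<lambda>p. M * ?k p) integrable_on polar_rect s" "(\<lambda>p. M * ?k p) integrable_on R"
    by (intro integrable_on_polar_rect continuous_intros kc continuous_on_J_mollifier)+
  have mk: "(\<lambda>p. m p * J p * mollifier \<epsilon> (w - \<Phi> p)) integrable_on polar_rect s"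
    by (intro integrable_on_polar_rect continuous_on_subset[OF _ sub] continuous_intros m continuous_on_mollifier_\<Phi>)
  have "norm (average s \<epsilon> m w) \<le> integral (polar_rect s) (\<lambda>p. M * ?k p)"
    unfolding average_def
  proof (rule Henstock_Kurzweil_Integration.integral_norm_bound_integral[OF mk kM(1)])
    fix p assume "p \<in> polar_rect s"
    then have p: "p \<in> R" using sub by blast
    have "norm (m p * J p * mollifier \<epsilon> (w - \<Phi> p)) = \<bar>m p\<bar> * ?k p"
      by (simp only: real_norm_def abs_mult[of "m p"] mult.assoc abs_of_nonneg[OF k0[OF p]])
    also have "\<dots> \<le> M * ?k p" by (rule mult_right_mono[OF M[OF p] k0[OF p]])
    finally show "norm (m p * J p * mollifier \<epsilon> (w - \<Phi> p)) \<le> M * ?k p" .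
  qed
  also have "\<dots> \<le> integral R (\<lambda>p. M * ?k p)"
    by (rule integral_subset_le[OF sub kM]) (use k0 M0 in auto)
  also have "\<dots> = M * integral disc (\<lambda>z. mollifier \<epsilon> (w - z))"
    by (simp only: integral_mult_right polar_mass)
  also have "\<dots> \<le> M * 1" by (rule mult_left_mono[OF mollifier_mass(1)[OF e] M0])
  finally show ?thesis by simp
qed

text \<open>
  For small \<open>\<epsilon>\<close> the kernel sees only points whose polar coordinates are close to \<open>(\<rho>0, \<theta>0)\<close>. If
  \<open>\<rho>0 < s\<close> these lie in the region of integration, and the kernel has total mass one there; if
  \<open>\<rho>0 > s\<close> none of them does.
\<close>
lemma average_tendsto:
  assumes s: "0 < s" "s < r" and m: "continuous_on R m"
    and p0: "(\<rho>0, \<theta>0) \<in> {0<..<r} \<times> {0<..<2*pi}" "\<rho>0 \<noteq> s"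
    and \<epsilon>: "\<And>n. \<epsilon> n > 0" "\<epsilon> \<longlonglongrightarrow> (0::real)"
  shows "(\<lambda>n. average s (\<epsilon> n) m (\<Phi> (\<rho>0, \<theta>0))) \<longlonglongrightarrow> (if \<rho>0 < s then m (\<rho>0, \<theta>0) else 0)"
proof (rule tendstoI)
  fix \<tau> :: real assume \<tau>: "\<tau> > 0"
  let ?p = "(\<rho>0, \<theta>0)"
  have sub: "polar_rect s \<subseteq> R" by (rule polar_rect_mono) (use s in simp)
  have pR: "?p \<in> R" using p0 by (auto simp: R_iff)
  obtain d where d: "d > 0" "\<And>p. p \<in> R \<Longrightarrow> dist p ?p < d \<Longrightarrow> dist (m p) (m ?p) < \<tau> / 2"
    using m pR \<tau> unfolding continuous_on_iff by (metis half_gt_zero)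
  define \<delta> where "\<delta> = min d \<bar>s - \<rho>0\<bar>"
  have \<delta>: "\<delta> > 0" using d p0 by (simp add: \<delta>_def)
  obtain \<epsilon>0 where \<epsilon>0: "\<epsilon>0 > 0" "\<And>p. p \<in> R \<Longrightarrow> dist (\<Phi> ?p) (\<Phi> p) < \<epsilon>0 \<Longrightarrow> dist ?p p < \<delta>"
    using \<Phi>_inverse_continuous[OF p0(1) \<delta>] by metis
  have near: "dist (m p) (m ?p) < \<tau> / 2 \<and> \<bar>fst p - \<rho>0\<bar> < \<bar>s - \<rho>0\<bar>" if "p \<in> R" "dist (\<Phi> ?p) (\<Phi> p) < \<epsilon>0" for p
    using \<epsilon>0(2)[OF that] d(2)[OF that(1)] dist_fst_le[of ?p p]
    by (simp add: \<delta>_def dist_commute dist_real_def abs_minus_commute[of "fst p"])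
  have "norm (\<Phi> ?p) < 1" using \<Phi>_interior[OF pR] p0 by auto
  then have "min \<epsilon>0 (1 - norm (\<Phi> ?p)) > 0" using \<epsilon>0 by simp
  then have "eventually (\<lambda>n. \<epsilon> n < min \<epsilon>0 (1 - norm (\<Phi> ?p))) sequentially"
    using order_tendstoD(2)[OF \<epsilon>(2)] by blast
  then show "\<forall>\<^sub>F n in sequentially. dist (average s (\<epsilon> n) m (\<Phi> ?p)) (if \<rho>0 < s then m ?p else 0) < \<tau>"
  proof eventually_elim
    case (elim n)
    let ?\<kappa> = "\<lambda>p. mollifier (\<epsilon> n) (\<Phi> ?p - \<Phi> p)"
    have far: "?\<kappa> p = 0" if "p \<in> R" "\<not> (dist (m p) (m ?p) < \<tau> / 2 \<and> \<bar>fst p - \<rho>0\<bar> < \<bar>s - \<rho>0\<bar>)" for p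
    proof (rule mollifier_eq_0[OF \<epsilon>(1)])
      have "\<not> dist (\<Phi> ?p) (\<Phi> p) < \<epsilon>0" using near that by blast
      then show "\<epsilon> n \<le> norm (\<Phi> ?p - \<Phi> p)" using elim by (simp add: dist_norm)
    qed
    show ?case
    proof (cases "\<rho>0 < s")
      case False
      have "average s (\<epsilon> n) m (\<Phi> ?p) = integral (polar_rect s) (\<lambda>p. 0)"
        unfolding average_def
      proof (rule integral_cong)
        fix p assume p: "p \<in> polar_rect s"
        then have "fst p \<le> s" by (auto simp: polar_rect_def)
        then have "?\<kappa> p = 0" using False sub p by (intro far) auto
        then show "m p * J p * ?\<kappa> p = 0" by simp
      qed
      then show ?thesis using False \<tau> by simp
    next
      case True
      let ?k = "\<lambda>p. J p * ?\<kappa> p"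
      have kc: "continuous_on (polar_rect s) ?k" by (rule continuous_on_subset[OF continuous_on_J_mollifier sub])
      have mc: "continuous_on (polar_rect s) m" by (rule continuous_on_subset[OF m sub])
      have "integral (polar_rect s) ?k = integral R ?k"
      proof (rule integral_spike_set)
        have "{x \<in> polar_rect s - R. ?k x \<noteq> 0} = {}" using sub by blast
        then show "negligible {x \<in> polar_rect s - R. ?k x \<noteq> 0}" by (simp only: negligible_empty)
        have "?k p = 0" if "p \<in> R - polar_rect s" for p
        proof -
          have "fst p > s" using that by (cases p) (auto simp: mem_polar_rect)
          then have "?\<kappa> p = 0" using True that by (intro far) auto
          then show ?thesis by simp
        qed
        then have "{x \<in> R - polar_rect s. ?k x \<noteq> 0} = {}" by blast
        then show "negligible {x \<in> R - polar_rect s. ?k x \<noteq> 0}" by (simp only: negligible_empty)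
      qed
      also have "\<dots> = 1" unfolding polar_mass by (rule mollifier_mass(2)[OF \<epsilon>(1)]) (use elim in simp)
      finally have mass: "integral (polar_rect s) ?k = 1" .
      have "norm (integral (polar_rect s) (\<lambda>p. (m p - m ?p) * ?k p)) \<le> integral (polar_rect s) (\<lambda>p. \<tau> / 2 * ?k p)"
      proof (rule Henstock_Kurzweil_Integration.integral_norm_bound_integral)
        fix p assume "p \<in> polar_rect s"
        then have p: "p \<in> R" using sub by blast
        have k0: "?k p \<ge> 0" by (intro mult_nonneg_nonneg J_nonneg[OF p] mollifier_nonneg[OF \<epsilon>(1)])
        show "norm ((m p - m ?p) * ?k p) \<le> \<tau> / 2 * ?k p"
        proof (cases "?\<kappa> p = 0")
          case False
          then have "dist (m p) (m ?p) < \<tau> / 2" using far[OF p] by blast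
          then have "\<bar>m p - m ?p\<bar> \<le> \<tau> / 2" by (simp add: dist_real_def)
          from mult_right_mono[OF this k0] show ?thesis
            by (simp only: real_norm_def abs_mult[of "m p - m ?p"] abs_of_nonneg[OF k0])
        qed simp
      qed (intro integrable_on_polar_rect continuous_intros kc mc)+
      also have "\<dots> = \<tau> / 2" by (simp only: integral_mult_right mass mult_1_right)
      finally have *: "\<bar>integral (polar_rect s) (\<lambda>p. (m p - m ?p) * ?k p)\<bar> \<le> \<tau> / 2" by simp
      have "integral (polar_rect s) (\<lambda>p. (m p - m ?p) * ?k p) = integral (polar_rect s) (\<lambda>p. m p * ?k p - m ?p * ?k p)"
        by (simp only: left_diff_distrib)
      also have "\<dots> = integral (polar_rect s) (\<lambda>p. m p * ?k p) - integral (polar_rect s) (\<lambda>p. m ?p * ?k p)"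
        by (intro integral_diff integrable_on_polar_rect continuous_on_mult continuous_on_const kc mc)
      also have "integral (polar_rect s) (\<lambda>p. m p * ?k p) = average s (\<epsilon> n) m (\<Phi> ?p)"
        by (simp only: average_def mult.assoc)
      also have "integral (polar_rect s) (\<lambda>p. m ?p * ?k p) = m ?p" by (simp only: integral_mult_right mass mult_1_right)
      finally show ?thesis using * True \<tau> by (simp add: dist_real_def)
    qed
  qed
qed

lemma polar_dominated_convergence:
  fixes F :: "nat \<Rightarrow> real \<times> real \<Rightarrow> real"
  assumes s: "0 < s" "s < r" and F: "\<And>n. continuous_on R (F n)" and bd: "\<And>n p. p \<in> R \<Longrightarrow> \<bar>F n p\<bar> \<le> C"
    and lim: "\<And>\<rho> \<theta>. (\<rho>, \<theta>) \<in> {0<..<r} \<times> {0<..<2*pi} \<Longrightarrow> \<rho> \<noteq> s \<Longrightarrow> (\<lambda>n. F n (\<rho>, \<theta>)) \<longlonglongrightarrow> (if \<rho> < s then G (\<rho>, \<theta>) else 0)"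
  shows "(\<lambda>n. integral R (F n)) \<longlonglongrightarrow> integral (polar_rect s) G"
proof -
  \<comment> \<open>The null set where nothing is known about convergence: the boundary and the line \<open>\<rho> = s\<close>.\<close>
  define Z where "Z = (cbox (0, 0) (r, 2*pi) - box (0, 0) (r, 2*pi)) \<union> {p. (1, 0) \<bullet> p = s}"
  have Z: "negligible Z" unfolding Z_def
    by (intro negligible_Un negligible_frontier_interval negligible_hyperplane) (simp add: zero_prod_def)
  have notZ: "p \<in> {0<..<r} \<times> {0<..<2*pi} \<and> fst p \<noteq> s" if "p \<in> R - Z" for p
    using that by (cases p) (auto simp: Z_def polar_rect_cbox box_def Basis_prod_def)
  define F' where "F' n p = (if p \<in> Z then 0 else F n p)" for n p
  define G' where "G' p = (if p \<in> Z then 0 else if fst p < s then G p else 0)" for p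
  have conv: "(\<lambda>n. integral R (F' n)) \<longlonglongrightarrow> integral R G'"
  proof (rule dominated_convergence(2)[where h="\<lambda>_. C"])
    show "F' n integrable_on R" for n
      by (rule integrable_spike[OF integrable_on_polar_rect[OF F] Z]) (simp add: F'_def)
    show "(\<lambda>_. C) integrable_on R" by (intro integrable_on_polar_rect continuous_intros)
    show "norm (F' n p) \<le> C" if "p \<in> R" for n p using bd[OF that, of n] by (auto simp: F'_def)
    show "(\<lambda>n. F' n p) \<longlonglongrightarrow> G' p" if "p \<in> R" for p
    proof (cases "p \<in> Z")
      case False
      then show ?thesis using lim[of "fst p" "snd p"] notZ[of p] that by (auto simp: F'_def G'_def)
    qed (simp add: F'_def G'_def)
  qed
  have "integral R (F' n) = integral R (F n)" for n
    by (rule integral_spike[OF Z]) (simp add: F'_def)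
  moreover have "integral R G' = integral R (\<lambda>p. if p \<in> polar_rect s then G p else 0)"
  proof (rule integral_spike[OF Z])
    fix p assume p: "p \<in> R - Z"
    then show "(if p \<in> polar_rect s then G p else 0) = G' p"
      using notZ[OF p] by (cases p) (auto simp: G'_def mem_polar_rect)
  qed
  moreover have "polar_rect s \<inter> R = polar_rect s" using polar_rect_mono[of s r] s by auto
  ultimately show ?thesis
    using conv by (simp add: Henstock_Kurzweil_Integration.integral_restrict_Int)
qed

lemma test_function_cone:
  assumes s: "0 < s" "s < r"
  obtains d where "d > 0" "\<And>\<epsilon>. 0 < \<epsilon> \<Longrightarrow> \<epsilon> < d \<Longrightarrow> test_function (cone_test s \<epsilon>)"
proof -
  have sub: "polar_rect s \<subseteq> R" by (rule polar_rect_mono) (use s in simp)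
  have "compact (polar_rect s)" "polar_rect s \<noteq> {}" using s by (auto simp: polar_rect_def intro!: compact_Times)
  moreover have "continuous_on (polar_rect s) (\<lambda>p. norm (\<Phi> p))"
    by (intro continuous_intros continuous_on_subset[OF \<Phi>_continuous(1) sub])
  ultimately obtain q where q: "q \<in> polar_rect s" "\<And>p. p \<in> polar_rect s \<Longrightarrow> norm (\<Phi> p) \<le> norm (\<Phi> q)"
    using continuous_attains_sup by metis
  have "norm (\<Phi> q) < 1" using \<Phi>_interior[of "fst q" "snd q"] q(1) sub s by (auto simp: polar_rect_def)
  then have d: "1 - norm (\<Phi> q) > 0" by simp
  show thesis
  proof (rule that[OF d])
    fix \<epsilon> :: real assume e: "0 < \<epsilon>" "\<epsilon> < 1 - norm (\<Phi> q)"
    have "Ck_on k UNIV (cone_test s \<epsilon>)" for k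
      unfolding cone_test_def using s by (intro Ck_on_average continuous_intros) auto
    moreover have "closure {w. cone_test s \<epsilon> w \<noteq> 0} \<subseteq> ball 0 1"
    proof -
      have "w \<in> cball 0 (norm (\<Phi> q) + \<epsilon>)" if "cone_test s \<epsilon> w \<noteq> 0" for w
      proof (rule ccontr)
        assume w: "w \<notin> cball 0 (norm (\<Phi> q) + \<epsilon>)"
        have "cone_test s \<epsilon> w = integral (polar_rect s) (\<lambda>p. 0)"
          unfolding cone_test_def average_def
        proof (rule integral_cong)
          fix p assume "p \<in> polar_rect s"
          then have "\<epsilon> \<le> norm (w - \<Phi> p)" using q(2)[of p] w norm_triangle_ineq2[of w "\<Phi> p"] by simp
          from mollifier_eq_0[OF e(1) this]
          show "(1 - fst p / s) * J p * mollifier \<epsilon> (w - \<Phi> p) = 0" by simp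
        qed
        then show False using that by simp
      qed
      then have "closure {w. cone_test s \<epsilon> w \<noteq> 0} \<subseteq> cball 0 (norm (\<Phi> q) + \<epsilon>)"
        by (intro closure_minimal) auto
      also have "\<dots> \<subseteq> ball 0 1" using e by (auto simp: subset_eq)
      finally show ?thesis .
    qed
    ultimately show "test_function (cone_test s \<epsilon>)" by (simp add: test_function_def)
  qed
qed

section \<open>The area estimate\<close>

text \<open>
  The covariant derivative of the cone \<open>1 - \<rho>/s\<close>.
\<close>
definition cone_gradient :: "real \<Rightarrow> 2 \<Rightarrow> real \<times> real \<Rightarrow> real" where
  "cone_gradient s i p = - (1/s) * (e p \<bullet> pd i X (\<Phi> p))"

lemma continuous_on_cone_gradient [continuous_intros]: "continuous_on R (cone_gradient s i)"
  unfolding cone_gradient_def[abs_def] by (intro continuous_intros)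

lemma continuous_on_bounded_R:
  fixes F :: "real \<times> real \<Rightarrow> real"
  assumes "continuous_on R F"
  obtains M where "M \<ge> 0" "\<And>p. p \<in> R \<Longrightarrow> \<bar>F p\<bar> \<le> M"
proof -
  have "bounded (F ` R)" using compact_continuous_image[OF assms compact_R] compact_imp_bounded by blast
  then obtain M where "M > 0" "\<forall>x\<in>F ` R. norm x \<le> M" unfolding bounded_pos by blast
  then show thesis by (intro that[of M]) auto
qed

lemma grad_sq_continuous:
  "continuous_on disc p1 \<Longrightarrow> continuous_on disc p2 \<Longrightarrow> continuous_on disc (\<lambda>w. grad_sq X w (p1 w) (p2 w))"
  unfolding grad_sq_def using area_element_pos
  by (intro continuous_intros continuous_on_X continuous_on_W) force+

lemma grad_sq_le:
  "w \<in> disc \<Longrightarrow> \<bar>p1\<bar> \<le> M \<Longrightarrow> \<bar>p2\<bar> \<le> M \<Longrightarrow>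
    grad_sq X w p1 p2 \<le> (M * (norm (pd 1 X w) + norm (pd 2 X w)) / W w)\<^sup>2"
proof -
  assume *: "w \<in> disc" "\<bar>p1\<bar> \<le> M" "\<bar>p2\<bar> \<le> M"
  have "norm (p1 *\<^sub>R pd 2 X w - p2 *\<^sub>R pd 1 X w) \<le> norm (p1 *\<^sub>R pd 2 X w) + norm (p2 *\<^sub>R pd 1 X w)"
    by (rule norm_triangle_ineq4)
  also have "\<dots> = \<bar>p1\<bar> * norm (pd 2 X w) + \<bar>p2\<bar> * norm (pd 1 X w)" by simp
  also have "\<dots> \<le> M * norm (pd 2 X w) + M * norm (pd 1 X w)"
    using * by (intro add_mono mult_right_mono) auto
  finally show ?thesis
    unfolding grad_sq_def using area_element_pos[OF *(1)]
    by (intro power_mono divide_right_mono) (auto simp: algebra_simps)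
qed

text \<open>
  Here \<open>q\<close> is dropped by its sign, and the weighted gradient is replaced by the induced one at the price
  of the factor \<open>1 + g0\<close>.
\<close>
lemma stability_polar:
  assumes G: "weight_matrix G g0" and st: "mu_stable G X \<mu> q" and q0: "\<forall>w\<in>disc. q w \<ge> 0"
    and test: "test_function \<phi>"
  shows "\<mu> * integral R (\<lambda>p. - (K (\<Phi> p) * f p * (\<phi> (\<Phi> p))\<^sup>2))
    \<le> (1 + g0) * integral R (\<lambda>p. grad_sq X (\<Phi> p) (pd 1 \<phi> (\<Phi> p)) (pd 2 \<phi> (\<Phi> p)) * f p)"
proof -
  have g0: "g0 \<ge> 0" using G by (simp add: weight_matrix_def)
  have \<mu>: "\<mu> > 0" and qc: "continuous_on disc q"
    and ineq: "\<mu> * integral disc (\<lambda>w. (q w - K w) * W w * (\<phi> w)\<^sup>2) \<le> integral disc (\<lambda>w. weighted_grad G X \<phi> \<phi> w * W w)"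
  proof -
    have "Ck_on 1 disc q" using st unfolding mu_stable_def by blast
    then show "continuous_on disc q" by (rule Ck_on_imp_continuous_on)
  qed (use st test in \<open>unfold mu_stable_def, blast\<close>)+
  have Ck_\<phi>: "Ck_on 1 disc \<phi>"
  proof -
    have "Ck_on 1 UNIV \<phi>" using test by (simp add: test_function_def)
    then obtain D where "\<And>x. (\<phi> has_derivative (\<lambda>h. \<Sum>b\<in>Basis. (h \<bullet> b) *\<^sub>R D b x)) (at x)" "\<And>b. b \<in> Basis \<Longrightarrow> continuous_on UNIV (D b)"
      unfolding One_nat_def Ck_on.simps by auto
    then show ?thesis unfolding One_nat_def
      by (intro Ck_on_SucI[where D=D]) (auto intro: has_derivative_at_withinI continuous_on_subset)
  qed
  have \<phi>c: "continuous_on disc \<phi>" "continuous_on disc (pd i \<phi>)" for i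
  proof -
    show "continuous_on disc \<phi>" by (rule Ck_on_imp_continuous_on[OF Ck_\<phi>])
    have "Ck_on 0 disc (pd i \<phi>)" by (rule Ck_on_pd) (use Ck_\<phi> in \<open>simp only: One_nat_def\<close>)
    then show "continuous_on disc (pd i \<phi>)" by (rule Ck_on_imp_continuous_on)
  qed
  let ?g = "\<lambda>w. grad_sq X w (pd 1 \<phi> w) (pd 2 \<phi> w) * W w"
  let ?k = "\<lambda>w. - (K w * W w * (\<phi> w)\<^sup>2)"
  have gc: "continuous_on disc ?g" by (intro continuous_intros grad_sq_continuous \<phi>c continuous_on_W)
  have kc: "continuous_on disc ?k" by (intro continuous_intros continuous_on_K continuous_on_W \<phi>c)
  have g0': "0 \<le> (1 + g0) * ?g w" if "w \<in> disc" for w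
    using g0 area_element_pos[OF that] by (simp add: grad_sq_def)
  have gi: "(\<lambda>w. (1 + g0) * ?g w) integrable_on disc"
    by (intro integrable_on_disc continuous_intros gc)
  have "\<mu> * integral disc ?k \<le> \<mu> * integral disc (\<lambda>w. (q w - K w) * W w * (\<phi> w)\<^sup>2)"
  proof (intro mult_left_mono integral_le integrable_on_disc kc)
    show "continuous_on disc (\<lambda>w. (q w - K w) * W w * (\<phi> w)\<^sup>2)"
      by (intro continuous_intros continuous_on_K continuous_on_W \<phi>c qc)
    fix w assume "w \<in> disc"
    then have "0 \<le> q w * W w * (\<phi> w)\<^sup>2" using q0 area_element_pos[of w] by (intro mult_nonneg_nonneg) auto
    then show "?k w \<le> (q w - K w) * W w * (\<phi> w)\<^sup>2" by (simp add: algebra_simps)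
  qed (use \<mu> in simp)
  also note ineq
  also have "integral disc (\<lambda>w. weighted_grad G X \<phi> \<phi> w * W w) \<le> integral disc (\<lambda>w. (1 + g0) * ?g w)"
  proof (cases "(\<lambda>w. weighted_grad G X \<phi> \<phi> w * W w) integrable_on disc")
    case True
    then show ?thesis
    proof (rule integral_le[OF _ gi])
      fix w assume w: "w \<in> disc"
      show "weighted_grad G X \<phi> \<phi> w * W w \<le> (1 + g0) * ?g w"
        using mult_right_mono[OF weighted_grad_le[OF G w, of \<phi>], of "W w"] area_element_pos[OF w] by (simp add: mult.assoc)
    qed
  next
    case False
    \<comment> \<open>By convention the integral of a non-integrable function is \<open>0\<close>; the right side is nonnegative.\<close>
    then show ?thesis using integral_nonneg[OF gi g0'] by (simp add: not_integrable_integral)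
  qed
  also have "\<dots> = (1 + g0) * integral R (\<lambda>p. ?g (\<Phi> p) * J p)"
    by (simp only: integral_mult_right integral_disc_polar[OF gc])
  finally show ?thesis
    unfolding integral_disc_polar[OF kc] f_def by (simp add: mult_ac)
qed

text \<open>
  The stability inequality for the mollified cones is passed to the limit \<open>\<epsilon> \<rightarrow> 0\<close>. Since
  \<open>|\<nabla>(1 - \<rho>/s)| = 1/s\<close>, the gradient term becomes \<open>(1 + g0)/s\<^sup>2\<close> times the area of the geodesic disc
  of radius \<open>s\<close>; the curvature term is evaluated by \<open>radial_identity\<close>. One takes \<open>s < r\<close> to keep the
  supports inside the open disc.
\<close>
lemma area_growth:
  assumes G: "weight_matrix G g0" and st: "mu_stable G X \<mu> q" and q0: "\<forall>w\<in>disc. q w \<ge> 0"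
    and s: "0 < s" "s < r"
  shows "(2 * \<mu> - (1 + g0)) * integral (polar_rect s) f \<le> 2 * pi * \<mu> * s\<^sup>2"
proof -
  have sub: "polar_rect s \<subseteq> R" by (rule polar_rect_mono) (use s in simp)
  obtain d where d: "d > 0" "\<And>\<epsilon>. 0 < \<epsilon> \<Longrightarrow> \<epsilon> < d \<Longrightarrow> test_function (cone_test s \<epsilon>)"
    using test_function_cone[OF s] by blast
  define \<epsilon> where "\<epsilon> n = d * inverse (real (Suc (Suc n)))" for n
  have \<epsilon>: "\<epsilon> n > 0" "\<epsilon> n < d" for n
  proof -
    have "inverse (real (Suc (Suc n))) < 1" by (rule inverse_less_1_iff[THEN iffD2]) simp
    from mult_strict_left_mono[OF this d(1)] show "\<epsilon> n < d" by (simp add: \<epsilon>_def)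
    show "\<epsilon> n > 0" unfolding \<epsilon>_def using d(1) by (intro mult_pos_pos) simp_all
  qed
  have \<epsilon>0: "\<epsilon> \<longlonglongrightarrow> 0"
    unfolding \<epsilon>_def by (intro tendsto_mult_right_zero LIMSEQ_Suc[OF LIMSEQ_inverse_real_of_nat])
  let ?h = "\<lambda>p::real\<times>real. 1 - fst p / s"
  let ?\<eta> = "\<lambda>n p. cone_test s (\<epsilon> n) (\<Phi> p)"
  let ?g = "\<lambda>n i p. pd i (cone_test s (\<epsilon> n)) (\<Phi> p)"
  have hc: "continuous_on R ?h" using s by (intro continuous_intros) auto
  have g_eq: "?g n i p = average s (\<epsilon> n) (cone_gradient s i) (\<Phi> p)" if "p \<in> R" for n i p
    unfolding cone_gradient_def[abs_def] by (rule pd_cone_test[OF s(1) less_imp_le[OF s(2)] \<Phi>_disc[OF that]])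
  have avc: "continuous_on R (\<lambda>p. average s (\<epsilon> n) m (\<Phi> p))" if "continuous_on R m" for n m
    by (rule continuous_on_compose2[OF Ck_on_imp_continuous_on[OF Ck_on_average[of s m 0]] \<Phi>_continuous(1)])
      (use s that in auto)
  have \<eta>c: "continuous_on R (?\<eta> n)" for n
    unfolding cone_test_def by (rule avc[OF hc])
  have gc: "continuous_on R (?g n i)" for n i
    by (rule continuous_on_eq[OF avc[OF continuous_on_cone_gradient]]) (rule g_eq[symmetric])
  have Wne: "\<forall>p\<in>R. W (\<Phi> p) \<noteq> 0" using W_pos by force
  obtain Mh where Mh: "\<And>p. p \<in> R \<Longrightarrow> \<bar>?h p\<bar> \<le> Mh" using continuous_on_bounded_R[OF hc] by blast
  obtain M1 where "M1 \<ge> 0" and M1: "\<And>p. p \<in> R \<Longrightarrow> \<bar>cone_gradient s 1 p\<bar> \<le> M1" by (rule continuous_on_bounded_R[OF continuous_on_cone_gradient[of s 1]]) (rule that)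
  obtain M2 where "M2 \<ge> 0" and M2: "\<And>p. p \<in> R \<Longrightarrow> \<bar>cone_gradient s 2 p\<bar> \<le> M2" by (rule continuous_on_bounded_R[OF continuous_on_cone_gradient[of s 2]]) (rule that)
  have M: "\<bar>cone_gradient s 1 p\<bar> \<le> max M1 M2" "\<bar>cone_gradient s 2 p\<bar> \<le> max M1 M2" if "p \<in> R" for p
    using M1[OF that] M2[OF that] by simp_all
  have \<eta>b: "\<bar>?\<eta> n p\<bar> \<le> Mh" for n p
    unfolding cone_test_def using average_bound[OF less_imp_le[OF s(2)] hc Mh \<epsilon>(1)] .
  have gb: "\<bar>?g n 1 p\<bar> \<le> max M1 M2" "\<bar>?g n 2 p\<bar> \<le> max M1 M2" if "p \<in> R" for n p
    unfolding g_eq[OF that]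
    using average_bound[OF less_imp_le[OF s(2)] continuous_on_cone_gradient M(1) \<epsilon>(1)] average_bound[OF less_imp_le[OF s(2)] continuous_on_cone_gradient M(2) \<epsilon>(1)] by blast+
  let ?F1 = "\<lambda>n p. - (K (\<Phi> p) * f p * (?\<eta> n p)\<^sup>2)"
  let ?F2 = "\<lambda>n p. grad_sq X (\<Phi> p) (?g n 1 p) (?g n 2 p) * f p"
  have lim1: "(\<lambda>n. integral R (?F1 n)) \<longlonglongrightarrow> integral (polar_rect s) (\<lambda>p. - (K (\<Phi> p) * f p * (?h p)\<^sup>2))"
  proof -
    obtain C where C: "C \<ge> 0" "\<And>p. p \<in> R \<Longrightarrow> \<bar>K (\<Phi> p) * f p\<bar> \<le> C"
      by (rule continuous_on_bounded_R[OF continuous_on_mult[OF continuous_on_comp_\<Phi>[OF continuous_on_K] continuous_on_f(1)]]) (rule that)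
    show ?thesis
    proof (rule polar_dominated_convergence[OF s])
      show "continuous_on R (?F1 n)" for n by (intro continuous_intros \<eta>c)
      show "\<bar>?F1 n p\<bar> \<le> C * Mh\<^sup>2" if "p \<in> R" for n p
      proof -
        have "(?\<eta> n p)\<^sup>2 \<le> Mh\<^sup>2" using \<eta>b[of n p] abs_le_square_iff[of "?\<eta> n p" Mh] by force
        then have "\<bar>K (\<Phi> p) * f p\<bar> * (?\<eta> n p)\<^sup>2 \<le> C * Mh\<^sup>2" using C that by (intro mult_mono) auto
        then show ?thesis by (simp add: abs_mult)
      qed
      fix \<rho> \<theta> assume p: "(\<rho>, \<theta>) \<in> {0<..<r} \<times> {0<..<2*pi}" "\<rho> \<noteq> s"
      have "(\<lambda>n. ?F1 n (\<rho>, \<theta>)) \<longlonglongrightarrow> - (K (\<Phi> (\<rho>, \<theta>)) * f (\<rho>, \<theta>) * (if \<rho> < s then ?h (\<rho>, \<theta>) else 0)\<^sup>2)"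
        unfolding cone_test_def by (intro tendsto_intros average_tendsto[OF s hc p \<epsilon>(1) \<epsilon>0])
      then show "(\<lambda>n. ?F1 n (\<rho>, \<theta>)) \<longlonglongrightarrow> (if \<rho> < s then - (K (\<Phi> (\<rho>, \<theta>)) * f (\<rho>, \<theta>) * (?h (\<rho>, \<theta>))\<^sup>2) else 0)"
        by (auto split: if_splits)
    qed
  qed
  have lim2: "(\<lambda>n. integral R (?F2 n)) \<longlonglongrightarrow> integral (polar_rect s) (\<lambda>p. (1/s)\<^sup>2 * f p)"
  proof -
    let ?b = "\<lambda>p. (max M1 M2 * (norm (pd 1 X (\<Phi> p)) + norm (pd 2 X (\<Phi> p))) / W (\<Phi> p))\<^sup>2 * f p"
    have "continuous_on R ?b" by (intro continuous_intros Wne)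
    then obtain C where "C \<ge> 0" and C: "\<And>p. p \<in> R \<Longrightarrow> \<bar>?b p\<bar> \<le> C"
      by (rule continuous_on_bounded_R) (rule that)
    show ?thesis
    proof (rule polar_dominated_convergence[OF s])
      show "continuous_on R (?F2 n)" for n
        unfolding grad_sq_def by (intro continuous_intros gc Wne)
      show "\<bar>?F2 n p\<bar> \<le> C" if p: "p \<in> R" for n p
      proof -
        have "\<bar>?F2 n p\<bar> = ?F2 n p" using f_nonneg[OF p] by (simp add: grad_sq_def)
        also have "\<dots> \<le> ?b p" by (intro mult_right_mono grad_sq_le \<Phi>_disc p gb f_nonneg)
        finally show ?thesis using C[OF p] by simp
      qed
      fix \<rho> \<theta> assume p: "(\<rho>, \<theta>) \<in> {0<..<r} \<times> {0<..<2*pi}" "\<rho> \<noteq> s"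
      let ?p = "(\<rho>, \<theta>)"
      have pR: "?p \<in> R" using p by (auto simp: R_iff)
      have "(\<lambda>n. ?g n i ?p) \<longlonglongrightarrow> (if \<rho> < s then cone_gradient s i ?p else 0)" for i
        unfolding g_eq[OF pR] by (rule average_tendsto[OF s continuous_on_cone_gradient p \<epsilon>(1) \<epsilon>0])
      then have "(\<lambda>n. ?F2 n ?p) \<longlonglongrightarrow> grad_sq X (\<Phi> ?p) (if \<rho> < s then cone_gradient s 1 ?p else 0) (if \<rho> < s then cone_gradient s 2 ?p else 0) * f ?p"
        unfolding grad_sq_def using Wne pR by (intro tendsto_intros) auto
      moreover have "grad_sq X (\<Phi> ?p) (cone_gradient s 1 ?p) (cone_gradient s 2 ?p) = (1/s)\<^sup>2"
      proof -
        let ?v = "(- (1/s)) *\<^sub>R e ?p"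
        have "cone_gradient s i ?p = ?v \<bullet> pd i X (\<Phi> ?p)" for i by (simp add: cone_gradient_def)
        moreover have "N (\<Phi> ?p) \<bullet> ?v = 0" using n_orth(2)[OF pR] by simp
        ultimately have "grad_sq X (\<Phi> ?p) (cone_gradient s 1 ?p) (cone_gradient s 2 ?p) = ?v \<bullet> ?v"
          using grad_sq_tangent[OF \<Phi>_disc[OF pR]] by (simp only:)
        also have "\<dots> = (1/s)\<^sup>2" using e_e[OF pR] by (simp add: power2_eq_square)
        finally show ?thesis .
      qed
      moreover have "grad_sq X (\<Phi> ?p) 0 0 = 0" by (simp add: grad_sq_def)
      ultimately show "(\<lambda>n. ?F2 n ?p) \<longlonglongrightarrow> (if \<rho> < s then (1/s)\<^sup>2 * f ?p else 0)"
        by (cases "\<rho> < s") (simp_all only: if_True if_False mult_zero_left)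
    qed
  qed
  have "\<mu> * integral (polar_rect s) (\<lambda>p. - (K (\<Phi> p) * f p * (?h p)\<^sup>2)) \<le> (1 + g0) * integral (polar_rect s) (\<lambda>p. (1/s)\<^sup>2 * f p)"
    using stability_polar[OF G st q0 d(2)[OF \<epsilon>]]
    by (intro LIMSEQ_le[OF tendsto_mult_left[OF lim1] tendsto_mult_left[OF lim2]]) auto
  moreover have "integral (polar_rect s) (\<lambda>p. - (K (\<Phi> p) * f p * (?h p)\<^sup>2)) = 2/s\<^sup>2 * integral (polar_rect s) f - 2 * pi"
  proof -
    have c: "continuous_on (polar_rect s) (\<lambda>p. K (\<Phi> p) * f p * (?h p)\<^sup>2)"
      by (intro continuous_on_subset[OF _ sub] continuous_intros hc)
    have fc: "continuous_on (polar_rect s) f" by (rule continuous_on_subset[OF continuous_on_f(1) sub])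
    have "integral (polar_rect s) (\<lambda>p. K (\<Phi> p) * f p * (?h p)\<^sup>2) = integral {0..2*pi} (\<lambda>\<theta>. 1 - 2/s\<^sup>2 * integral {0..s} (\<lambda>\<rho>. f (\<rho>, \<theta>)))"
      unfolding integral_polar_rect(2)[OF c] fst_conv using radial_identity[OF s(1) less_imp_le[OF s(2)]] by (rule integral_cong)
    also have "\<dots> = integral {0..2*pi} (\<lambda>\<theta>. 1) - integral {0..2*pi} (\<lambda>\<theta>. 2/s\<^sup>2 * integral {0..s} (\<lambda>\<rho>. f (\<rho>, \<theta>)))"
    proof (intro integral_diff integrable_continuous_real continuous_intros)
      have "continuous_on ({0..2*pi} \<times> cbox 0 s) (\<lambda>(\<theta>, \<rho>). f (\<rho>, \<theta>))"
        unfolding case_prod_unfold by (rule continuous_on_compose2[OF fc]) (auto simp: mem_polar_rect intro!: continuous_intros)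
      from integral_continuous_on_param[OF this]
      show "continuous_on {0..2*pi} (\<lambda>\<theta>. integral {0..s} (\<lambda>\<rho>. f (\<rho>, \<theta>)))" by (simp add: cbox_interval)
    qed
    also have "\<dots> = 2 * pi - 2/s\<^sup>2 * integral (polar_rect s) f"
      unfolding integral_mult_right integral_polar_rect(2)[OF fc] by simp
    finally show ?thesis by (simp add: integral_neg)
  qed
  ultimately have "\<mu> * (2/s\<^sup>2 * integral (polar_rect s) f - 2 * pi) \<le> (1 + g0) * ((1/s)\<^sup>2 * integral (polar_rect s) f)"
    by (simp only: integral_mult_right)
  from mult_right_mono[OF this, of "s\<^sup>2"]
  have "\<mu> * ((2/s\<^sup>2 * integral (polar_rect s) f - 2 * pi) * s\<^sup>2) \<le> (1 + g0) * (((1/s)\<^sup>2 * s\<^sup>2) * integral (polar_rect s) f)"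
    by (simp only: mult_ac zero_le_power2)
  moreover have "(2/s\<^sup>2 * integral (polar_rect s) f - 2 * pi) * s\<^sup>2 = 2 * integral (polar_rect s) f - 2 * pi * s\<^sup>2"
    using s by (simp add: left_diff_distrib)
  moreover have "(1/s)\<^sup>2 * s\<^sup>2 = 1" using s by (simp add: power_divide)
  ultimately have "\<mu> * (2 * integral (polar_rect s) f - 2 * pi * s\<^sup>2) \<le> (1 + g0) * integral (polar_rect s) f" by simp
  then show ?thesis by (simp add: algebra_simps)
qed

lemma area_bound:
  assumes G: "weight_matrix G g0" and st: "mu_stable G X \<mu> q" and q0: "\<forall>w\<in>disc. q w \<ge> 0"
  shows "(2 * \<mu> - (1 + g0)) * area X \<le> 2 * pi * \<mu> * r\<^sup>2"
proof -
  let ?m = "\<lambda>\<rho>. integral {0..2*pi} (\<lambda>\<theta>. f (\<rho>, \<theta>))"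
  let ?a = "\<lambda>s. integral {0..s} ?m"
  have "continuous_on ({0..r} \<times> cbox 0 (2*pi)) (\<lambda>(\<rho>, \<theta>). f (\<rho>, \<theta>))"
    by (simp add: continuous_on_f(1)[unfolded polar_rect_def] cbox_interval)
  from integral_continuous_on_param[OF this] have "continuous_on {0..r} ?m" by (simp add: cbox_interval)
  then have ac: "continuous_on {0..r} ?a"
    by (intro indefinite_integral_continuous_1 integrable_continuous_real)
  have a: "integral (polar_rect s) f = ?a s" if "s \<le> r" for s
    by (rule integral_polar_rect(1)[OF continuous_on_subset[OF continuous_on_f(1) polar_rect_mono[OF that]]])
  let ?b = "\<lambda>s. 2 * pi * \<mu> * s\<^sup>2 - (2 * \<mu> - (1 + g0)) * ?a s"
  have cl: "closure {0<..<r} = {0..r}" using r by (rule closure_greaterThanLessThan)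
  have "continuous_on {0..r} ?b" by (intro continuous_on_diff continuous_on_mult continuous_on_const continuous_on_power continuous_on_id ac)
  moreover have "?b s \<ge> 0" if "s \<in> {0<..<r}" for s
    using area_growth[OF G st q0, of s] a[of s] that by simp
  ultimately have "?b r \<ge> 0"
    using continuous_ge_on_closure[of "{0<..<r}" ?b r 0] r unfolding cl by simp
  then show ?thesis using a[of r] by (simp add: area_eq)
qed

end

theorem mainTheorem1:
  fixes X :: "real^2 \<Rightarrow> real^3" and G :: "real^3 \<Rightarrow> real^3 \<Rightarrow> real^3^3"
    and q :: "real^2 \<Rightarrow> real" and \<mu> g0 r :: real and X0 :: "real^3"
  assumes "immersion X"
    and "weight_matrix G g0"
    and "mu_stable G X \<mu> q"
    and "\<mu> > (1 + g0) / 2"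
    and "\<forall>w\<in>disc. q w \<ge> 0"
    and "r > 0"
    and "geodesic_disc X r X0"
  shows "area X \<le> 2 * pi * \<mu> / (2 * \<mu> - (1 + g0)) * r\<^sup>2"
proof -
  have "\<exists>\<Phi> P w0. polar_disc X r \<Phi> P w0"
    using assms(7)
    unfolding geodesic_disc_def polar_disc_def polar_disc_axioms_def immersed_disc_def
    by (elim ex_forward conjE, intro conjI)
      (assumption | rule assms | (rule ballI, drule (1) bspec, erule conjunct2))+
  then obtain \<Phi> P w0 where "polar_disc X r \<Phi> P w0" by blast
  then interpret polar_disc X r \<Phi> P w0 .
  have "area X \<le> (2 * pi * \<mu> * r\<^sup>2) / (2 * \<mu> - (1 + g0))"
    using area_bound[OF assms(2,3,5)] assms(4) by (subst pos_le_divide_eq) (simp_all add: mult.commute)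
  then show ?thesis by simp
qed

end
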